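(* Let $\Gamma$ be the amalgamated product $S_4\ast_{C_2\times C_2}S_4$, where the subgroup $\{1,(12)(34),(13)(24),(14)(23)\}$ of the first factor is identified with the subgroup $\{1,(12),(34),(12)(34)\}$ of the second factor via the isomorphism $(12)(34)\mapsto(12)(34)$, $(13)(24)\mapsto(12)$, $(14)(23)\mapsto(34)$. Then $\mu(\Gamma)=\frac14$ and $\chi(\Gamma)=-\frac16$.
   Context: For a finitely generated group $\Gamma$, $s_n(\Gamma)$ denotes the number of subgroups of index $n$ in $\Gamma$, and the growth coefficient of $\Gamma$ is $$\mu(\Gamma)=\limsup_{n\to\infty}\frac{\log s_n(\Gamma)}{n\log n}.$$ $\chi(\Gamma)$ is the (rational) Euler characteristic of the virtually free group $\Gamma$; for an amalgamated product of finite groups, $\chi(G\ast_U H)=\frac1{|G|}+\frac1{|H|}-\frac1{|U|}$. *)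

theory Defs
  imports
    "HOL-Algebra.Sym_Groups"
    "HOL-Library.Extended_Real"
begin

section \<open>Amalgamated products\<close>

text \<open>
  The amalgamated product of \<open>G\<close> and \<open>H\<close> in which each element \<open>a\<close> of \<open>A \<subseteq> carrier G\<close> is
  identified with \<open>\<phi> a \<in> carrier H\<close>: words in the disjoint union of the two carriers, modulo
  the smallest congruence that contains the multiplication tables of \<open>G\<close> and \<open>H\<close> and identifies
  \<open>a\<close> with \<open>\<phi> a\<close>. When \<open>\<phi>\<close> is an isomorphism from \<open>A \<le> G\<close> onto a subgroup of \<open>H\<close>, this is the
  usual amalgam of \<open>G\<close> and \<open>H\<close> along \<open>A\<close>.
\<close>

definition amalgam_words ::
    "('a, 'm) monoid_scheme \<Rightarrow> ('b, 'n) monoid_scheme \<Rightarrow> ('a + 'b) list set" where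
  "amalgam_words G H = lists (Inl ` carrier G \<union> Inr ` carrier H)"

inductive amalgam_eq ::
    "('a, 'm) monoid_scheme \<Rightarrow> ('b, 'n) monoid_scheme \<Rightarrow> 'a set \<Rightarrow> ('a \<Rightarrow> 'b) \<Rightarrow>
      ('a + 'b) list \<Rightarrow> ('a + 'b) list \<Rightarrow> bool"
  for G H A \<phi> where
  refl: "w \<in> amalgam_words G H \<Longrightarrow> amalgam_eq G H A \<phi> w w"
| sym: "amalgam_eq G H A \<phi> v w \<Longrightarrow> amalgam_eq G H A \<phi> w v"
| trans: "amalgam_eq G H A \<phi> u v \<Longrightarrow> amalgam_eq G H A \<phi> v w \<Longrightarrow> amalgam_eq G H A \<phi> u w"
| append: "amalgam_eq G H A \<phi> v v' \<Longrightarrow> amalgam_eq G H A \<phi> w w' \<Longrightarrow>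
    amalgam_eq G H A \<phi> (v @ w) (v' @ w')"
| one_left: "amalgam_eq G H A \<phi> [Inl \<one>\<^bsub>G\<^esub>] []"
| one_right: "amalgam_eq G H A \<phi> [Inr \<one>\<^bsub>H\<^esub>] []"
| mult_left: "x \<in> carrier G \<Longrightarrow> y \<in> carrier G \<Longrightarrow>
    amalgam_eq G H A \<phi> [Inl x, Inl y] [Inl (x \<otimes>\<^bsub>G\<^esub> y)]"
| mult_right: "x \<in> carrier H \<Longrightarrow> y \<in> carrier H \<Longrightarrow>
    amalgam_eq G H A \<phi> [Inr x, Inr y] [Inr (x \<otimes>\<^bsub>H\<^esub> y)]"
| identify: "a \<in> A \<Longrightarrow> amalgam_eq G H A \<phi> [Inl a] [Inr (\<phi> a)]"

definition amalgamated_product ::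
    "('a, 'm) monoid_scheme \<Rightarrow> ('b, 'n) monoid_scheme \<Rightarrow> 'a set \<Rightarrow> ('a \<Rightarrow> 'b) \<Rightarrow>
      ('a + 'b) list set monoid" where
  "amalgamated_product G H A \<phi> =
    \<lparr> carrier = amalgam_words G H // {(v, w). amalgam_eq G H A \<phi> v w},
      mult = (\<lambda>X Y. {w. \<exists>x\<in>X. \<exists>y\<in>Y. amalgam_eq G H A \<phi> (x @ y) w}),
      one = {w. amalgam_eq G H A \<phi> [] w} \<rparr>"


section \<open>Subgroup growth\<close>

text \<open>
  For \<open>n = 0\<close> this would count subgroups of infinite index, because \<open>card\<close> of an infinite set
  is \<open>0\<close>; this has no effect on the limit superior below.
\<close>

definition subgroup_count :: "('a, 'm) monoid_scheme \<Rightarrow> nat \<Rightarrow> nat" where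
  "subgroup_count G n = card {S. subgroup S G \<and> card (rcosets\<^bsub>G\<^esub> S) = n}"

text \<open>The case distinction implements \<open>log 0 = -\<infinity>\<close>, whereas \<open>ln 0 = 0\<close> in the library.\<close>

definition growth_coefficient :: "('a, 'm) monoid_scheme \<Rightarrow> ereal" where
  "growth_coefficient G =
    limsup (\<lambda>n. if subgroup_count G n = 0 then - \<infinity>
                else ereal (ln (real (subgroup_count G n)) / (real n * ln (real n))))"


section \<open>The rational Euler characteristic of a virtually free group\<close>

text \<open>A letter \<open>(x, True)\<close> stands for \<open>x\<close> and \<open>(x, False)\<close> for its inverse.\<close>

definition letter_value :: "('a, 'm) monoid_scheme \<Rightarrow> 'a \<times> bool \<Rightarrow> 'a" where
  "letter_value G l = (if snd l then fst l else inv\<^bsub>G\<^esub> (fst l))"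

definition word_value :: "('a, 'm) monoid_scheme \<Rightarrow> ('a \<times> bool) list \<Rightarrow> 'a" where
  "word_value G w = foldr (\<lambda>l g. letter_value G l \<otimes>\<^bsub>G\<^esub> g) w \<one>\<^bsub>G\<^esub>"

definition reduced_word :: "('a \<times> bool) list \<Rightarrow> bool" where
  "reduced_word w = successively (\<lambda>k l. \<not> (fst k = fst l \<and> snd k \<noteq> snd l)) w"

definition freely_generated_by :: "('a, 'm) monoid_scheme \<Rightarrow> 'a set \<Rightarrow> bool" where
  "freely_generated_by G X \<longleftrightarrow>
    X \<subseteq> carrier G \<and> generate G X = carrier G \<and>
    (\<forall>w. set w \<subseteq> X \<times> UNIV \<and> reduced_word w \<and> w \<noteq> [] \<longrightarrow> word_value G w \<noteq> \<one>\<^bsub>G\<^esub>)"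

text \<open>
  \<open>\<chi>(G) = \<chi>(F) / [G : F] = (1 - r) / [G : F]\<close> for a free subgroup \<open>F\<close> of finite rank \<open>r\<close> and
  finite index; by Schreier's index formula this does not depend on \<open>F\<close>. The value is
  unspecified if there is no such subgroup.
\<close>

definition euler_characteristic :: "('a, 'm) monoid_scheme \<Rightarrow> rat" where
  "euler_characteristic G =
    (THE q. \<exists>F X. subgroup F G \<and> finite (rcosets\<^bsub>G\<^esub> F) \<and>
       finite X \<and> freely_generated_by (G\<lparr>carrier := F\<rparr>) X \<and>
       q = (1 - of_nat (card X)) / of_nat (card (rcosets\<^bsub>G\<^esub> F)))"

end

(*
  Growth. A subgroup of index n with a numbering of its cosets is a transitive action of \<Gamma> on n
  points. Let G and H be the two factors. There are at most C^n n^(n + a - g - h) actions in which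
  V, G and H have a, g and h orbits, because an action is determined, up to C^n choices, by the
  G- and H-orbit of each V-orbit and by the V-orbits. Burnside's lemma gives a <= 6 g and
  10 a <= 12 h + 3 n, hence a - g - h <= n/4. The bound is attained by the H-set of two-element
  subsets of {1,2,3,4}, whose W-orbits are two fixed points and one free orbit. Matching six copies
  of it with the G-sets G, G/V, G/V gives 36 points and a graph whose fundamental group is free of
  rank 10, and k layers of this can be permuted along the 12 edges with fixed points. Two of these
  permutations make the copies of a layer connected and a third one joins the layers, so that
  (k!)^9 different subgroups of index 36 k remain.

  Euler characteristic. A bijection between transversals of V in G and of W in H defines a transitive
  action on 24 points. The stabilizer of a point is free of rank 5, as it acts like a free group on
  reduced words. The quotient (1 - r)/m is the same for every free subgroup of rank r and index m,
  because the cocycles with values in the group of order two on G/F x G/F' can be counted over either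
  factor.
*)
theory Submission
  imports Defs "HOL-Algebra.Group_Action" "HOL-Real_Asymp.Real_Asymp"
begin

section \<open>Amalgamated products\<close>

text \<open>Elements of the amalgam are never put into a normal form. By the universal property an
  action of \<Gamma> is a pair of actions of the factors that agree on the common subgroup, so every
  action constructed below is a matching between a G-set and an H-set. The extremal sets are read
  off from equality in the two orbit inequalities. Equality in a <= 6 g means that all point
  stabilizers in the first factor lie in V, as for G and G/V; equality in 10 a <= 12 h + 3 n holds
  for the pairs, where a = 3, h = 1 and n = 6. As V is normal, G/V consists of six V-fixed points,
  while G consists of six free V-orbits, so six copies of the pairs match exactly one G and two G/V.
  Over a V-fixed point the layers may be permuted arbitrarily. The Euler characteristic is defined
  through an arbitrary free subgroup of finite index, so uniqueness of its value has to be proved.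
  Counting cocycles uses only the universal property of free groups, whereas passing to the
  intersection of two free subgroups would need the freeness and the rank of that
  intersection.\<close>

locale amalgam = G: group G + H: group H
  for G :: "('a, 'm) monoid_scheme" and H :: "('b, 'n) monoid_scheme" +
  fixes A :: "'a set" and \<phi> :: "'a \<Rightarrow> 'b"
  assumes A_subset: "A \<subseteq> carrier G" and \<phi>_closed: "\<phi> ` A \<subseteq> carrier H"
begin

abbreviation weq (infix "\<approx>" 50) where "v \<approx> w \<equiv> amalgam_eq G H A \<phi> v w"
abbreviation "\<Gamma> \<equiv> amalgamated_product G H A \<phi>"
definition cls where "cls w = {v. w \<approx> v}"
definition inl where "inl g = cls [Inl g]"
definition inr where "inr h = cls [Inr h]"

lemma weq_words: "v \<approx> w \<Longrightarrow> v \<in> amalgam_words G H \<and> w \<in> amalgam_words G H"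
  by (induction rule: amalgam_eq.induct) (use A_subset \<phi>_closed in \<open>auto simp: amalgam_words_def\<close>)

lemma cls_eq_iff: "w \<in> amalgam_words G H \<Longrightarrow> cls v = cls w \<longleftrightarrow> v \<approx> w"
  unfolding cls_def by (auto intro: amalgam_eq.intros)

lemma cls_eqI: "v \<approx> w \<Longrightarrow> cls v = cls w"
  using cls_eq_iff weq_words by blast

lemma carrier_\<Gamma>: "carrier \<Gamma> = cls ` amalgam_words G H"
  unfolding amalgamated_product_def cls_def quotient_def by (auto simp: Image_def)

lemma words_append: "v @ w \<in> amalgam_words G H \<longleftrightarrow> v \<in> amalgam_words G H \<and> w \<in> amalgam_words G H"
  by (auto simp: amalgam_words_def)

lemma nil_word: "[] \<in> amalgam_words G H"
  by (simp add: amalgam_words_def)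

lemma mult_cls:
  assumes "v \<in> amalgam_words G H" "w \<in> amalgam_words G H"
  shows "cls v \<otimes>\<^bsub>\<Gamma>\<^esub> cls w = cls (v @ w)"
proof -
  have "(\<exists>x\<in>cls v. \<exists>y\<in>cls w. (x @ y) \<approx> u) \<longleftrightarrow> (v @ w) \<approx> u" for u
    using assms unfolding cls_def
    by (auto intro: amalgam_eq.intros dest: amalgam_eq.append)
  then show ?thesis
    unfolding amalgamated_product_def by (auto simp: cls_def)
qed

lemma one_cls: "\<one>\<^bsub>\<Gamma>\<^esub> = cls []"
  unfolding amalgamated_product_def cls_def by simp

primrec letter_inv where
  "letter_inv (Inl g) = Inl (inv\<^bsub>G\<^esub> g)"
| "letter_inv (Inr h) = Inr (inv\<^bsub>H\<^esub> h)"

lemma word_inverse: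
  assumes "w \<in> amalgam_words G H"
  shows "rev (map letter_inv w) \<in> amalgam_words G H \<and> (rev (map letter_inv w) @ w) \<approx> []"
  using assms
proof (induction w)
  case Nil then show ?case by (auto simp: amalgam_words_def intro: amalgam_eq.refl)
next
  case (Cons l w)
  then have w: "w \<in> amalgam_words G H" and l: "l \<in> Inl ` carrier G \<union> Inr ` carrier H"
    by (auto simp: amalgam_words_def)
  have li: "[letter_inv l] \<in> amalgam_words G H"
    using l by (auto simp: amalgam_words_def)
  have inv: "[letter_inv l, l] \<approx> []"
    using l
  proof
    assume "l \<in> Inl ` carrier G"
    then show ?thesis
      using amalgam_eq.mult_left[of "inv\<^bsub>G\<^esub> (projl l)" G "projl l" H A \<phi>]
      by (auto intro: amalgam_eq.trans amalgam_eq.one_left)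
  next
    assume "l \<in> Inr ` carrier H"
    then show ?thesis
      using amalgam_eq.mult_right[of "inv\<^bsub>H\<^esub> (projr l)" H "projr l" G A \<phi>]
      by (auto intro: amalgam_eq.trans amalgam_eq.one_right)
  qed
  have "([letter_inv l, l] @ w) \<approx> ([] @ w)"
    using inv w by (rule amalgam_eq.append[OF _ amalgam_eq.refl])
  then have "(rev (map letter_inv w) @ ([letter_inv l, l] @ w)) \<approx> (rev (map letter_inv w) @ ([] @ w))"
    using Cons.IH[OF w] amalgam_eq.append[OF amalgam_eq.refl] by blast
  then show ?case
    using amalgam_eq.trans[of G H A \<phi> _ "rev (map letter_inv w) @ w"] Cons.IH w li
    by (simp add: words_append)
qed

lemma group_\<Gamma>: "group \<Gamma>"
proof (rule groupI)
  show "\<one>\<^bsub>\<Gamma>\<^esub> \<in> carrier \<Gamma>" unfolding carrier_\<Gamma> one_cls by (auto simp: amalgam_words_def)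
next
  fix x assume "x \<in> carrier \<Gamma>"
  then obtain w where w: "w \<in> amalgam_words G H" "x = cls w" unfolding carrier_\<Gamma> by auto
  show "\<exists>y\<in>carrier \<Gamma>. y \<otimes>\<^bsub>\<Gamma>\<^esub> x = \<one>\<^bsub>\<Gamma>\<^esub>"
    unfolding carrier_\<Gamma> one_cls using word_inverse[OF w(1)] w
    by (intro bexI[of _ "cls (rev (map letter_inv w))"]) (auto simp: mult_cls dest: cls_eqI)
qed (auto simp: carrier_\<Gamma> mult_cls one_cls words_append nil_word)

lemma inl_hom: "inl \<in> hom G \<Gamma>"
  unfolding inl_def
  by (rule homI) (auto simp: carrier_\<Gamma> mult_cls amalgam_words_def cls_eqI[OF amalgam_eq.mult_left])

lemma inr_hom: "inr \<in> hom H \<Gamma>"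
  unfolding inr_def
  by (rule homI) (auto simp: carrier_\<Gamma> mult_cls amalgam_words_def cls_eqI[OF amalgam_eq.mult_right])

lemma inl_eq_inr: "a \<in> A \<Longrightarrow> inl a = inr (\<phi> a)"
  unfolding inl_def inr_def by (intro cls_eqI amalgam_eq.identify)

text \<open>Phrased with left multiplications, as this is what the orbit arguments need.\<close>

lemma \<Gamma>_induct [consumes 1, case_names one inl inr]:
  assumes "x \<in> carrier \<Gamma>"
    and "P \<one>\<^bsub>\<Gamma>\<^esub>"
    and "\<And>g x. g \<in> carrier G \<Longrightarrow> x \<in> carrier \<Gamma> \<Longrightarrow> P x \<Longrightarrow> P (inl g \<otimes>\<^bsub>\<Gamma>\<^esub> x)"
    and "\<And>h x. h \<in> carrier H \<Longrightarrow> x \<in> carrier \<Gamma> \<Longrightarrow> P x \<Longrightarrow> P (inr h \<otimes>\<^bsub>\<Gamma>\<^esub> x)"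
  shows "P x"
proof -
  have "w \<in> amalgam_words G H \<Longrightarrow> P (cls w)" for w
  proof (induction w)
    case Nil then show ?case using assms(2) by (simp add: one_cls)
  next
    case (Cons l w)
    then have w: "w \<in> amalgam_words G H" and l: "l \<in> Inl ` carrier G \<union> Inr ` carrier H"
      by (auto simp: amalgam_words_def)
    have eq: "cls (l # w) = cls [l] \<otimes>\<^bsub>\<Gamma>\<^esub> cls w"
      using w l by (subst mult_cls) (auto simp: amalgam_words_def)
    show ?case
      using l w Cons.IH assms(3)[of _ "cls w"] assms(4)[of _ "cls w"] unfolding eq inl_def inr_def carrier_\<Gamma> by auto
  qed
  then show ?thesis using assms(1) unfolding carrier_\<Gamma> by auto
qed

text \<open>Evaluation of words in \<open>K\<close> respects every rule that generates the
  congruence, hence it is constant on classes. Actions of the amalgam are obtained from this with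
  \<open>BijGroup E\<close> as \<open>K\<close>.\<close>

lemma universal_property:
  assumes K: "group K" and f: "f \<in> hom G K" and f': "f' \<in> hom H K"
    and agree: "\<And>a. a \<in> A \<Longrightarrow> f a = f' (\<phi> a)"
  obtains F where "F \<in> hom \<Gamma> K" "\<And>g. g \<in> carrier G \<Longrightarrow> F (inl g) = f g"
    "\<And>h. h \<in> carrier H \<Longrightarrow> F (inr h) = f' h"
proof -
  interpret K: group K by fact
  interpret f: group_hom G K f by unfold_locales fact
  interpret f': group_hom H K f' by unfold_locales fact
  define ev where "ev w = foldr (\<lambda>l y. case_sum f f' l \<otimes>\<^bsub>K\<^esub> y) w \<one>\<^bsub>K\<^esub>" for w
  have ev_closed: "ev w \<in> carrier K" if "w \<in> amalgam_words G H" for w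
    using that by (induction w) (auto simp: ev_def amalgam_words_def)
  have ev_append: "ev (v @ w) = ev v \<otimes>\<^bsub>K\<^esub> ev w"
    if "v \<in> amalgam_words G H" "w \<in> amalgam_words G H" for v w
    using that(1)
  proof (induction v)
    case Nil then show ?case using ev_closed[OF that(2)] by (simp add: ev_def)
  next
    case (Cons l v)
    then have "v \<in> amalgam_words G H" "case_sum f f' l \<in> carrier K" by (auto simp: amalgam_words_def)
    then show ?case using Cons.IH ev_closed[OF that(2)] ev_closed[of v]
      by (simp add: ev_def K.m_assoc)
  qed
  have ev_eq: "ev v = ev w" if "v \<approx> w" for v w
    using that
  proof (induction rule: amalgam_eq.induct)
    case (append v v' w w')
    then show ?case using weq_words by (simp add: ev_append)
  next
    case (identify a)
    then show ?case using agree A_subset \<phi>_closed by (auto simp: ev_def)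
  qed (auto simp: ev_def)
  define F where "F X = ev (SOME w. w \<in> X)" for X
  have F: "F (cls w) = ev w" if "w \<in> amalgam_words G H" for w
  proof -
    have "w \<in> cls w" using that by (simp add: cls_def amalgam_eq.refl)
    then have "(SOME v. v \<in> cls w) \<in> cls w" by (rule someI)
    then show ?thesis unfolding F_def cls_def using ev_eq by auto
  qed
  show ?thesis
  proof
    show "F \<in> hom \<Gamma> K"
      by (rule homI) (auto simp: carrier_\<Gamma> F ev_closed mult_cls words_append ev_append)
    show "F (inl g) = f g" if "g \<in> carrier G" for g
      using that by (simp add: inl_def F amalgam_words_def) (simp add: ev_def)
    show "F (inr h) = f' h" if "h \<in> carrier H" for h
      using that by (simp add: inr_def F amalgam_words_def) (simp add: ev_def)
  qed
qed

end

section \<open>Group actions\<close>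

text \<open>An action is a homomorphism into \<open>BijGroup E\<close>, whose elements are
  extensional; this is the reason for \<open>restrict\<close>. Bijectivity comes for free, since
  \<open>inv g\<close> acts as the inverse map.\<close>

lemma group_actionI:
  assumes "group G"
    and closed: "\<And>g x. g \<in> carrier G \<Longrightarrow> x \<in> E \<Longrightarrow> f g x \<in> E"
    and one: "\<And>x. x \<in> E \<Longrightarrow> f \<one>\<^bsub>G\<^esub> x = x"
    and mult: "\<And>g h x. g \<in> carrier G \<Longrightarrow> h \<in> carrier G \<Longrightarrow> x \<in> E \<Longrightarrow> f (g \<otimes>\<^bsub>G\<^esub> h) x = f g (f h x)"
  shows "group_action G E (\<lambda>g. restrict (f g) E)"
proof -
  interpret group G by fact
  have inverse: "f (inv\<^bsub>G\<^esub> g) (f g x) = x" "f g (f (inv\<^bsub>G\<^esub> g) x) = x" if "g \<in> carrier G" "x \<in> E" for g x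
    using that mult[of "inv\<^bsub>G\<^esub> g" g x] mult[of g "inv\<^bsub>G\<^esub> g" x] one by auto
  have bij: "restrict (f g) E \<in> Bij E" if "g \<in> carrier G" for g
    using that closed inverse unfolding Bij_def
    by (auto intro!: bij_betwI[where g = "f (inv\<^bsub>G\<^esub> g)"] simp: bij_betw_restrict_eq)
  have "(\<lambda>g. restrict (f g) E) \<in> hom G (BijGroup E)"
    using bij closed mult unfolding hom_def BijGroup_def by (auto simp: compose_def fun_eq_iff)
  then show ?thesis
    by (simp add: group_action_def group_hom_def group_hom_axioms_def group_BijGroup is_group)
qed

lemma (in group_action) is_group: "group G"
  using group_hom group_hom.axioms(1) by blast

lemma (in group_action) act_one: "x \<in> E \<Longrightarrow> \<phi> \<one>\<^bsub>G\<^esub> x = x"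
  using id_eq_one by (metis restrict_apply')

lemma (in group_action) act_closed: "g \<in> carrier G \<Longrightarrow> x \<in> E \<Longrightarrow> \<phi> g x \<in> E"
  using element_image by blast

lemma (in group_action) act_inv:
  assumes "g \<in> carrier G" "x \<in> E"
  shows "\<phi> (inv\<^bsub>G\<^esub> g) (\<phi> g x) = x" "\<phi> g (\<phi> (inv\<^bsub>G\<^esub> g) x) = x"
proof -
  show "\<phi> (inv\<^bsub>G\<^esub> g) (\<phi> g x) = x" using orbit_sym_aux assms by blast
  show "\<phi> g (\<phi> (inv\<^bsub>G\<^esub> g) x) = x"
    using orbit_sym_aux[of "inv\<^bsub>G\<^esub> g" x] assms group.inv_closed[OF is_group] group.inv_inv[OF is_group] by simp
qed

text \<open>As the index counts right cosets, multiplication by \<open>inv g\<close> on the right is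
  used to get a left action. It is transitive and the point \<open>F\<close> has stabilizer
  \<open>F\<close>, so every subgroup becomes a point stabilizer.\<close>

lemma (in group) coset_action:
  assumes F: "subgroup F G"
  shows "group_action G (rcosets F) (\<lambda>g. restrict (\<lambda>R. R #> inv g) (rcosets F))" (is ?a)
    and "stabilizer G (\<lambda>g. restrict (\<lambda>R. R #> inv g) (rcosets F)) F = F" (is ?b)
    and "\<And>R. R \<in> rcosets F \<Longrightarrow> \<exists>g\<in>carrier G. restrict (\<lambda>R. R #> inv g) (rcosets F) F = R"
proof -
  interpret F: subgroup F G by fact
  have sub: "R \<subseteq> carrier G" if "R \<in> rcosets F" for R
    using F.rcosets_carrier[OF is_group that] .
  have closed: "R #> inv g \<in> rcosets F" if "g \<in> carrier G" "R \<in> rcosets F" for g R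
    using that by (auto simp: RCOSETS_def coset_mult_assoc F.subset)
  show ?a
    using closed sub by (intro group_actionI is_group) (auto simp: coset_mult_assoc inv_mult_group coset_mult_one)
  have FF: "F \<in> rcosets F" using F.subgroup_in_rcosets[OF is_group] .
  show ?b
  proof -
    have "F #> inv g = F \<longleftrightarrow> g \<in> F" if g: "g \<in> carrier G" for g
    proof -
      have "F #> inv g = F \<longleftrightarrow> inv g \<in> F"
        using coset_join1[of F "inv g"] coset_join2[OF _ F, of "inv g"] g F by auto
      then show ?thesis using g F.m_inv_closed by (metis inv_inv)
    qed
    then show ?thesis using FF F.subset by (auto simp: stabilizer_def)
  qed
  fix R assume "R \<in> rcosets F"
  then obtain a where "a \<in> carrier G" "R = F #> a" by (auto simp: RCOSETS_def)
  then show "\<exists>g\<in>carrier G. restrict (\<lambda>R. R #> inv g) (rcosets F) F = R"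
    using FF by (intro bexI[of _ "inv a"]) auto
qed

section \<open>Free groups\<close>

lemma letter_value_closed:
  "group G \<Longrightarrow> l \<in> carrier G \<times> UNIV \<Longrightarrow> letter_value G l \<in> carrier G"
  by (cases l) (auto simp: letter_value_def group.inv_closed)

lemma word_value_closed:
  "group G \<Longrightarrow> set w \<subseteq> carrier G \<times> UNIV \<Longrightarrow> word_value G w \<in> carrier G"
proof (induction w)
  case (Cons l w)
  interpret group G by fact
  show ?case using Cons letter_value_closed[OF is_group, of l] by (auto simp: word_value_def)
qed (auto simp: word_value_def group.is_monoid)

lemma word_value_append:
  assumes "group G" "set v \<subseteq> carrier G \<times> UNIV" "set w \<subseteq> carrier G \<times> UNIV"
  shows "word_value G (v @ w) = word_value G v \<otimes>\<^bsub>G\<^esub> word_value G w"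
  using assms(2)
proof (induction v)
  case Nil
  interpret group G by fact
  show ?case using word_value_closed[OF is_group assms(3)] by (simp add: word_value_def)
next
  case (Cons l v)
  interpret group G by fact
  show ?case using Cons letter_value_closed[OF is_group, of l] word_value_closed[OF is_group assms(3)]
      word_value_closed[OF is_group, of v]
    by (simp add: word_value_def m_assoc)
qed

definition inverse_word :: "('a \<times> bool) list \<Rightarrow> ('a \<times> bool) list" where
  "inverse_word w = rev (map (\<lambda>l. (fst l, \<not> snd l)) w)"

lemma set_inverse_word: "set (inverse_word w) \<subseteq> X \<times> UNIV \<longleftrightarrow> set w \<subseteq> X \<times> UNIV"
  by (auto simp: inverse_word_def)

lemma word_value_inverse:
  fixes G (structure)
  assumes "group G" "set w \<subseteq> carrier G \<times> UNIV"
  shows "word_value G (inverse_word w) = inv\<^bsub>G\<^esub> word_value G w"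
  using assms(2)
proof (induction w)
  interpret group G by fact
  case Nil show ?case by (simp add: word_value_def inverse_word_def)
next
  interpret group G by fact
  case (Cons l w)
  have "word_value G (inverse_word (l # w)) = word_value G (inverse_word w @ [(fst l, \<not> snd l)])"
    by (simp add: inverse_word_def)
  also have "\<dots> = inv (word_value G w) \<otimes> word_value G [(fst l, \<not> snd l)]"
    using Cons set_inverse_word[of w "carrier G"] by (subst word_value_append) (auto simp: is_group)
  also have "word_value G [(fst l, \<not> snd l)] = inv (letter_value G l)"
    using Cons.prems by (auto simp: word_value_def letter_value_def)
  also have "inv (word_value G w) \<otimes> inv (letter_value G l) = inv (word_value G (l # w))"
    using Cons.prems letter_value_closed[OF is_group, of l] word_value_closed[OF is_group, of w]
    by (simp add: word_value_def inv_mult_group)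
  finally show ?case .
qed

lemma cancelling_pair:
  assumes "\<not> reduced_word w"
  obtains u x b v where "w = u @ (x, b) # (x, \<not> b) # v"
proof -
  have "\<exists>u x b v. w = u @ (x, b) # (x, \<not> b) # v"
    using assms unfolding reduced_word_def
  proof (induction w rule: induct_list012)
    case (3 k l w)
    show ?case
    proof (cases "fst k = fst l \<and> snd k \<noteq> snd l")
      case True
      then have "k # l # w = [] @ (fst k, snd k) # (fst k, \<not> snd k) # w" by (cases k; cases l) auto
      then show ?thesis by blast
    next
      case False
      then obtain u x b v where "l # w = u @ (x, b) # (x, \<not> b) # v" using 3 by auto
      then have "k # l # w = (k # u) @ (x, b) # (x, \<not> b) # v" by simp
      then show ?thesis by blast
    qed
  qed auto
  then show ?thesis using that by blast
qed

lemma word_value_cancel: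
  fixes G (structure)
  assumes "group G" "set (u @ (x, b) # (x, \<not> b) # v) \<subseteq> carrier G \<times> UNIV"
  shows "word_value G (u @ (x, b) # (x, \<not> b) # v) = word_value G (u @ v)"
proof -
  interpret group G by fact
  have x: "x \<in> carrier G" using assms by auto
  have v: "word_value G v \<in> carrier G" using assms by (intro word_value_closed) auto
  have "letter_value G (x, b) \<otimes> (letter_value G (x, \<not> b) \<otimes> word_value G v) = word_value G v"
    using x v by (cases b) (auto simp: letter_value_def m_assoc[symmetric])
  then have "word_value G ((x, b) # (x, \<not> b) # v) = word_value G v"
    by (simp add: word_value_def)
  then show ?thesis using assms by (simp add: word_value_append)
qed

lemma word_value_surj:
  assumes "group G" "X \<subseteq> carrier G" "g \<in> generate G X"
  shows "\<exists>w. set w \<subseteq> X \<times> UNIV \<and> word_value G w = g"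
  using assms(3)
proof (induction rule: generate.induct)
  case one show ?case by (intro exI[of _ "[]"]) (simp add: word_value_def)
next
  interpret group G by fact
  case (incl h) then show ?case using assms(2)
    by (intro exI[of _ "[(h, True)]"]) (auto simp: word_value_def letter_value_def)
next
  interpret group G by fact
  case (inv h) then show ?case using assms(2)
    by (intro exI[of _ "[(h, False)]"]) (auto simp: word_value_def letter_value_def)
next
  case (eng h1 h2)
  then obtain v w where "set v \<subseteq> X \<times> UNIV" "word_value G v = h1" "set w \<subseteq> X \<times> UNIV" "word_value G w = h2"
    by blast
  moreover have "X \<times> (UNIV :: bool set) \<subseteq> carrier G \<times> UNIV" using assms(2) by auto
  ultimately show ?case using assms(1)
    by (intro exI[of _ "v @ w"]) (auto simp: word_value_append)
qed

text \<open>Freeness is given only as the absence of nonempty reduced words of trivial value. A word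
  of trivial value can therefore be cancelled down to the empty word, and the same cancellations are
  valid in \<open>K\<close>; so the value of a word in \<open>K\<close> depends only on its value in
  \<open>F\<close>.\<close>

lemma free_universal_property:
  assumes F: "group F" and K: "group K" and free: "freely_generated_by F X"
    and f: "f ` X \<subseteq> carrier K"
  obtains h where "h \<in> hom F K" "\<And>x. x \<in> X \<Longrightarrow> h x = f x"
proof -
  interpret F: group F by fact
  interpret K: group K by fact
  have X: "X \<subseteq> carrier F" and gen: "generate F X = carrier F"
    and red: "\<And>w. set w \<subseteq> X \<times> UNIV \<Longrightarrow> reduced_word w \<Longrightarrow> w \<noteq> [] \<Longrightarrow> word_value F w \<noteq> \<one>\<^bsub>F\<^esub>"
    using free unfolding freely_generated_by_def by auto
  define ev where "ev w = word_value K (map (apfst f) w)" for w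
  have inF: "set w \<subseteq> carrier F \<times> UNIV" if "set w \<subseteq> X \<times> UNIV" for w :: "(_ \<times> bool) list"
    using that X by auto
  have inK: "set (map (apfst f) w) \<subseteq> carrier K \<times> UNIV" if "set w \<subseteq> X \<times> UNIV" for w :: "(_ \<times> bool) list"
    using that f by fastforce
  have triv: "ev w = \<one>\<^bsub>K\<^esub>" if "set w \<subseteq> X \<times> UNIV" "word_value F w = \<one>\<^bsub>F\<^esub>" for w
    using that
  proof (induction "length w" arbitrary: w rule: less_induct)
    case less
    show ?case
    proof (cases "w = []")
      case True then show ?thesis by (simp add: ev_def word_value_def)
    next
      case False
      then have "\<not> reduced_word w" using red less.prems by blast
      then obtain u x b v where w: "w = u @ (x, b) # (x, \<not> b) # v" by (rule cancelling_pair)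
      have "word_value F (u @ v) = \<one>\<^bsub>F\<^esub>"
        using less.prems inF[OF less.prems(1)] word_value_cancel[OF F, of u x b v] unfolding w by simp
      then have "ev (u @ v) = \<one>\<^bsub>K\<^esub>" using less.hyps[of "u @ v"] less.prems(1) unfolding w by auto
      then show ?thesis
        using word_value_cancel[OF K, of "map (apfst f) u" "f x" b "map (apfst f) v"] inK[OF less.prems(1)]
        unfolding ev_def w by simp
    qed
  qed
  have ev_append: "ev (v @ w) = ev v \<otimes>\<^bsub>K\<^esub> ev w" if "set v \<subseteq> X \<times> UNIV" "set w \<subseteq> X \<times> UNIV" for v w
    using inK[OF that(1)] inK[OF that(2)] by (simp add: ev_def word_value_append[OF K])
  have ev_inverse: "ev (inverse_word w) = inv\<^bsub>K\<^esub> ev w" if "set w \<subseteq> X \<times> UNIV" for w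
  proof -
    have "map (apfst f) (inverse_word w) = inverse_word (map (apfst f) w)"
      by (auto simp: inverse_word_def rev_map)
    then show ?thesis using word_value_inverse[OF K inK[OF that]] by (simp add: ev_def)
  qed
  have ev_closed: "ev w \<in> carrier K" if "set w \<subseteq> X \<times> UNIV" for w
    using word_value_closed[OF K inK[OF that]] by (simp add: ev_def)
  have ev_eq: "ev v = ev w" if v: "set v \<subseteq> X \<times> UNIV" and w: "set w \<subseteq> X \<times> UNIV"
    and eq: "word_value F v = word_value F w" for v w
  proof -
    have i: "set (inverse_word w) \<subseteq> X \<times> UNIV" using w by (simp add: set_inverse_word)
    have "word_value F (inverse_word w @ v) = \<one>\<^bsub>F\<^esub>"
      using word_value_append[OF F inF[OF i] inF[OF v]] word_value_inverse[OF F inF[OF w]] eq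
        word_value_closed[OF F inF[OF w]] by simp
    then have "ev (inverse_word w @ v) = \<one>\<^bsub>K\<^esub>" using i v by (intro triv) auto
    then have "inv\<^bsub>K\<^esub> ev w \<otimes>\<^bsub>K\<^esub> ev v = \<one>\<^bsub>K\<^esub>" using ev_append[OF i v] ev_inverse[OF w] by simp
    then show ?thesis using ev_closed[OF v] ev_closed[OF w] by (metis K.inv_equality K.inv_closed K.inv_inv)
  qed
  define rep where "rep g = (SOME w. set w \<subseteq> X \<times> UNIV \<and> word_value F w = g)" for g
  have rep: "set (rep g) \<subseteq> X \<times> UNIV" "word_value F (rep g) = g" if "g \<in> carrier F" for g
    using someI_ex[OF word_value_surj[OF F X, of g]] that gen unfolding rep_def by auto
  show ?thesis
  proof
    show "(\<lambda>g. ev (rep g)) \<in> hom F K"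
    proof (rule homI)
      fix g h assume gh: "g \<in> carrier F" "h \<in> carrier F"
      have "ev (rep (g \<otimes>\<^bsub>F\<^esub> h)) = ev (rep g @ rep h)"
        using rep gh word_value_append[OF F inF[OF rep(1)] inF[OF rep(1)]] by (intro ev_eq) auto
      then show "ev (rep (g \<otimes>\<^bsub>F\<^esub> h)) = ev (rep g) \<otimes>\<^bsub>K\<^esub> ev (rep h)"
        using rep gh by (simp add: ev_append)
    qed (use rep ev_closed in auto)
    show "ev (rep x) = f x" if "x \<in> X" for x
    proof -
      have "ev (rep x) = ev [(x, True)]"
        using that X rep[of x] by (intro ev_eq) (auto simp: word_value_def letter_value_def)
      also have "\<dots> = f x" using that f by (auto simp: ev_def word_value_def letter_value_def)
      finally show ?thesis .
    qed
  qed
qed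

section \<open>Counting cocycles\<close>

text \<open>
  Cocycles of the action groupoid with values in the group of order two, a cocycle being encoded
  as the set of arguments where it does not vanish.
\<close>

definition cocycles :: "('a, 'm) monoid_scheme \<Rightarrow> 's set \<Rightarrow> ('a \<Rightarrow> 's \<Rightarrow> 's) \<Rightarrow> ('a \<times> 's) set set" where
  "cocycles G S act = {c \<in> Pow (carrier G \<times> S). \<forall>g\<in>carrier G. \<forall>h\<in>carrier G. \<forall>s\<in>S.
     ((g \<otimes>\<^bsub>G\<^esub> h, s) \<in> c) = (((g, act h s) \<in> c) \<noteq> ((h, s) \<in> c))}"

lemma cocyclesD:
  assumes "c \<in> cocycles G S act" "g \<in> carrier G" "h \<in> carrier G" "s \<in> S"
  shows "((g \<otimes>\<^bsub>G\<^esub> h, s) \<in> c) = (((g, act h s) \<in> c) \<noteq> ((h, s) \<in> c))"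
  using assms unfolding cocycles_def by blast

lemma (in group_action) cocycle_one:
  assumes c: "c \<in> cocycles G E \<phi>"
  shows "(\<one>\<^bsub>G\<^esub>, s) \<notin> c"
proof (cases "s \<in> E")
  interpret group G by (rule is_group)
  case True
  then show ?thesis using cocyclesD[OF c one_closed one_closed True] act_one by simp
next
  case False then show ?thesis using c by (auto simp: cocycles_def)
qed

text \<open>Values on \<open>X \<times> E\<close> can be prescribed freely: they define a twisted
  action of each generator on a double cover of \<open>E\<close>, and by the universal property
  these extend to an action of the whole group. Uniqueness holds because \<open>X\<close>
  generates.\<close>

lemma (in group_action) card_cocycles_free:
  assumes free: "freely_generated_by G X" and "finite X" "finite E"
  shows "card (cocycles G E \<phi>) = 2 ^ (card X * card E)"
proof -
  interpret group G by (rule is_group)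
  have X: "X \<subseteq> carrier G" and gen: "generate G X = carrier G"
    using free unfolding freely_generated_by_def by auto
  have "bij_betw (\<lambda>c. c \<inter> (X \<times> E)) (cocycles G E \<phi>) (Pow (X \<times> E))"
    unfolding bij_betw_def
  proof
    show "inj_on (\<lambda>c. c \<inter> (X \<times> E)) (cocycles G E \<phi>)"
    proof (rule inj_onI)
      fix c d assume c: "c \<in> cocycles G E \<phi>" and d: "d \<in> cocycles G E \<phi>"
        and eq: "c \<inter> (X \<times> E) = d \<inter> (X \<times> E)"
      have eqX: "(x, s) \<in> c \<longleftrightarrow> (x, s) \<in> d" if "x \<in> X" "s \<in> E" for x s using that eq by blast
      have "\<forall>s\<in>E. (g, s) \<in> c \<longleftrightarrow> (g, s) \<in> d" if "g \<in> generate G X" for g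
        using that
      proof (induction rule: generate.induct)
        case one show ?case using cocycle_one[OF c] cocycle_one[OF d] by blast
      next
        case (incl h) then show ?case using eqX by blast
      next
        case (inv h)
        show ?case
        proof
          fix s assume s: "s \<in> E"
          have h: "h \<in> carrier G" using inv X by auto
          \<comment> \<open>The cocycle identity for \<open>inv h\<close> and \<open>h\<close> at
            \<open>t\<close> says that the values at \<open>(inv h, s)\<close> and at
            \<open>(h, t)\<close> cancel.\<close>
          define t where "t = \<phi> (inv h) s"
          have t: "t \<in> E" "\<phi> h t = s" using h s by (auto simp: t_def act_closed act_inv)
          show "(inv h, s) \<in> c \<longleftrightarrow> (inv h, s) \<in> d"
            using cocyclesD[OF c inv_closed[OF h] h t(1)] cocyclesD[OF d inv_closed[OF h] h t(1)]
              cocycle_one[OF c] cocycle_one[OF d] h t eqX[OF inv t(1)] by simp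
        qed
      next
        case (eng g h)
        then have "g \<in> carrier G" "h \<in> carrier G" using gen by auto
        then show ?case using eng.IH cocyclesD[OF c] cocyclesD[OF d] act_closed by auto
      qed
      then show "c = d" using c d gen by (auto simp: cocycles_def)
    qed
    show "(\<lambda>c. c \<inter> (X \<times> E)) ` cocycles G E \<phi> = Pow (X \<times> E)"
    proof (intro equalityI subsetI)
      fix D assume "D \<in> Pow (X \<times> E)"
      \<comment> \<open>The double cover of \<open>E\<close>: the two sheets are interchanged
        exactly over those \<open>s\<close> with \<open>(x, s) \<in> D\<close>.\<close>
      define T where "T x = restrict (\<lambda>(s, b). (\<phi> x s, b \<noteq> ((x, s) \<in> D))) (E \<times> UNIV)" for x
      have T: "T x \<in> Bij (E \<times> UNIV)" if "x \<in> X" for x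
      proof -
        have x: "x \<in> carrier G" using X that by auto
        have "bij_betw (\<lambda>(s, b). (\<phi> x s, b \<noteq> ((x, s) \<in> D))) (E \<times> UNIV) (E \<times> UNIV)"
          by (rule bij_betwI[where g = "\<lambda>(s, b). (\<phi> (inv x) s, b \<noteq> ((x, \<phi> (inv x) s) \<in> D))"])
            (use x in \<open>auto simp: act_closed act_inv\<close>)
        then show ?thesis by (auto simp: Bij_def T_def bij_betw_restrict_eq)
      qed
      obtain \<Phi> where \<Phi>: "\<Phi> \<in> hom G (BijGroup (E \<times> UNIV))" and \<Phi>X: "\<And>x. x \<in> X \<Longrightarrow> \<Phi> x = T x"
        using free_universal_property[OF is_group group_BijGroup free, of T "E \<times> UNIV"] T
        by (auto simp: BijGroup_def)
      interpret \<Phi>: group_action G "E \<times> (UNIV :: bool set)" \<Phi>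
        using \<Phi> by (simp add: group_action_def group_hom_def group_hom_axioms_def group_BijGroup)
      \<comment> \<open>The cocycle records whether \<open>g\<close> changes the sheet over
        \<open>s\<close>.\<close>
      define c where "c = {(g, s). g \<in> carrier G \<and> s \<in> E \<and> snd (\<Phi> g (s, False))}"
      have "\<forall>s\<in>E. \<forall>b. \<Phi> g (s, b) = (\<phi> g s, b \<noteq> ((g, s) \<in> c))" if "g \<in> generate G X" for g
        using that
      proof (induction rule: generate.induct)
        case one
        then show ?case using \<Phi>.act_one act_one by (auto simp: c_def)
      next
        case (incl x)
        then show ?case using \<Phi>X[OF incl] X by (auto simp: c_def T_def)
      next
        case (inv x)
        have x: "x \<in> carrier G" using inv X by auto
        have *: "\<Phi> (inv x) (s, b) = (\<phi> (inv x) s, b \<noteq> ((x, \<phi> (inv x) s) \<in> D))" if s: "s \<in> E" for s b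
        proof (rule \<Phi>.orbit_sym_aux)
          show "x \<in> carrier G" by fact
          show "\<Phi> x (\<phi> (inv x) s, b \<noteq> ((x, \<phi> (inv x) s) \<in> D)) = (s, b)"
            using x s \<Phi>X[OF inv] by (auto simp: T_def act_closed act_inv)
        qed (use x s in \<open>auto simp: act_closed\<close>)
        show ?case using * x by (auto simp: c_def)
      next
        case (eng g h)
        then have gh: "g \<in> carrier G" "h \<in> carrier G" using gen by auto
        have "\<Phi> (g \<otimes> h) (s, b) = \<Phi> g (\<Phi> h (s, b))" if "s \<in> E" for s b
          using \<Phi>.composition_rule gh that by blast
        then have *: "\<Phi> (g \<otimes> h) (s, b) = (\<phi> g (\<phi> h s), (b \<noteq> ((h, s) \<in> c)) \<noteq> ((g, \<phi> h s) \<in> c))" if "s \<in> E" for s b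
          using eng.IH gh that act_closed by auto
        show ?case using * gh by (auto simp: composition_rule) (auto simp: c_def *)
      qed
      then have c: "\<Phi> g (s, b) = (\<phi> g s, b \<noteq> ((g, s) \<in> c))" if "g \<in> carrier G" "s \<in> E" for g s b
        using that gen by blast
      have "c \<in> cocycles G E \<phi>"
        unfolding cocycles_def
      proof (intro CollectI conjI ballI)
        show "c \<in> Pow (carrier G \<times> E)" by (auto simp: c_def)
        fix g h s assume gh: "g \<in> carrier G" "h \<in> carrier G" and s: "s \<in> E"
        have "\<Phi> (g \<otimes> h) (s, False) = \<Phi> g (\<Phi> h (s, False))"
          using \<Phi>.composition_rule gh s by blast
        then show "((g \<otimes> h, s) \<in> c) = (((g, \<phi> h s) \<in> c) \<noteq> ((h, s) \<in> c))"
          using gh s c act_closed by auto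
      qed
      moreover have "c \<inter> (X \<times> E) = D"
      proof -
        have "(x, s) \<in> c \<longleftrightarrow> (x, s) \<in> D" if "x \<in> X" "s \<in> E" for x s
          using c[of x s False] \<Phi>X[of x] that X by (auto simp: T_def)
        then show ?thesis using \<open>D \<in> Pow (X \<times> E)\<close> by auto
      qed
      ultimately show "D \<in> (\<lambda>c. c \<inter> (X \<times> E)) ` cocycles G E \<phi>" by blast
    qed auto
  qed
  then show ?thesis
    using bij_betw_same_card card_Pow[of "X \<times> E"] assms by (fastforce simp: card_cartesian_product)
qed

text \<open>
  Shapiro's lemma at the level of cocycles: a cocycle is determined by its restriction to the
  fibre over a base point and by its values on a transversal of the stabilizer.
\<close>

lemma card_cocycles_induced:
  fixes G (structure)
  assumes S: "group_action G S act" and M: "group_action G M act'"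
    and p: "\<And>s. s \<in> S \<Longrightarrow> p s \<in> M" "\<And>g s. g \<in> carrier G \<Longrightarrow> s \<in> S \<Longrightarrow> p (act g s) = act' g (p s)"
    and m: "m \<in> M" and trans: "\<And>x. x \<in> M \<Longrightarrow> \<exists>g\<in>carrier G. act' g m = x"
    and fin: "finite S" "finite M"
    and F: "F = stabilizer G act' m" and S0: "S0 = {s \<in> S. p s = m}"
  shows "card (cocycles G S act) = card (cocycles (G\<lparr>carrier := F\<rparr>) S0 act) * 2 ^ ((card M - 1) * card S0)"
proof -
  interpret S: group_action G S act by fact
  interpret M: group_action G M act' by fact
  interpret group G by (rule S.is_group)
  have subF: "subgroup F G" unfolding F by (rule M.stabilizer_subgroup[OF m])
  interpret F: subgroup F G by fact
  have Fm: "g \<in> F \<longleftrightarrow> g \<in> carrier G \<and> act' g m = m" for g unfolding F stabilizer_def by blast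
  \<comment> \<open>The representative of \<open>m\<close> is fixed to be the unit, so that
    restriction to \<open>F\<close> and to the fibre over \<open>m\<close> needs no correction
    term.\<close>
  define \<gamma> where "\<gamma> x = (if x = m then \<one> else SOME g. g \<in> carrier G \<and> act' g m = x)" for x
  have \<gamma>: "\<gamma> x \<in> carrier G" "act' (\<gamma> x) m = x" if "x \<in> M" for x
    using someI_ex[of "\<lambda>g. g \<in> carrier G \<and> act' g m = x"] trans[OF that] M.act_one[OF m]
    by (auto simp: \<gamma>_def)
  have \<gamma>m: "\<gamma> m = \<one>" by (simp add: \<gamma>_def)
  define \<sigma> where "\<sigma> s = act (inv (\<gamma> (p s))) s" for s
  have \<sigma>: "\<sigma> s \<in> S0" "act (\<gamma> (p s)) (\<sigma> s) = s" if s: "s \<in> S" for s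
  proof -
    have "act' (inv (\<gamma> (p s))) (p s) = m"
      using M.act_inv(1)[of "\<gamma> (p s)" m] \<gamma>[OF p(1)[OF s]] m by simp
    then show "\<sigma> s \<in> S0" "act (\<gamma> (p s)) (\<sigma> s) = s"
      using s \<gamma>[OF p(1)[OF s]] by (auto simp: \<sigma>_def S0 S.act_closed p S.act_inv)
  qed
  \<comment> \<open>The factor in \<open>F\<close> that remains when
    \<open>g \<otimes> \<gamma> x\<close> is written with the representative of
    \<open>act' g x\<close> in front.\<close>
  define f where "f g x = inv (\<gamma> (act' g x)) \<otimes> (g \<otimes> \<gamma> x)" for g x
  have f: "f g x \<in> F" "\<gamma> (act' g x) \<otimes> f g x = g \<otimes> \<gamma> x" if "g \<in> carrier G" "x \<in> M" for g x
  proof -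
    note cl = that \<gamma>[OF that(2)] \<gamma>[OF M.act_closed[OF that]]
    have "act' (g \<otimes> \<gamma> x) m = act' g x" using cl m by (simp add: M.composition_rule)
    moreover have "act' (inv (\<gamma> (act' g x))) (act' g x) = m"
      using M.act_inv(1)[of "\<gamma> (act' g x)" m] cl m by simp
    ultimately show "f g x \<in> F" using cl m by (simp add: Fm f_def M.composition_rule[OF m])
    show "\<gamma> (act' g x) \<otimes> f g x = g \<otimes> \<gamma> x" using cl by (simp add: f_def m_assoc[symmetric])
  qed
  have S0S: "s \<in> S" "p s = m" if "s \<in> S0" for s using that by (auto simp: S0)
  have FS0: "act g s \<in> S0" if "g \<in> F" "s \<in> S0" for g s
    using that by (auto simp: S0 Fm S.act_closed p)
  have \<sigma>_act: "\<sigma> (act g s) = act (f g (p s)) (\<sigma> s)" if g: "g \<in> carrier G" and s: "s \<in> S" for g s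
  proof -
    note cl = g s p(1)[OF s] \<gamma>[OF p(1)[OF s]] \<gamma>[OF M.act_closed[OF g p(1)[OF s]]] S0S(1)[OF \<sigma>(1)[OF s]]
    have "act (f g (p s)) (\<sigma> s) = act (inv (\<gamma> (act' g (p s)))) (act g (act (\<gamma> (p s)) (\<sigma> s)))"
      using cl by (simp add: f_def S.composition_rule S.act_closed)
    then show ?thesis using \<sigma>(2)[OF s] p(2)[OF g s] by (simp add: \<sigma>_def)
  qed
  \<comment> \<open>The base point is left out because \<open>\<gamma> m\<close> is the unit, where
    every cocycle vanishes. This is the origin of \<open>card M - 1\<close>.\<close>
  define N where "N = (M - {m}) \<times> S0"
  define D where "D c = {(x, s). (x, s) \<in> N \<and> (\<gamma> x, s) \<in> c}" for c
  \<comment> \<open>The two factorizations \<open>g \<otimes> \<gamma> (p s)\<close> and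
    \<open>\<gamma> (act' g (p s)) \<otimes> f g (p s)\<close> of one element are evaluated at
    \<open>\<sigma> s\<close> and compared.\<close>
  have formula: "(g, s) \<in> c \<longleftrightarrow>
      (((p s, \<sigma> s) \<in> D c) \<noteq> (((act' g (p s), act (f g (p s)) (\<sigma> s)) \<in> D c) \<noteq> ((f g (p s), \<sigma> s) \<in> c)))"
    if c: "c \<in> cocycles G S act" and g: "g \<in> carrier G" and s: "s \<in> S" for c g s
  proof -
    have Dc: "(x, t) \<in> D c \<longleftrightarrow> (\<gamma> x, t) \<in> c" if "x \<in> M" "t \<in> S0" for x t
      using that S.cocycle_one[OF c] by (auto simp: D_def N_def \<gamma>m)
    note x = p(1)[OF s] and y = M.act_closed[OF g p(1)[OF s]]
    note t = S0S(1)[OF \<sigma>(1)[OF s]]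
    have "((g \<otimes> \<gamma> (p s), \<sigma> s) \<in> c) = (((g, s) \<in> c) \<noteq> ((\<gamma> (p s), \<sigma> s) \<in> c))"
      using cocyclesD[OF c g \<gamma>(1)[OF x] t] \<sigma>(2)[OF s] by simp
    moreover have "((g \<otimes> \<gamma> (p s), \<sigma> s) \<in> c) =
        (((\<gamma> (act' g (p s)), act (f g (p s)) (\<sigma> s)) \<in> c) \<noteq> ((f g (p s), \<sigma> s) \<in> c))"
      using cocyclesD[OF c \<gamma>(1)[OF y] _ t, of "f g (p s)"] f[OF g x] F.subset by auto
    moreover have "act (f g (p s)) (\<sigma> s) \<in> S0" using FS0 f[OF g x] \<sigma>[OF s] by blast
    ultimately show ?thesis using Dc[OF x \<sigma>(1)[OF s]] Dc[OF y] by blast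
  qed
  let ?R = "\<lambda>c. (c \<inter> (F \<times> S0), D c)"
  have "bij_betw ?R (cocycles G S act) (cocycles (G\<lparr>carrier := F\<rparr>) S0 act \<times> Pow N)"
    unfolding bij_betw_def
  proof
    show "inj_on ?R (cocycles G S act)"
    proof (rule inj_onI)
      fix c d assume c: "c \<in> cocycles G S act" and d: "d \<in> cocycles G S act" and eq: "?R c = ?R d"
      have "(g, s) \<in> c \<longleftrightarrow> (g, s) \<in> d" if g: "g \<in> carrier G" and s: "s \<in> S" for g s
      proof -
        have "(f g (p s), \<sigma> s) \<in> c \<longleftrightarrow> (f g (p s), \<sigma> s) \<in> d"
          using eq f[OF g p(1)[OF s]] \<sigma>[OF s] by blast
        then show ?thesis using formula[OF c g s] formula[OF d g s] eq by simp
      qed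
      then show "c = d" using c d by (auto simp: cocycles_def)
    qed
    show "?R ` cocycles G S act = cocycles (G\<lparr>carrier := F\<rparr>) S0 act \<times> Pow N"
    proof (intro equalityI subsetI)
      fix z assume "z \<in> ?R ` cocycles G S act"
      then obtain c where c: "c \<in> cocycles G S act" and z: "z = ?R c" by blast
      have "c \<inter> (F \<times> S0) \<in> cocycles (G\<lparr>carrier := F\<rparr>) S0 act"
        unfolding cocycles_def using cocyclesD[OF c] S0S(1) FS0 F.subset by auto
      then show "z \<in> cocycles (G\<lparr>carrier := F\<rparr>) S0 act \<times> Pow N" unfolding z by (auto simp: D_def)
    next
      fix z assume "z \<in> cocycles (G\<lparr>carrier := F\<rparr>) S0 act \<times> Pow N"
      then obtain c0 E where c0: "c0 \<in> cocycles (G\<lparr>carrier := F\<rparr>) S0 act" and E: "E \<subseteq> N" and z: "z = (c0, E)"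
        by blast
      have c0D: "((g \<otimes> h, s) \<in> c0) = (((g, act h s) \<in> c0) \<noteq> ((h, s) \<in> c0))" if "g \<in> F" "h \<in> F" "s \<in> S0" for g h s
        using cocyclesD[OF c0] that by simp
      have Em: "(m, s) \<notin> E" for s using E by (auto simp: N_def)
      \<comment> \<open>The formula above is turned into a definition. That it yields a cocycle
        rests on the rule \<open>ff\<close> for \<open>f\<close> proved below.\<close>
      define c where "c = {(g, s). g \<in> carrier G \<and> s \<in> S \<and>
        (((p s, \<sigma> s) \<in> E) \<noteq> (((act' g (p s), act (f g (p s)) (\<sigma> s)) \<in> E) \<noteq> ((f g (p s), \<sigma> s) \<in> c0)))}"
      have c: "c \<in> cocycles G S act"
        unfolding cocycles_def
      proof (intro CollectI conjI ballI)
        show "c \<in> Pow (carrier G \<times> S)" by (auto simp: c_def)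
        fix g h s assume gh: "g \<in> carrier G" "h \<in> carrier G" and s: "s \<in> S"
        note x = p(1)[OF s]
        note y = M.act_closed[OF gh(2) x]
        note z = M.act_closed[OF gh(1) y]
        note fh = f[OF gh(2) x]
        note fg = f[OF gh(1) y]
        have ff: "f (g \<otimes> h) (p s) = f g (act' h (p s)) \<otimes> f h (p s)"
        proof -
          have "f g (act' h (p s)) \<otimes> f h (p s)
            = inv (\<gamma> (act' g (act' h (p s)))) \<otimes> (g \<otimes> (\<gamma> (act' h (p s)) \<otimes> f h (p s)))"
            using fh(1) F.subset \<gamma>(1)[OF y] \<gamma>(1)[OF z] gh by (auto simp: f_def[of g] m_assoc)
          also have "\<dots> = f (g \<otimes> h) (p s)"
            unfolding fh(2) using gh x \<gamma>(1)[OF x] by (simp add: f_def M.composition_rule m_assoc)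
          finally show ?thesis by simp
        qed
        have a1: "act (f (g \<otimes> h) (p s)) (\<sigma> s) = act (f g (act' h (p s))) (act (f h (p s)) (\<sigma> s))"
          unfolding ff using fg(1) fh(1) F.subset S0S(1)[OF \<sigma>(1)[OF s]] by (intro S.composition_rule) auto
        have a2: "((f (g \<otimes> h) (p s), \<sigma> s) \<in> c0) =
          (((f g (act' h (p s)), act (f h (p s)) (\<sigma> s)) \<in> c0) \<noteq> ((f h (p s), \<sigma> s) \<in> c0))"
          unfolding ff using c0D fg(1) fh(1) \<sigma>(1)[OF s] by blast
        show "((g \<otimes> h, s) \<in> c) = (((g, act h s) \<in> c) \<noteq> ((h, s) \<in> c))"
          using gh s x a1 a2 by (auto simp: c_def S.act_closed p \<sigma>_act M.composition_rule)
      qed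
      have f_m: "f g m = g" if "g \<in> F" for g
        using that \<gamma>m Fm by (simp add: f_def)
      have \<sigma>0: "\<sigma> s = s" if "s \<in> S0" for s
        using S0S[OF that] \<gamma>m by (simp add: \<sigma>_def S.act_one)
      have "(g, s) \<in> c \<longleftrightarrow> (g, s) \<in> c0" if "g \<in> F" "s \<in> S0" for g s
        using that S0S[OF that(2)] by (auto simp: c_def f_m \<sigma>0 Em Fm)
      then have 1: "c \<inter> (F \<times> S0) = c0" using c0 by (auto simp: cocycles_def)
      have one0: "(\<one>, s) \<notin> c0" if "s \<in> S0" for s
        using c0D[of \<one> \<one> s] that S0S[OF that] by (simp add: S.act_one)
      have "(\<gamma> x, s) \<in> c \<longleftrightarrow> (x, s) \<in> E" if "(x, s) \<in> N" for x s
      proof -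
        have x: "x \<in> M" and s: "s \<in> S0" using that by (auto simp: N_def)
        have "f (\<gamma> x) m = \<one>" using \<gamma>[OF x] by (simp add: f_def \<gamma>m)
        then show ?thesis using \<gamma>[OF x] S0S[OF s] s by (auto simp: c_def \<sigma>0 Em S.act_one one0)
      qed
      then have 2: "D c = E" using E by (auto simp: D_def)
      show "z \<in> ?R ` cocycles G S act" using c 1 2 z by blast
    qed
  qed
  then have "card (cocycles G S act) = card (cocycles (G\<lparr>carrier := F\<rparr>) S0 act \<times> Pow N)"
    by (rule bij_betw_same_card)
  moreover have "card (Pow N) = 2 ^ ((card M - 1) * card S0)"
    using fin m by (simp add: card_Pow N_def S0 card_cartesian_product)
  ultimately show ?thesis by (simp add: card_cartesian_product)
qed

text \<open>The fibre over \<open>F\<close> is acted on by the free group \<open>F\<close>, which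
  contributes \<open>card X\<close> free choices for each of its points; every coset other than
  \<open>F\<close> contributes one more through the transversal.\<close>

lemma (in group) card_cocycles_over_free:
  assumes F: "subgroup F G" and free: "freely_generated_by (G\<lparr>carrier := F\<rparr>) X" and X: "finite X"
    and S: "group_action G S act" and fin: "finite S" "finite (rcosets F)"
    and p: "\<And>s. s \<in> S \<Longrightarrow> p s \<in> rcosets F" "\<And>g s. g \<in> carrier G \<Longrightarrow> s \<in> S \<Longrightarrow> p (act g s) = p s #> inv g"
  shows "card (cocycles G S act) = 2 ^ ((card X + (card (rcosets F) - 1)) * card {s \<in> S. p s = F})"
proof -
  interpret S: group_action G S act by fact
  interpret F: subgroup F G by fact
  define act' where "act' = (\<lambda>g. restrict (\<lambda>R. R #> inv g) (rcosets F))"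
  note act' = coset_action(1,2)[OF F, folded act'_def]
  have trans: "\<exists>g\<in>carrier G. act' g F = R" if "R \<in> rcosets F" for R
    unfolding act'_def by (rule coset_action(3)[OF F that])
  interpret M: group_action G "rcosets F" act' by (rule act')
  have FF: "F \<in> rcosets F" by (rule F.subgroup_in_rcosets[OF is_group])
  have p': "p (act g s) = act' g (p s)" if "g \<in> carrier G" "s \<in> S" for g s
    using p that by (simp add: act'_def)
  define S0 where "S0 = {s \<in> S. p s = F}"
  have S0: "act g s \<in> S0" if "g \<in> F" "s \<in> S0" for g s
  proof -
    have "g \<in> stabilizer G act' F" using that act'(2) by simp
    then show ?thesis using that p' S.act_closed F.subset by (auto simp: S0_def stabilizer_def)
  qed
  interpret S0: group_action "G\<lparr>carrier := F\<rparr>" S0 "\<lambda>g. restrict (act g) S0"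
    using S0 F.subset by (intro group_actionI subgroup_imp_group F)
      (auto simp: S0_def S.act_one S.composition_rule)
  have "cocycles (G\<lparr>carrier := F\<rparr>) S0 act = cocycles (G\<lparr>carrier := F\<rparr>) S0 (\<lambda>g. restrict (act g) S0)"
    unfolding cocycles_def by auto
  then have "card (cocycles (G\<lparr>carrier := F\<rparr>) S0 act) = 2 ^ (card X * card S0)"
    using S0.card_cocycles_free[OF free X] fin by (simp add: S0_def)
  then show ?thesis
    using card_cocycles_induced[OF S M.group_action_axioms p(1) p' FF trans fin act'(2)[symmetric] S0_def]
    by (simp add: S0_def power_add[symmetric] algebra_simps)
qed

text \<open>
  For free subgroups \<open>F\<close> and \<open>F'\<close>, the cocycles on \<open>G/F \<times> G/F'\<close> can be counted
  over either factor.
\<close>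

lemma (in group) free_subgroup_rank_index:
  assumes F: "subgroup F G" and free: "freely_generated_by (G\<lparr>carrier := F\<rparr>) X" and X: "finite X"
    and finF: "finite (rcosets F)"
    and F': "subgroup F' G" and free': "freely_generated_by (G\<lparr>carrier := F'\<rparr>) X'" and X': "finite X'"
    and finF': "finite (rcosets F')"
  shows "(1 - rat_of_nat (card X)) / of_nat (card (rcosets F)) = (1 - of_nat (card X')) / of_nat (card (rcosets F'))"
proof -
  let ?M = "rcosets F" and ?M' = "rcosets F'"
  interpret M: group_action G ?M "\<lambda>g. restrict (\<lambda>R. R #> inv g) ?M" by (rule coset_action[OF F])
  interpret M': group_action G ?M' "\<lambda>g. restrict (\<lambda>R. R #> inv g) ?M'" by (rule coset_action[OF F'])
  \<comment> \<open>The diagonal action, so that both projections are equivariant.\<close>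
  define act where "act = (\<lambda>g. restrict (\<lambda>(R, R'). (R #> inv g, R' #> inv g)) (?M \<times> ?M'))"
  have S: "group_action G (?M \<times> ?M') act"
    unfolding act_def
  proof (rule group_actionI[OF is_group])
    fix g x assume "g \<in> carrier G" "x \<in> ?M \<times> ?M'"
    then show "(case x of (R, R') \<Rightarrow> (R #> inv g, R' #> inv g)) \<in> ?M \<times> ?M'"
      using M.act_closed[of g "fst x"] M'.act_closed[of g "snd x"] by auto
  next
    fix x assume "x \<in> ?M \<times> ?M'"
    then show "(case x of (R, R') \<Rightarrow> (R #> inv \<one>, R' #> inv \<one>)) = x"
      using M.act_one[of "fst x"] M'.act_one[of "snd x"] by auto
  next
    fix g h x assume "g \<in> carrier G" "h \<in> carrier G" "x \<in> ?M \<times> ?M'"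
    then show "(case x of (R, R') \<Rightarrow> (R #> inv (g \<otimes> h), R' #> inv (g \<otimes> h)))
        = (case case x of (R, R') \<Rightarrow> (R #> inv h, R' #> inv h) of (R, R') \<Rightarrow> (R #> inv g, R' #> inv g))"
      using M.composition_rule[of "fst x" g h] M'.composition_rule[of "snd x" g h]
        M.act_closed[of h "fst x"] M'.act_closed[of h "snd x"] by auto
  qed
  have FF: "F \<in> ?M" "F' \<in> ?M'" using subgroup.subgroup_in_rcosets[OF _ is_group] F F' by auto
  then have pos: "card ?M > 0" "card ?M' > 0" using finF finF' card_gt_0_iff by blast+
  have "{s \<in> ?M \<times> ?M'. fst s = F} = {F} \<times> ?M'" "{s \<in> ?M \<times> ?M'. snd s = F'} = ?M \<times> {F'}" using FF by auto
  then have fibres: "card {s \<in> ?M \<times> ?M'. fst s = F} = card ?M'" "card {s \<in> ?M \<times> ?M'. snd s = F'} = card ?M"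
    by (simp_all add: card_cartesian_product)
  have fin: "finite (?M \<times> ?M')" using finF finF' by simp
  have "card (cocycles G (?M \<times> ?M') act) = 2 ^ ((card X + (card ?M - 1)) * card {s \<in> ?M \<times> ?M'. fst s = F})"
    by (rule card_cocycles_over_free[OF F free X S fin finF]) (auto simp: act_def)
  moreover have "card (cocycles G (?M \<times> ?M') act) = 2 ^ ((card X' + (card ?M' - 1)) * card {s \<in> ?M \<times> ?M'. snd s = F'})"
    by (rule card_cocycles_over_free[OF F' free' X' S fin finF']) (auto simp: act_def)
  ultimately have "(2::nat) ^ ((card X + (card ?M - 1)) * card ?M') = 2 ^ ((card X' + (card ?M' - 1)) * card ?M)"
    unfolding fibres by simp
  then have "(card X + (card ?M - 1)) * card ?M' = (card X' + (card ?M' - 1)) * card ?M" by simp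
  then have "rat_of_nat ((card X + (card ?M - 1)) * card ?M') = of_nat ((card X' + (card ?M' - 1)) * card ?M)"
    by (simp only:)
  moreover have "rat_of_nat (card ?M - 1) = of_nat (card ?M) - 1" "rat_of_nat (card ?M' - 1) = of_nat (card ?M') - 1"
    using pos by (simp_all add: of_nat_diff)
  ultimately have "(of_nat (card X) + (of_nat (card ?M) - 1)) * rat_of_nat (card ?M')
      = (of_nat (card X') + (of_nat (card ?M') - 1)) * of_nat (card ?M)"
    by (simp only: of_nat_mult of_nat_add)
  \<comment> \<open>With ranks r, r' and indices m, m' the exponents give (r + m - 1) m' = (r' + m'
    - 1) m, and m m' cancels.\<close>
  then have "(1 - rat_of_nat (card X)) * of_nat (card ?M') = (1 - of_nat (card X')) * of_nat (card ?M)"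
    by algebra
  moreover have "rat_of_nat (card ?M) \<noteq> 0" "rat_of_nat (card ?M') \<noteq> 0" using pos by simp_all
  ultimately show ?thesis by (subst frac_eq_eq) assumption+
qed

section \<open>Gluing actions of the two factors\<close>

context amalgam begin

text \<open>The action of \<open>H\<close> is transported to \<open>E\<close> along
  \<open>\<theta>\<close>, after which the universal property applies. All freedom in the later
  constructions lies in the choice of \<open>\<theta>\<close>, which only has to commute with
  \<open>A\<close>.\<close>

lemma glue_actions:
  assumes G: "group_action G E act" and H: "group_action H Y act'"
    and \<theta>: "bij_betw \<theta> Y E"
    and equi: "\<And>a y. a \<in> A \<Longrightarrow> y \<in> Y \<Longrightarrow> \<theta> (act' (\<phi> a) y) = act a (\<theta> y)"
  obtains \<Phi> where "group_action \<Gamma> E \<Phi>"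
    "\<And>g x. g \<in> carrier G \<Longrightarrow> \<Phi> (inl g) x = act g x"
    "\<And>h y. h \<in> carrier H \<Longrightarrow> y \<in> Y \<Longrightarrow> \<Phi> (inr h) (\<theta> y) = \<theta> (act' h y)"
proof -
  interpret aG: group_action G E act by fact
  interpret aH: group_action H Y act' by fact
  define \<theta>' where "\<theta>' = inv_into Y \<theta>"
  have \<theta>': "\<theta>' x \<in> Y" "\<theta> (\<theta>' x) = x" if "x \<in> E" for x
    using that \<theta> unfolding \<theta>'_def by (metis bij_betw_def inv_into_into, metis bij_betw_inv_into_right)
  have \<theta>E: "\<theta> y \<in> E" "\<theta>' (\<theta> y) = y" if "y \<in> Y" for y
    using that \<theta> unfolding \<theta>'_def by (metis bij_betwE, metis bij_betw_inv_into_left)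
  define b where "b h = restrict (\<lambda>x. \<theta> (act' h (\<theta>' x))) E" for h
  have bH: "group_action H E b"
    unfolding b_def using \<theta>' \<theta>E
    by (intro group_actionI aH.is_group) (auto simp: aH.act_closed aH.act_one aH.composition_rule)
  \<comment> \<open>An equality of functions, hence also a claim about arguments outside
    \<open>E\<close>; there extensionality decides.\<close>
  have agree: "act a = b (\<phi> a)" if a: "a \<in> A" for a
  proof
    fix x
    have ext: "act a \<in> extensional E"
      using aG.bij_prop0[of a] a A_subset by (auto simp: Bij_def)
    show "act a x = b (\<phi> a) x"
    proof (cases "x \<in> E")
      case True
      then show ?thesis using equi[OF a \<theta>'(1)[OF True]] \<theta>'(2)[OF True] by (simp add: b_def)
    next
      case False
      then show ?thesis using extensional_arb[OF ext False] by (simp add: b_def)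
    qed
  qed
  obtain \<Phi> where \<Phi>: "\<Phi> \<in> hom \<Gamma> (BijGroup E)" "\<And>g. g \<in> carrier G \<Longrightarrow> \<Phi> (inl g) = act g"
    "\<And>h. h \<in> carrier H \<Longrightarrow> \<Phi> (inr h) = b h"
    using universal_property[OF group_BijGroup group_hom.homh[OF aG.group_hom]
        group_hom.homh[OF group_action.group_hom[OF bH]] agree] by blast
  show ?thesis
  proof
    show "group_action \<Gamma> E \<Phi>"
      using \<Phi>(1) by (simp add: group_action_def group_hom_def group_hom_axioms_def group_BijGroup group_\<Gamma>)
    show "\<Phi> (inr h) (\<theta> y) = \<theta> (act' h y)" if "h \<in> carrier H" "y \<in> Y" for h y
      using that \<theta>E by (simp add: \<Phi> b_def)
  qed (simp add: \<Phi>)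
qed

end

subsection \<open>The permutation action on reduced words\<close>

definition reduced_words :: "'a set \<Rightarrow> ('a \<times> bool) list set" where
  "reduced_words X = {w. set w \<subseteq> X \<times> UNIV \<and> reduced_word w}"

text \<open>Left multiplication by a letter in the free group, carried out on reduced words.\<close>

fun push :: "'a \<times> bool \<Rightarrow> ('a \<times> bool) list \<Rightarrow> ('a \<times> bool) list" where
  "push l [] = [l]"
| "push l (k # w) = (if fst k = fst l \<and> snd k \<noteq> snd l then w else l # k # w)"

lemma push_reduced:
  assumes "w \<in> reduced_words X" "fst l \<in> X"
  shows "push l w \<in> reduced_words X"
  using assms by (cases w; cases l) (auto simp: reduced_words_def reduced_word_def successively_Cons)

lemma push_push:
  assumes "w \<in> reduced_words X"
  shows "push (x, \<not> b) (push (x, b) w) = w"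
proof (cases w)
  case (Cons k v)
  then show ?thesis using assms
    by (cases v; cases k) (auto simp: reduced_words_def reduced_word_def)
qed auto

lemma push_Cons: "reduced_word (l # w) \<Longrightarrow> push l w = l # w"
  by (cases w) (auto simp: reduced_word_def)

text \<open>One index set for both transversals: this is where the two factors are required to
  contain the common subgroup with the same index. The assumption \<open>u\<close> also contains the
  injectivity of \<open>\<phi>\<close> on \<open>A\<close>. The index \<open>i\<^sub>0\<close>
  stands for the coset of the unit in both groups.\<close>

locale amalgam_transversal = amalgam G H A \<phi>
  for G :: "('a, 'm) monoid_scheme" and H :: "('b, 'n) monoid_scheme" and A \<phi> +
  fixes I :: "'i set" and i\<^sub>0 :: 'i and t :: "'i \<Rightarrow> 'a" and u :: "'i \<Rightarrow> 'b"
  assumes subgroup_A: "subgroup A G" and \<phi>_hom: "\<phi> \<in> hom (G\<lparr>carrier := A\<rparr>) H"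
    and i\<^sub>0: "i\<^sub>0 \<in> I" "t i\<^sub>0 = \<one>\<^bsub>G\<^esub>" "u i\<^sub>0 = \<one>\<^bsub>H\<^esub>"
    and t_closed: "\<And>i. i \<in> I \<Longrightarrow> t i \<in> carrier G" and u_closed: "\<And>i. i \<in> I \<Longrightarrow> u i \<in> carrier H"
    and t: "bij_betw (\<lambda>(a, i). a \<otimes>\<^bsub>G\<^esub> t i) (A \<times> I) (carrier G)"
    and u: "bij_betw (\<lambda>(a, i). \<phi> a \<otimes>\<^bsub>H\<^esub> u i) (A \<times> I) (carrier H)"
begin

lemma \<phi>_mult: "a \<in> A \<Longrightarrow> b \<in> A \<Longrightarrow> \<phi> (a \<otimes>\<^bsub>G\<^esub> b) = \<phi> a \<otimes>\<^bsub>H\<^esub> \<phi> b"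
  using hom_mult[OF \<phi>_hom] by simp

lemma \<phi>_carrier: "a \<in> A \<Longrightarrow> \<phi> a \<in> carrier H"
  using \<phi>_closed by blast

lemma A_carrier: "a \<in> A \<Longrightarrow> a \<in> carrier G"
  using A_subset by blast

lemma A_one: "\<one>\<^bsub>G\<^esub> \<in> A" and A_mult: "a \<in> A \<Longrightarrow> b \<in> A \<Longrightarrow> a \<otimes>\<^bsub>G\<^esub> b \<in> A"
  using subgroup_A by (auto simp: subgroup.one_closed subgroup.m_closed)

lemma \<phi>_one: "\<phi> \<one>\<^bsub>G\<^esub> = \<one>\<^bsub>H\<^esub>"
  using \<phi>_mult[OF A_one A_one] \<phi>_carrier[OF A_one] by (metis A_carrier A_one G.r_one H.r_cancel_one')

lemma decompose_G:
  assumes "g \<in> carrier G" obtains a i where "a \<in> A" "i \<in> I" "g = a \<otimes>\<^bsub>G\<^esub> t i"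
proof -
  have "g \<in> (\<lambda>(a, i). a \<otimes>\<^bsub>G\<^esub> t i) ` (A \<times> I)" using assms t by (simp add: bij_betw_def)
  then show ?thesis using that by auto
qed

lemma decompose_H:
  assumes "h \<in> carrier H" obtains a i where "a \<in> A" "i \<in> I" "h = \<phi> a \<otimes>\<^bsub>H\<^esub> u i"
proof -
  have "h \<in> (\<lambda>(a, i). \<phi> a \<otimes>\<^bsub>H\<^esub> u i) ` (A \<times> I)" using assms u by (simp add: bij_betw_def)
  then show ?thesis using that by auto
qed

definition coords :: "'b \<Rightarrow> 'a \<times> 'i" where
  "coords = inv_into (A \<times> I) (\<lambda>(a, i). \<phi> a \<otimes>\<^bsub>H\<^esub> u i)"

lemma coords: "a \<in> A \<Longrightarrow> i \<in> I \<Longrightarrow> coords (\<phi> a \<otimes>\<^bsub>H\<^esub> u i) = (a, i)"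
  using bij_betw_inv_into_left[OF u, of "(a, i)"] by (simp add: coords_def)

lemma coords_bij: "bij_betw coords (carrier H) (A \<times> I)"
  unfolding coords_def using u by (rule bij_betw_inv_into)

definition gen :: "'i \<Rightarrow> ('a + 'b) list set" where
  "gen i = inl (inv\<^bsub>G\<^esub> t i) \<otimes>\<^bsub>\<Gamma>\<^esub> inr (u i)"

abbreviation "gens \<equiv> gen ` (I - {i\<^sub>0})"
abbreviation "D \<equiv> generate \<Gamma> gens"

sublocale \<Gamma>: group "amalgamated_product G H A \<phi>" by (rule group_\<Gamma>)
sublocale inl: group_hom G "amalgamated_product G H A \<phi>" inl
  by unfold_locales (rule inl_hom)
sublocale inr: group_hom H "amalgamated_product G H A \<phi>" inr
  by unfold_locales (rule inr_hom)

lemma gen_closed: "i \<in> I \<Longrightarrow> gen i \<in> carrier \<Gamma>"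
  by (simp add: gen_def t_closed u_closed)

lemma gens_carrier: "gens \<subseteq> carrier \<Gamma>"
  using gen_closed by auto

lemma subgroup_D: "subgroup D \<Gamma>"
  by (rule \<Gamma>.generate_is_subgroup[OF gens_carrier])

lemma gen_D: "i \<in> I \<Longrightarrow> gen i \<in> D"
proof (cases "i = i\<^sub>0")
  case True then show ?thesis by (simp add: gen_def i\<^sub>0 generate.one)
qed (auto intro: generate.incl)

lemma inr_u: "i \<in> I \<Longrightarrow> inr (u i) = inl (t i) \<otimes>\<^bsub>\<Gamma>\<^esub> gen i"
  by (simp add: gen_def t_closed u_closed \<Gamma>.m_assoc[symmetric] flip: inl.hom_mult)

text \<open>The regular actions of both factors are multiplied by the set of reduced words and
  matched so that the coset with index \<open>i\<close> shifts the word by the letter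
  \<open>i\<close>. Over the unit, \<open>gen i\<close> then acts like a free generator.\<close>

lemma free_action:
  obtains \<Phi> where "group_action \<Gamma> (carrier G \<times> reduced_words (I - {i\<^sub>0})) \<Phi>"
    "\<And>g k w. g \<in> carrier G \<Longrightarrow> k \<in> carrier G \<Longrightarrow> w \<in> reduced_words (I - {i\<^sub>0}) \<Longrightarrow>
      \<Phi> (inl g) (k, w) = (g \<otimes>\<^bsub>G\<^esub> k, w)"
    "\<And>i w. i \<in> I - {i\<^sub>0} \<Longrightarrow> w \<in> reduced_words (I - {i\<^sub>0}) \<Longrightarrow> \<Phi> (gen i) (\<one>\<^bsub>G\<^esub>, w) = (\<one>\<^bsub>G\<^esub>, push (i, True) w)"
proof -
  let ?P = "reduced_words (I - {i\<^sub>0})"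
  define q where "q i w = (if i = i\<^sub>0 then w else push (i, True) w)" for i w
  define q' where "q' i w = (if i = i\<^sub>0 then w else push (i, False) w)" for i w
  have q: "q i w \<in> ?P" "q' i w \<in> ?P" "q' i (q i w) = w" "q i (q' i w) = w" if "i \<in> I" "w \<in> ?P" for i w
    using that push_push[of w "I - {i\<^sub>0}" i True] push_push[of w "I - {i\<^sub>0}" i False]
    by (auto simp: q_def q'_def push_reduced)
  define act where "act g = restrict (\<lambda>(k, w). (g \<otimes>\<^bsub>G\<^esub> k, w)) (carrier G \<times> ?P)" for g
  define act' where "act' h = restrict (\<lambda>(k, w). (h \<otimes>\<^bsub>H\<^esub> k, w)) (carrier H \<times> ?P)" for h
  have act: "group_action G (carrier G \<times> ?P) act"
    unfolding act_def by (intro group_actionI G.is_group) (auto simp: G.m_assoc)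
  have act': "group_action H (carrier H \<times> ?P) act'"
    unfolding act'_def by (intro group_actionI H.is_group) (auto simp: H.m_assoc)
  \<comment> \<open>The shift depends only on the index of the coset, hence it commutes with the
    action of \<open>A\<close>.\<close>
  define \<theta> where "\<theta> = (\<lambda>(h, w). case coords h of (a, i) \<Rightarrow> (a \<otimes>\<^bsub>G\<^esub> t i, q i w))"
  have \<theta>: "\<theta> (\<phi> a \<otimes>\<^bsub>H\<^esub> u i, w) = (a \<otimes>\<^bsub>G\<^esub> t i, q i w)" if "a \<in> A" "i \<in> I" for a i w
    using that by (simp add: \<theta>_def coords)
  have b1: "bij_betw (\<lambda>(h, w). (coords h, w)) (carrier H \<times> ?P) ((A \<times> I) \<times> ?P)"
    using bij_betw_map_prod[OF coords_bij bij_betw_id[of ?P]] by (simp add: map_prod_def id_def)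
  have b2: "bij_betw (\<lambda>((a, i), w). ((a, i), q i w)) ((A \<times> I) \<times> ?P) ((A \<times> I) \<times> ?P)"
    by (rule bij_betwI[where g = "\<lambda>((a, i), w). ((a, i), q' i w)"]) (auto simp: q)
  have b3: "bij_betw (\<lambda>(ai, w). ((\<lambda>(a, i). a \<otimes>\<^bsub>G\<^esub> t i) ai, w)) ((A \<times> I) \<times> ?P) (carrier G \<times> ?P)"
    using bij_betw_map_prod[OF t bij_betw_id[of ?P]] by (simp add: map_prod_def id_def)
  have "bij_betw ((\<lambda>(ai, w). ((\<lambda>(a, i). a \<otimes>\<^bsub>G\<^esub> t i) ai, w)) \<circ>
      ((\<lambda>((a, i), w). ((a, i), q i w)) \<circ> (\<lambda>(h, w). (coords h, w)))) (carrier H \<times> ?P) (carrier G \<times> ?P)"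
    by (rule bij_betw_trans[OF bij_betw_trans[OF b1 b2] b3])
  then have bij: "bij_betw \<theta> (carrier H \<times> ?P) (carrier G \<times> ?P)"
    by (rule bij_betw_cong[THEN iffD1, rotated]) (auto simp: \<theta>_def split: prod.splits)
  have equi: "\<theta> (act' (\<phi> a) y) = act a (\<theta> y)" if a: "a \<in> A" and y: "y \<in> carrier H \<times> ?P" for a y
  proof -
    obtain h w where hw: "y = (h, w)" "h \<in> carrier H" "w \<in> ?P" using y by auto
    obtain b i where b: "b \<in> A" "i \<in> I" "h = \<phi> b \<otimes>\<^bsub>H\<^esub> u i" using decompose_H hw by blast
    have "\<phi> a \<otimes>\<^bsub>H\<^esub> h = \<phi> (a \<otimes>\<^bsub>G\<^esub> b) \<otimes>\<^bsub>H\<^esub> u i"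
      using a b by (simp add: \<phi>_mult \<phi>_carrier u_closed H.m_assoc)
    then have "\<theta> (act' (\<phi> a) y) = (a \<otimes>\<^bsub>G\<^esub> b \<otimes>\<^bsub>G\<^esub> t i, q i w)"
      using a b hw by (simp add: act'_def \<theta> A_mult)
    moreover have "act a (\<theta> y) = (a \<otimes>\<^bsub>G\<^esub> (b \<otimes>\<^bsub>G\<^esub> t i), q i w)"
      using a b hw q(1)[of i w] by (simp add: act_def \<theta> A_carrier t_closed)
    ultimately show ?thesis using a b by (simp add: G.m_assoc A_carrier t_closed)
  qed
  obtain \<Phi> where \<Phi>: "group_action \<Gamma> (carrier G \<times> ?P) \<Phi>"
    "\<And>g x. g \<in> carrier G \<Longrightarrow> \<Phi> (inl g) x = act g x"
    "\<And>h y. h \<in> carrier H \<Longrightarrow> y \<in> carrier H \<times> ?P \<Longrightarrow> \<Phi> (inr h) (\<theta> y) = \<theta> (act' h y)"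
    using glue_actions[OF act act' bij equi] by blast
  interpret \<Phi>: group_action "amalgamated_product G H A \<phi>" "carrier G \<times> ?P" \<Phi> by (rule \<Phi>)
  show ?thesis
  proof
    show "group_action \<Gamma> (carrier G \<times> ?P) \<Phi>" by (rule \<Phi>)
    show "\<Phi> (inl g) (k, w) = (g \<otimes>\<^bsub>G\<^esub> k, w)" if "g \<in> carrier G" "k \<in> carrier G" "w \<in> ?P" for g k w
      using that by (simp add: \<Phi>(2) act_def)
    show "\<Phi> (gen i) (\<one>\<^bsub>G\<^esub>, w) = (\<one>\<^bsub>G\<^esub>, push (i, True) w)" if i: "i \<in> I - {i\<^sub>0}" and w: "w \<in> ?P" for i w
    proof -
      have eq: "\<theta> (\<one>\<^bsub>H\<^esub>, w) = (\<one>\<^bsub>G\<^esub>, w)" "\<theta> (u i, w) = (t i, q i w)"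
        using \<theta>[OF A_one i\<^sub>0(1), of w] \<theta>[OF A_one, of i w] i by (auto simp: \<phi>_one i\<^sub>0 q_def t_closed u_closed)
      have "\<Phi> (inr (u i)) (\<theta> (\<one>\<^bsub>H\<^esub>, w)) = \<theta> (u i, w)"
        using i w by (subst \<Phi>(3)) (auto simp: act'_def u_closed)
      then have "\<Phi> (inr (u i)) (\<one>\<^bsub>G\<^esub>, w) = (t i, q i w)" unfolding eq .
      moreover have "\<Phi> (gen i) (\<one>\<^bsub>G\<^esub>, w) = \<Phi> (inl (inv\<^bsub>G\<^esub> t i)) (\<Phi> (inr (u i)) (\<one>\<^bsub>G\<^esub>, w))"
        unfolding gen_def using i w by (intro \<Phi>.composition_rule) (auto simp: t_closed u_closed)
      ultimately show ?thesis using i w q(1)[of i w] by (simp add: \<Phi>(2) act_def t_closed q_def del: inl.hom_inv)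
    qed
  qed
qed

text \<open>Since \<open>inr (u i)\<close> is \<open>inl (t i)\<close> times an element of
  \<open>D\<close>, both factors represent the same left cosets of \<open>D\<close>. The set of
  products is therefore stable under left multiplication by either factor.\<close>

lemma \<Gamma>_eq_inl_D: "x \<in> carrier \<Gamma> \<Longrightarrow> \<exists>g\<in>carrier G. \<exists>d\<in>D. x = inl g \<otimes>\<^bsub>\<Gamma>\<^esub> d"
proof (induction rule: \<Gamma>_induct)
  case one
  show ?case by (intro bexI[of _ "\<one>\<^bsub>G\<^esub>"] bexI[of _ "\<one>\<^bsub>\<Gamma>\<^esub>"]) (auto simp: generate.one)
next
  case (inl g x)
  then obtain k d where k: "k \<in> carrier G" "d \<in> D" "x = inl k \<otimes>\<^bsub>\<Gamma>\<^esub> d" by blast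
  then have "inl g \<otimes>\<^bsub>\<Gamma>\<^esub> x = inl (g \<otimes>\<^bsub>G\<^esub> k) \<otimes>\<^bsub>\<Gamma>\<^esub> d"
    using inl \<Gamma>.generate_in_carrier[OF gens_carrier] by (simp add: \<Gamma>.m_assoc)
  then show ?case using k inl by blast
next
  case (inr h x)
  then obtain k d where k: "k \<in> carrier G" "d \<in> D" "x = inl k \<otimes>\<^bsub>\<Gamma>\<^esub> d" by blast
  obtain a i where a: "a \<in> A" "i \<in> I" "k = a \<otimes>\<^bsub>G\<^esub> t i" using decompose_G k by blast
  have "h \<otimes>\<^bsub>H\<^esub> (\<phi> a \<otimes>\<^bsub>H\<^esub> u i) \<in> carrier H" using inr a by (simp add: \<phi>_carrier u_closed)
  then obtain b j where b: "b \<in> A" "j \<in> I" "h \<otimes>\<^bsub>H\<^esub> (\<phi> a \<otimes>\<^bsub>H\<^esub> u i) = \<phi> b \<otimes>\<^bsub>H\<^esub> u j"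
    using decompose_H by blast
  have D: "y \<in> carrier \<Gamma>" if "y \<in> D" for y using that \<Gamma>.generate_in_carrier[OF gens_carrier] by blast
  note cl = inr(1) a(1,2) b(1,2) k(1,2) D[OF k(2)] gen_closed A_carrier \<phi>_carrier t_closed u_closed
  have "inl (t i) = inr (u i) \<otimes>\<^bsub>\<Gamma>\<^esub> inv\<^bsub>\<Gamma>\<^esub> gen i"
    using cl by (simp add: inr_u \<Gamma>.m_assoc)
  then have "x = inr (\<phi> a \<otimes>\<^bsub>H\<^esub> u i) \<otimes>\<^bsub>\<Gamma>\<^esub> (inv\<^bsub>\<Gamma>\<^esub> gen i \<otimes>\<^bsub>\<Gamma>\<^esub> d)"
    unfolding k(3) a(3) using cl by (simp add: inl_eq_inr \<Gamma>.m_assoc)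
  then have "inr h \<otimes>\<^bsub>\<Gamma>\<^esub> x = inr (h \<otimes>\<^bsub>H\<^esub> (\<phi> a \<otimes>\<^bsub>H\<^esub> u i)) \<otimes>\<^bsub>\<Gamma>\<^esub> (inv\<^bsub>\<Gamma>\<^esub> gen i \<otimes>\<^bsub>\<Gamma>\<^esub> d)"
    using cl by (simp add: \<Gamma>.m_assoc)
  also have "\<dots> = inl (b \<otimes>\<^bsub>G\<^esub> t j) \<otimes>\<^bsub>\<Gamma>\<^esub> (gen j \<otimes>\<^bsub>\<Gamma>\<^esub> (inv\<^bsub>\<Gamma>\<^esub> gen i \<otimes>\<^bsub>\<Gamma>\<^esub> d))"
    unfolding b(3) using cl by (simp add: inl_eq_inr inr_u \<Gamma>.m_assoc)
  finally have "inr h \<otimes>\<^bsub>\<Gamma>\<^esub> x = inl (b \<otimes>\<^bsub>G\<^esub> t j) \<otimes>\<^bsub>\<Gamma>\<^esub> (gen j \<otimes>\<^bsub>\<Gamma>\<^esub> (inv\<^bsub>\<Gamma>\<^esub> gen i \<otimes>\<^bsub>\<Gamma>\<^esub> d))" .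
  moreover have "gen j \<otimes>\<^bsub>\<Gamma>\<^esub> (inv\<^bsub>\<Gamma>\<^esub> gen i \<otimes>\<^bsub>\<Gamma>\<^esub> d) \<in> D"
    using subgroup_D gen_D a b k by (simp add: subgroup.m_closed subgroup.m_inv_closed)
  ultimately show ?case using cl by blast
qed

text \<open>A reduced word in the generators moves the empty word over the unit to that very word,
  so it is nontrivial unless empty. Moreover \<open>D\<close> preserves the points over the unit and
  a nontrivial \<open>inl g\<close> does not; hence the cosets of the elements \<open>inl g\<close>
  are distinct, and the index of \<open>D\<close> is the order of \<open>G\<close>.\<close>

lemma D_free:
  "freely_generated_by (\<Gamma>\<lparr>carrier := D\<rparr>) gens" "inj_on gen (I - {i\<^sub>0})" "bij_betw (\<lambda>g. D #>\<^bsub>\<Gamma>\<^esub> inl g) (carrier G) (rcosets\<^bsub>\<Gamma>\<^esub> D)"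
proof -
  let ?J = "I - {i\<^sub>0}" let ?P = "reduced_words (I - {i\<^sub>0})"
  obtain \<Phi> where \<Phi>: "group_action \<Gamma> (carrier G \<times> ?P) \<Phi>"
    "\<And>g k w. g \<in> carrier G \<Longrightarrow> k \<in> carrier G \<Longrightarrow> w \<in> ?P \<Longrightarrow> \<Phi> (inl g) (k, w) = (g \<otimes>\<^bsub>G\<^esub> k, w)"
    "\<And>i w. i \<in> ?J \<Longrightarrow> w \<in> ?P \<Longrightarrow> \<Phi> (gen i) (\<one>\<^bsub>G\<^esub>, w) = (\<one>\<^bsub>G\<^esub>, push (i, True) w)"
    using free_action by blast
  interpret \<Phi>: group_action "amalgamated_product G H A \<phi>" "carrier G \<times> ?P" \<Phi> by (rule \<Phi>)
  have nil: "[] \<in> ?P" by (simp add: reduced_words_def reduced_word_def)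
  show inj: "inj_on gen ?J"
  proof (rule inj_onI)
    fix i j assume ij: "i \<in> ?J" "j \<in> ?J" "gen i = gen j"
    have "(\<one>\<^bsub>G\<^esub>, push (i, True) []) = (\<one>\<^bsub>G\<^esub>, push (j, True) [])"
      using \<Phi>(3)[OF ij(1) nil] \<Phi>(3)[OF ij(2) nil] unfolding ij(3) by metis
    then show "i = j" by simp
  qed
  have letter: "\<Phi> (letter_value (\<Gamma>\<lparr>carrier := D\<rparr>) (gen i, b)) (\<one>\<^bsub>G\<^esub>, w) = (\<one>\<^bsub>G\<^esub>, push (i, b) w)"
    if i: "i \<in> ?J" and w: "w \<in> ?P" for i b w
  proof (cases b)
    case False
    have w': "push (i, False) w \<in> ?P" using push_reduced[OF w, of "(i, False)"] i by simp
    have eq: "push (i, True) (push (i, False) w) = w" using push_push[OF w, of i False] by simp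
    have "\<Phi> (inv\<^bsub>\<Gamma>\<^esub> gen i) (\<one>\<^bsub>G\<^esub>, w) = (\<one>\<^bsub>G\<^esub>, push (i, False) w)"
      by (rule \<Phi>.orbit_sym_aux) (use i w w' \<Phi>(3)[OF i w'] eq gen_closed in auto)
    then show ?thesis using False i gen_D subgroup_D by (simp add: letter_value_def \<Gamma>.m_inv_consistent)
  qed (use \<Phi>(3) that in \<open>simp add: letter_value_def\<close>)
  have letter_D: "letter_value (\<Gamma>\<lparr>carrier := D\<rparr>) (gen i, b) \<in> D" if "i \<in> ?J" for i b
    using that letter_value_closed[OF \<Gamma>.subgroup_imp_group[OF subgroup_D], of "(gen i, b)"] gen_D by simp
  have D: "y \<in> carrier \<Gamma>" if "y \<in> D" for y using that \<Gamma>.generate_in_carrier[OF gens_carrier] by blast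
  have word: "word_value (\<Gamma>\<lparr>carrier := D\<rparr>) (map (apfst gen) v) \<in> D \<and>
      \<Phi> (word_value (\<Gamma>\<lparr>carrier := D\<rparr>) (map (apfst gen) v)) (\<one>\<^bsub>G\<^esub>, []) = (\<one>\<^bsub>G\<^esub>, v)"
    if "v \<in> ?P" for v
    using that
  proof (induction v)
    case Nil
    then show ?case using \<Phi>.act_one nil by (simp add: word_value_def generate.one)
  next
    case (Cons l v)
    obtain i b where l: "l = (i, b)" by fastforce
    have v: "v \<in> ?P" and i: "i \<in> ?J" and red: "reduced_word ((i, b) # v)"
      using Cons.prems l by (auto simp: reduced_words_def reduced_word_def successively_Cons)
    let ?x = "letter_value (\<Gamma>\<lparr>carrier := D\<rparr>) (gen i, b)"
    let ?y = "word_value (\<Gamma>\<lparr>carrier := D\<rparr>) (map (apfst gen) v)"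
    have xy: "?x \<in> D" "?y \<in> D" using letter_D[OF i] Cons.IH[OF v] by auto
    have eq: "word_value (\<Gamma>\<lparr>carrier := D\<rparr>) (map (apfst gen) (l # v)) = ?x \<otimes>\<^bsub>\<Gamma>\<^esub> ?y"
      by (simp add: word_value_def l)
    have "\<Phi> (?x \<otimes>\<^bsub>\<Gamma>\<^esub> ?y) (\<one>\<^bsub>G\<^esub>, []) = \<Phi> ?x (\<Phi> ?y (\<one>\<^bsub>G\<^esub>, []))"
      using xy D nil by (intro \<Phi>.composition_rule) auto
    also have "\<dots> = (\<one>\<^bsub>G\<^esub>, push (i, b) v)" using Cons.IH[OF v] letter[OF i v] by simp
    finally show ?case unfolding eq using xy subgroup_D red l by (simp add: subgroup.m_closed push_Cons)
  qed
  show "freely_generated_by (\<Gamma>\<lparr>carrier := D\<rparr>) gens"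
    unfolding freely_generated_by_def
  proof (intro conjI allI impI)
    show "gens \<subseteq> carrier (\<Gamma>\<lparr>carrier := D\<rparr>)" by (auto intro: generate.incl)
    show "generate (\<Gamma>\<lparr>carrier := D\<rparr>) gens = carrier (\<Gamma>\<lparr>carrier := D\<rparr>)"
      using \<Gamma>.generate_consistent[OF _ subgroup_D, of gens] by (auto intro: generate.incl)
    fix w assume w: "set w \<subseteq> gens \<times> UNIV \<and> reduced_word w \<and> w \<noteq> []"
    define v where "v = map (apfst (inv_into ?J gen)) w"
    have "gen (inv_into ?J gen (fst l)) = fst l" if "l \<in> set w" for l
    proof (rule f_inv_into_f)
      have "l \<in> gens \<times> UNIV" using that w by blast
      then show "fst l \<in> gens" by (rule mem_Times_iff[THEN iffD1, THEN conjunct1])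
    qed
    then have "map (apfst gen) v = w"
      unfolding v_def map_map by (intro map_idI) (simp add: prod_eq_iff)
    moreover have "v \<in> ?P"
    proof -
      have "inv_into ?J gen (fst l) \<in> ?J" if "l \<in> set w" for l
      proof (rule inv_into_into)
        have "l \<in> gens \<times> UNIV" using that w by blast
        then show "fst l \<in> gens" by (rule mem_Times_iff[THEN iffD1, THEN conjunct1])
      qed
      then have "set v \<subseteq> ?J \<times> UNIV" unfolding v_def by (simp add: image_subset_iff mem_Times_iff)
      moreover have "reduced_word v"
      proof -
        have "successively (\<lambda>k l. \<not> (gen (fst k) = gen (fst l) \<and> snd k \<noteq> snd l)) v"
          using w unfolding \<open>map (apfst gen) v = w\<close>[symmetric] reduced_word_def successively_map by simp
        then show ?thesis unfolding reduced_word_def by (rule successively_mono) auto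
      qed
      ultimately show ?thesis by (simp add: reduced_words_def)
    qed
    ultimately have "\<Phi> (word_value (\<Gamma>\<lparr>carrier := D\<rparr>) w) (\<one>\<^bsub>G\<^esub>, []) = (\<one>\<^bsub>G\<^esub>, v)" using word by metis
    moreover have "v \<noteq> []" using w by (simp add: v_def)
    ultimately show "word_value (\<Gamma>\<lparr>carrier := D\<rparr>) w \<noteq> \<one>\<^bsub>\<Gamma>\<lparr>carrier := D\<rparr>\<^esub>"
      using \<Phi>.act_one[of "(\<one>\<^bsub>G\<^esub>, [])"] nil by auto
  qed
  \<comment> \<open>The induction has to range over all words \<open>v\<close>, since a product
    passes through other words than the empty one.\<close>
  have fixes_one: "\<exists>w\<in>?P. \<Phi> d (\<one>\<^bsub>G\<^esub>, []) = (\<one>\<^bsub>G\<^esub>, w)" if "d \<in> D" for d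
  proof -
    have "\<forall>v\<in>?P. \<exists>w\<in>?P. \<Phi> d (\<one>\<^bsub>G\<^esub>, v) = (\<one>\<^bsub>G\<^esub>, w)"
      using that
    proof (induction rule: generate.induct)
      case one then show ?case using \<Phi>.act_one by auto
    next
      case (incl h) then show ?case using \<Phi>(3) push_reduced by fastforce
    next
      case (inv h)
      then obtain i where i: "i \<in> ?J" "h = gen i" by blast
      then show ?case
        using letter[of i _ False] gen_D subgroup_D push_reduced[of _ ?J "(i, False)"]
        by (fastforce simp: letter_value_def \<Gamma>.m_inv_consistent)
    next
      case (eng h k)
      show ?case
      proof
        fix v assume v: "v \<in> ?P"
        then obtain w where w: "w \<in> ?P" "\<Phi> k (\<one>\<^bsub>G\<^esub>, v) = (\<one>\<^bsub>G\<^esub>, w)" using eng.IH by blast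
        have "\<Phi> (h \<otimes>\<^bsub>\<Gamma>\<^esub> k) (\<one>\<^bsub>G\<^esub>, v) = \<Phi> h (\<Phi> k (\<one>\<^bsub>G\<^esub>, v))"
          using eng.hyps D v by (intro \<Phi>.composition_rule) auto
        then show "\<exists>w\<in>?P. \<Phi> (h \<otimes>\<^bsub>\<Gamma>\<^esub> k) (\<one>\<^bsub>G\<^esub>, v) = (\<one>\<^bsub>G\<^esub>, w)" using w eng.IH by auto
      qed
    qed
    then show ?thesis using nil by blast
  qed
  interpret D: subgroup D "amalgamated_product G H A \<phi>" by (rule subgroup_D)
  show "bij_betw (\<lambda>g. D #>\<^bsub>\<Gamma>\<^esub> inl g) (carrier G) (rcosets\<^bsub>\<Gamma>\<^esub> D)"
    unfolding bij_betw_def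
  proof
    show "inj_on (\<lambda>g. D #>\<^bsub>\<Gamma>\<^esub> inl g) (carrier G)"
    proof (rule inj_onI)
      fix g k assume gk: "g \<in> carrier G" "k \<in> carrier G" "D #>\<^bsub>\<Gamma>\<^esub> inl g = D #>\<^bsub>\<Gamma>\<^esub> inl k"
      then have "inl g \<in> D #>\<^bsub>\<Gamma>\<^esub> inl k" using \<Gamma>.rcos_self[of "inl g" D] subgroup_D by simp
      then have "inl g \<otimes>\<^bsub>\<Gamma>\<^esub> inv\<^bsub>\<Gamma>\<^esub> inl k \<in> D"
        using D.rcos_module_imp[OF \<Gamma>.is_group] gk by simp
      then have "inl (g \<otimes>\<^bsub>G\<^esub> inv\<^bsub>G\<^esub> k) \<in> D" using gk by simp
      then have "g \<otimes>\<^bsub>G\<^esub> inv\<^bsub>G\<^esub> k = \<one>\<^bsub>G\<^esub>" using fixes_one[of "inl (g \<otimes>\<^bsub>G\<^esub> inv\<^bsub>G\<^esub> k)"] gk nil by (auto simp: \<Phi>(2) simp del: inl.hom_mult)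
      then show "g = k" using gk by (metis G.inv_closed G.inv_equality G.inv_inv)
    qed
    show "(\<lambda>g. D #>\<^bsub>\<Gamma>\<^esub> inl g) ` carrier G = rcosets\<^bsub>\<Gamma>\<^esub> D"
    proof (intro equalityI subsetI)
      fix R assume "R \<in> rcosets\<^bsub>\<Gamma>\<^esub> D"
      then obtain x where x: "x \<in> carrier \<Gamma>" "R = D #>\<^bsub>\<Gamma>\<^esub> x" by (auto simp: RCOSETS_def)
      then obtain g d where gd: "g \<in> carrier G" "d \<in> D" "inv\<^bsub>\<Gamma>\<^esub> x = inl g \<otimes>\<^bsub>\<Gamma>\<^esub> d" using \<Gamma>_eq_inl_D[of "inv\<^bsub>\<Gamma>\<^esub> x"] by auto
      then have "x = inv\<^bsub>\<Gamma>\<^esub> (inl g \<otimes>\<^bsub>\<Gamma>\<^esub> d)" using x by (metis \<Gamma>.inv_inv)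
      also have "\<dots> = inv\<^bsub>\<Gamma>\<^esub> d \<otimes>\<^bsub>\<Gamma>\<^esub> inl (inv\<^bsub>G\<^esub> g)" using gd D by (simp add: \<Gamma>.inv_mult_group)
      finally have "R = (D #>\<^bsub>\<Gamma>\<^esub> inv\<^bsub>\<Gamma>\<^esub> d) #>\<^bsub>\<Gamma>\<^esub> inl (inv\<^bsub>G\<^esub> g)"
        unfolding x(2) using gd D D.subset by (simp add: \<Gamma>.coset_mult_assoc)
      also have "D #>\<^bsub>\<Gamma>\<^esub> inv\<^bsub>\<Gamma>\<^esub> d = D" using gd D subgroup_D by (intro \<Gamma>.coset_join2) auto
      finally show "R \<in> (\<lambda>g. D #>\<^bsub>\<Gamma>\<^esub> inl g) ` carrier G"
        using G.inv_closed[OF gd(1)] by (rule image_eqI)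
    qed (use D.subset in \<open>auto intro: \<Gamma>.rcosetsI\<close>)
  qed
qed

text \<open>Rank |I| - 1 and index |G| give 1 - (|I| - 1) = 2 - |I| in the numerator. As both
  factors have order |A| |I|, this is the value 1/|G| + 1/|H| - 1/|A|.\<close>

theorem euler_characteristic_amalgam:
  assumes "finite (carrier G)" "finite I"
  shows "euler_characteristic \<Gamma> = (2 - of_nat (card I)) / of_nat (card (carrier G))"
proof -
  have index: "card (rcosets\<^bsub>\<Gamma>\<^esub> D) = card (carrier G)" "finite (rcosets\<^bsub>\<Gamma>\<^esub> D)"
    using bij_betw_same_card[OF D_free(3)] bij_betw_finite[OF D_free(3)] assms by auto
  have rank: "card gens = card I - 1" using card_image[OF D_free(2)] i\<^sub>0 by simp
  have "card I > 0" using i\<^sub>0 assms card_gt_0_iff by blast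
  then have val: "(2 - of_nat (card I)) / of_nat (card (carrier G)) = (1 - rat_of_nat (card gens)) / of_nat (card (rcosets\<^bsub>\<Gamma>\<^esub> D))"
    unfolding index rank by (simp add: of_nat_diff)
  show ?thesis
    unfolding euler_characteristic_def
  proof (rule the_equality)
    show "\<exists>F X. subgroup F \<Gamma> \<and> finite (rcosets\<^bsub>\<Gamma>\<^esub> F) \<and> finite X \<and> freely_generated_by (\<Gamma>\<lparr>carrier := F\<rparr>) X \<and>
       (2 - of_nat (card I)) / of_nat (card (carrier G)) = (1 - rat_of_nat (card X)) / of_nat (card (rcosets\<^bsub>\<Gamma>\<^esub> F))"
      using subgroup_D index D_free(1) assms val by (intro exI[of _ D] exI[of _ gens]) auto
  next
    fix q assume "\<exists>F X. subgroup F \<Gamma> \<and> finite (rcosets\<^bsub>\<Gamma>\<^esub> F) \<and> finite X \<and> freely_generated_by (\<Gamma>\<lparr>carrier := F\<rparr>) X \<and>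
       q = (1 - rat_of_nat (card X)) / of_nat (card (rcosets\<^bsub>\<Gamma>\<^esub> F))"
    then obtain F X where "subgroup F \<Gamma>" "finite (rcosets\<^bsub>\<Gamma>\<^esub> F)" "finite X" "freely_generated_by (\<Gamma>\<lparr>carrier := F\<rparr>) X"
       "q = (1 - rat_of_nat (card X)) / of_nat (card (rcosets\<^bsub>\<Gamma>\<^esub> F))" by blast
    then show "q = (2 - of_nat (card I)) / of_nat (card (carrier G))"
      unfolding val using \<Gamma>.free_subgroup_rank_index[of F X D gens] subgroup_D D_free(1) index assms by simp
  qed
qed

end

section \<open>Fixed points and orbits of actions of the symmetric group of degree four\<close>

definition fixed_points where "fixed_points E act g = card (invariants E act g)"

text \<open>The element \<open>h\<close> maps fixed points of \<open>g\<close> to fixed points of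
  \<open>k\<close>. Conjugacy is stated without an inverse so that, for concrete permutations, it
  can be checked by evaluating two compositions.\<close>

lemma (in group_action) fixed_points_conj:
  assumes "finite E" "g \<in> carrier G" "h \<in> carrier G" "k \<in> carrier G" "h \<otimes>\<^bsub>G\<^esub> g = k \<otimes>\<^bsub>G\<^esub> h"
  shows "fixed_points E \<phi> g \<le> fixed_points E \<phi> k"
  unfolding fixed_points_def
proof (rule card_inj_on_le)
  show "inj_on (\<phi> h) (invariants E \<phi> g)"
    using inj_prop[OF assms(3)] by (rule inj_on_subset) (auto simp: invariants_def)
  have "\<phi> k (\<phi> h x) = \<phi> h (\<phi> g x)" if "x \<in> E" for x
    using composition_rule[OF that assms(3,2)] composition_rule[OF that assms(4,3)] assms(5) by simp
  then show "\<phi> h ` invariants E \<phi> g \<subseteq> invariants E \<phi> k"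
    using assms by (auto simp: invariants_def act_closed)
qed (use assms in \<open>simp add: invariants_def\<close>)

lemma (in group_action) invariants_Int:
  assumes "g \<in> carrier G" "h \<in> carrier G"
  shows "invariants E \<phi> g \<inter> invariants E \<phi> h \<subseteq> invariants E \<phi> (g \<otimes>\<^bsub>G\<^esub> h)"
  using assms by (auto simp: invariants_def composition_rule)

lemma (in group_action) fixed_points_one: "fixed_points E \<phi> \<one>\<^bsub>G\<^esub> = card E"
proof -
  have "invariants E \<phi> \<one>\<^bsub>G\<^esub> = E" by (auto simp: invariants_def act_one)
  then show ?thesis by (simp add: fixed_points_def)
qed

lemma (in group_action) card_orbits_subgroup:
  assumes "finite E" "subgroup U G" "finite U"
  shows "card (orbits (G\<lparr>carrier := U\<rparr>) E \<phi>) * card U = (\<Sum>g\<in>U. fixed_points E \<phi> g)"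
proof -
  interpret U: group_action "G\<lparr>carrier := U\<rparr>" E \<phi> by (rule induced_action[OF assms(2)])
  show ?thesis using U.burnside assms by (simp add: order_def fixed_points_def)
qed

abbreviation "S4 \<equiv> sym_group 4"

abbreviation (input) "v1 \<equiv> transpose (1::nat) 2 \<circ> transpose 3 4"
abbreviation (input) "v2 \<equiv> transpose (1::nat) 3 \<circ> transpose 2 4"
abbreviation (input) "v3 \<equiv> transpose (1::nat) 4 \<circ> transpose 2 3"

lemma card_S4: "card (carrier S4) = 24" "finite (carrier S4)"
proof -
  have "carrier S4 = {p. p permutes {1..4}}" by (auto simp: sym_group_carrier)
  then show "card (carrier S4) = 24" "finite (carrier S4)"
    using card_permutations[of "{1..4::nat}" 4] finite_permutations[of "{1..4::nat}"]
    by (simp_all add: fact_numeral)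
qed

lemma transpose_S4: "i \<in> {1..4} \<Longrightarrow> j \<in> {1..4} \<Longrightarrow> transpose i j \<in> carrier S4"
  unfolding sym_group_carrier by (rule permutes_swap_id)

lemma comp_S4: "p \<in> carrier S4 \<Longrightarrow> q \<in> carrier S4 \<Longrightarrow> p \<circ> q \<in> carrier S4"
  unfolding sym_group_carrier by (rule permutes_compose)

lemma S4_mult: "p \<otimes>\<^bsub>S4\<^esub> q = p \<circ> q"
  by (simp add: sym_group_mult)

text \<open>By Burnside's lemma, four times the left orbit number and 24 times the right one are
  sums of fixed point numbers over \<open>V\<close> and over the whole group, and the first sum is
  part of the second.\<close>

lemma four_orbits:
  assumes act: "group_action S4 E act" and fin: "finite E"
    and V: "V = {id, v1, v2, v3}" and sub: "subgroup V S4"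
  shows "card (orbits (S4\<lparr>carrier := V\<rparr>) E act) \<le> 6 * card (orbits S4 E act)"
proof -
  interpret group_action S4 E act by fact
  have ne: "v1 1 = (2::nat)" "v2 1 = (3::nat)" "v3 1 = (4::nat)" by (simp_all add: transpose_def)
  have "card V = 4"
  proof -
    have "(\<lambda>p. p 1) ` V = {1, 2, 3, 4}" using ne by (auto simp: V)
    then have "card V \<ge> 4" using card_image_le[of V "\<lambda>p. p 1"] by (simp add: V)
    moreover have "card V \<le> 4" unfolding V by (intro card_insert_le_m1) auto
    ultimately show ?thesis by simp
  qed
  have "V \<subseteq> carrier S4" using sub by (rule subgroup.subset)
  then have "(\<Sum>g\<in>V. fixed_points E act g) \<le> (\<Sum>g\<in>carrier S4. fixed_points E act g)"
    using card_S4 by (intro sum_mono2) auto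
  moreover have "card (orbits S4 E act) * 24 = (\<Sum>g\<in>carrier S4. fixed_points E act g)"
    using burnside card_S4 fin by (simp add: order_def fixed_points_def)
  moreover have "card (orbits (S4\<lparr>carrier := V\<rparr>) E act) * 4 = (\<Sum>g\<in>V. fixed_points E act g)"
    using card_orbits_subgroup[OF fin sub] \<open>card V = 4\<close> by (simp add: V)
  ultimately show ?thesis by linarith
qed

text \<open>
  By Burnside's lemma the claim follows from \<open>2 f(12) + f((12)(34)) \<le> n + (3- and 4-cycle terms)\<close>.
  This holds by inclusion-exclusion for the fixed point sets of \<open>(12)\<close>, \<open>(13)\<close> and
  \<open>(14)(23)\<close>, because the pairwise products of these are a 3-cycle and two 4-cycles.
\<close>

lemma orbits_inequality:
  assumes act: "group_action S4 E act" and fin: "finite E"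
    and W: "W = {id, transpose 1 2, transpose 3 4, v1}" and sub: "subgroup W S4"
  shows "10 * card (orbits (S4\<lparr>carrier := W\<rparr>) E act) \<le> 12 * card (orbits S4 E act) + 3 * card E"
proof -
  interpret group_action S4 E act by fact
  define f where "f = fixed_points E act"
  let ?t = "\<lambda>i j. transpose (i::nat) j"
  have conj: "f g \<le> f k" if "g \<in> carrier S4" "h \<in> carrier S4" "k \<in> carrier S4" "h \<circ> g = k \<circ> h" for g h k
    unfolding f_def using that fixed_points_conj[OF fin] by (simp add: S4_mult)
  have t: "f (?t 1 2) \<le> f (?t 1 3)" "f (?t 1 2) \<le> f (?t 1 4)" "f (?t 1 2) \<le> f (?t 2 3)"
    "f (?t 1 2) \<le> f (?t 2 4)" "f (?t 1 2) \<le> f (?t 3 4)" "f (?t 3 4) \<le> f (?t 1 2)" "f v1 \<le> f v2" "f v1 \<le> f v3"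
    using conj[of "?t 1 2" "?t 2 3" "?t 1 3"] conj[of "?t 1 2" "?t 2 4" "?t 1 4"] conj[of "?t 1 2" "?t 1 3" "?t 2 3"]
      conj[of "?t 1 2" "?t 1 4" "?t 2 4"] conj[of "?t 1 2" v2 "?t 3 4"] conj[of "?t 3 4" v2 "?t 1 2"]
      conj[of v1 "?t 2 3" v2] conj[of v1 "?t 2 4" v3]
    by (simp_all add: transpose_S4 comp_S4) (auto simp: fun_eq_iff transpose_def)
  \<comment> \<open>A 3-cycle and two 4-cycles, each with its inverse: the pairwise products of (1
    2), (1 3) and (1 4)(2 3).\<close>
  let ?c = "?t 1 2 \<circ> ?t 1 3" and ?c' = "?t 1 3 \<circ> ?t 1 2"
    and ?d = "?t 1 2 \<circ> v3" and ?d' = "v3 \<circ> ?t 1 2" and ?e = "?t 1 3 \<circ> v3" and ?e' = "v3 \<circ> ?t 1 3"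
  have "f (?t i j \<circ> q) \<le> f (q \<circ> ?t i j)" if "i \<in> {1..4}" "j \<in> {1..4}" "q \<in> carrier S4" for i j q
    by (rule conj[where h = "?t i j"]) (use that in \<open>auto intro!: comp_S4 transpose_S4 simp: fun_eq_iff\<close>)
  from this[of 1 2 "?t 1 3"] this[of 1 2 v3] this[of 1 3 v3]
  have cyc: "f ?c \<le> f ?c'" "f ?d \<le> f ?d'" "f ?e \<le> f ?e'"
    by (simp_all add: transpose_S4 comp_S4)
  \<comment> \<open>Sixteen of the 24 elements: the identity, all transpositions and double
    transpositions, two 3-cycles and four 4-cycles. The others contribute nonnegative terms, which
    are dropped.\<close>
  let ?L = "[id, ?t 1 2, ?t 1 3, ?t 1 4, ?t 2 3, ?t 2 4, ?t 3 4, v1, v2, v3, ?c, ?c', ?d, ?d', ?e, ?e']"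
  \<comment> \<open>Permutations are told apart by their four values, which turns distinctness into
    a computation with numbers.\<close>
  have "distinct (map (\<lambda>p. (p 1, p 2, p 3, p 4)) ?L)" by (simp add: transpose_def)
  then have "distinct ?L" by (simp only: distinct_map)
  then have "sum_list (map f ?L) = sum f (set ?L)" by (rule sum_list_distinct_conv_sum_set)
  also have "\<dots> \<le> sum f (carrier S4)"
  proof (rule sum_mono2)
    have "id \<in> carrier S4" by (simp add: sym_group_carrier permutes_id)
    then show "set ?L \<subseteq> carrier S4"
      using transpose_S4 comp_S4 by simp
  qed (use card_S4 in auto)
  also have "sum f (carrier S4) = card (orbits S4 E act) * 24"
    using burnside card_S4 fin by (simp add: order_def fixed_points_def f_def)
  finally have H: "sum_list (map f ?L) \<le> card (orbits S4 E act) * 24" .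
  have fid: "f id = card E" using fixed_points_one by (simp add: f_def sym_group_one)
  have "distinct (map (\<lambda>p. (p 1, p 2, p 3, p 4)) [id, ?t 1 2, ?t 3 4, v1])" by (simp add: transpose_def)
  then have dW: "distinct [id, ?t 1 2, ?t 3 4, v1]" by (simp only: distinct_map)
  have "card W = 4" using distinct_card[OF dW] by (simp add: W)
  have "sum f W = sum_list (map f [id, ?t 1 2, ?t 3 4, v1])"
    using sum_list_distinct_conv_sum_set[OF dW, of f] by (simp add: W)
  then have W': "card (orbits (S4\<lparr>carrier := W\<rparr>) E act) * 4 = f id + f (?t 1 2) + f (?t 3 4) + f v1"
    using card_orbits_subgroup[OF fin sub] \<open>card W = 4\<close> by (simp add: W f_def)
  let ?A = "invariants E act (?t 1 2)" and ?B = "invariants E act (?t 1 3)" and ?C = "invariants E act v3"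
  have finI: "finite (invariants E act g)" for g using fin by (simp add: invariants_def)
  have "card (?A \<union> ?B \<union> ?C) \<le> card E" using fin by (intro card_mono) (auto simp: invariants_def)
  moreover have "card ?A + card ?B = card (?A \<union> ?B) + card (?A \<inter> ?B)"
    "card (?A \<union> ?B) + card ?C = card (?A \<union> ?B \<union> ?C) + card ((?A \<union> ?B) \<inter> ?C)"
    by (rule card_Un_Int; simp add: finI)+
  moreover have "card ((?A \<union> ?B) \<inter> ?C) \<le> card (?A \<inter> ?C) + card (?B \<inter> ?C)"
    unfolding Int_Un_distrib2 by (rule card_Un_le)
  moreover have le: "card (invariants E act g \<inter> invariants E act h) \<le> f (g \<circ> h)" if "g \<in> carrier S4" "h \<in> carrier S4" for g h
    unfolding f_def fixed_points_def using that invariants_Int[of g h] by (intro card_mono finI) (simp add: S4_mult)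
  have "card (?A \<inter> ?B) \<le> f ?c" "card (?A \<inter> ?C) \<le> f ?d" "card (?B \<inter> ?C) \<le> f ?e"
    by (rule le; intro comp_S4 transpose_S4; simp)+
  ultimately have incl_excl: "f (?t 1 2) + f (?t 1 3) + f v3 \<le> card E + f ?c + f ?d + f ?e"
    unfolding f_def fixed_points_def by linarith
  have collect: "N + a + b + 2 * (x + y + z) \<le> K"
    if "N + T + D + X + Y + Z \<le> K" "a \<le> T" "b \<le> D" "2 * x \<le> X" "2 * y \<le> Y" "2 * z \<le> Z"
    for N a b x y z K T D X Y Z :: nat
    using that by presburger
  have "f id + (f (?t 1 2) + f (?t 1 3) + f (?t 1 4) + f (?t 2 3) + f (?t 2 4) + f (?t 3 4)) + (f v1 + f v2 + f v3)
      + (f ?c + f ?c') + (f ?d + f ?d') + (f ?e + f ?e') \<le> card (orbits S4 E act) * 24"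
    using H by (simp only: list.map sum_list.Cons sum_list.Nil add_0_right add.assoc)
  moreover have "6 * f (?t 1 2) \<le> f (?t 1 2) + f (?t 1 3) + f (?t 1 4) + f (?t 2 3) + f (?t 2 4) + f (?t 3 4)"
    "3 * f v1 \<le> f v1 + f v2 + f v3"
    using t by linarith+
  moreover have "2 * f ?c \<le> f ?c + f ?c'" "2 * f ?d \<le> f ?d + f ?d'" "2 * f ?e \<le> f ?e + f ?e'"
    unfolding mult_2 by (rule add_left_mono[OF cyc(1)] add_left_mono[OF cyc(2)] add_left_mono[OF cyc(3)])+
  ultimately have sum_H: "card E + 6 * f (?t 1 2) + 3 * f v1 + 2 * (f ?c + f ?d + f ?e) \<le> card (orbits S4 E act) * 24"
    unfolding fid by (rule collect)
  have sum_W: "card (orbits (S4\<lparr>carrier := W\<rparr>) E act) * 4 \<le> card E + 2 * f (?t 1 2) + f v1"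
    using W' t(6) fid by linarith
  have sum_F: "2 * f (?t 1 2) + f v1 \<le> card E + (f ?c + f ?d + f ?e)"
    using incl_excl t(1,8) by linarith
  \<comment> \<open>One half of the first inequality, five halves of the second and the third
    inequality itself add up to this.\<close>
  have "10 * r \<le> 12 * k + 3 * N" if "N + 6 * b + 3 * v + 2 * s \<le> k * 24" "r * 4 \<le> N + 2 * b + v"
      "2 * b + v \<le> N + s" for N b v s k r :: nat
    using that by simp
  from this[OF sum_H sum_W sum_F] show ?thesis .
qed

section \<open>Asymptotics\<close>

text \<open>The quotient of \<open>real n ^ n\<close> by \<open>fact n\<close> is a single term of
  the exponential series at n. This weak form of Stirling's formula suffices, as exponential factors
  do not affect the growth coefficient.\<close>

lemma power_le_fact_exp: "real n ^ n \<le> fact n * exp (real n)"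
proof (cases "n = 0")
  case False
  obtain s where "\<bar>s\<bar> \<le> \<bar>real n\<bar>" "exp (real n) = (\<Sum>m<Suc n. real n ^ m / fact m) + exp s / fact (Suc n) * real n ^ Suc n"
    using Maclaurin_exp_le[of "real n" "Suc n"] by blast
  then have "real n ^ n / fact n \<le> exp (real n)"
    using sum_nonneg[of "{..<n}" "\<lambda>m. real n ^ m / fact m"] by simp
  then show ?thesis by (simp add: field_simps)
qed simp

lemma ln_fact_ge: "n > 0 \<Longrightarrow> real n * ln (real n) - real n \<le> ln (fact n)"
proof -
  assume n: "n > 0"
  have "ln (real n ^ n) \<le> ln (fact n * exp (real n))"
    using n power_le_fact_exp[of n] by (subst ln_le_cancel_iff) auto
  then show ?thesis using n by (simp add: ln_mult ln_realpow)
qed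

text \<open>Up to exponential factors \<open>fact (n - 1)\<close> is n to the power n, so dividing
  by it lowers the exponent from (1 + c) n to c n. The logarithm of \<open>C ^ n\<close> is of
  smaller order than n log n.\<close>

lemma growth_coefficient_le:
  fixes C :: real
  assumes "C \<ge> 1"
    and bound: "\<And>n. n \<ge> 1 \<Longrightarrow> real (subgroup_count G n) * fact (n - 1) \<le> C ^ n * real n powr ((1 + c) * real n)"
  shows "growth_coefficient G \<le> ereal c"
proof -
  let ?s = "\<lambda>n. if subgroup_count G n = 0 then - \<infinity> else ereal (ln (real (subgroup_count G n)) / (real n * ln (real n)))"
  let ?r = "\<lambda>n. c + (ln C + 1) / ln (real n) + 1 / real n"
  have "?s n \<le> ereal (?r n)" if n: "n \<ge> 2" for n
  proof (cases "subgroup_count G n = 0")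
    case False
    have pos: "ln (real n) > 0" using n by simp
    have "fact n = real n * fact (n - 1)" using n by (simp add: fact_reduce)
    then have "real (subgroup_count G n) * fact n = real n * (real (subgroup_count G n) * fact (n - 1))" by simp
    also have "\<dots> \<le> real n * (C ^ n * real n powr ((1 + c) * real n))"
      using n bound[of n] by (intro mult_left_mono) auto
    finally have "ln (real (subgroup_count G n) * fact n) \<le> ln (real n * (C ^ n * real n powr ((1 + c) * real n)))"
      using False assms(1) n by (subst ln_le_cancel_iff) auto
    then have "ln (real (subgroup_count G n)) + ln (fact n) \<le> ln (real n) + (real n * ln C + (1 + c) * real n * ln (real n))"
      using False assms(1) n by (simp add: ln_mult ln_realpow ln_powr)
    then have "ln (real (subgroup_count G n)) \<le> ln (real n) + real n * ln C + c * (real n * ln (real n)) + real n"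
      using ln_fact_ge[of n] n by (simp add: algebra_simps)
    then have "ln (real (subgroup_count G n)) / (real n * ln (real n))
        \<le> (ln (real n) + real n * ln C + c * (real n * ln (real n)) + real n) / (real n * ln (real n))"
      using pos n by (intro divide_right_mono) auto
    also have "\<dots> = ?r n" using pos n by (simp add: field_simps)
    finally show ?thesis using False by simp
  qed simp
  then have "eventually (\<lambda>n. ?s n \<le> ereal (?r n)) sequentially"
    by (rule eventually_sequentiallyI)
  then have "limsup ?s \<le> limsup (\<lambda>n. ereal (?r n))" by (rule Limsup_mono)
  also have "\<dots> = ereal c"
  proof (rule lim_imp_Limsup)
    have "?r \<longlonglongrightarrow> c" by real_asymp
    then show "(\<lambda>n. ereal (?r n)) \<longlonglongrightarrow> ereal c" by simp
  qed simp
  finally show ?thesis unfolding growth_coefficient_def .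
qed

text \<open>A limit superior is bounded below along the subsequence of multiples of m, where the
  logarithm of the bound is about r k log k and the denominator about m k log k.\<close>

lemma growth_coefficient_ge:
  fixes r m :: nat
  assumes m: "m > 0" and bound: "\<And>k. k \<ge> 2 \<Longrightarrow> fact k ^ r \<le> subgroup_count G (m * k)"
  shows "ereal (real r / real m) \<le> growth_coefficient G"
proof -
  let ?s = "\<lambda>n. if subgroup_count G n = 0 then - \<infinity> else ereal (ln (real (subgroup_count G n)) / (real n * ln (real n)))"
  let ?r = "\<lambda>k. real r * (ln (real k) - 1) / (real m * (ln (real m) + ln (real k)))"
  have "ereal (?r k) \<le> ?s (m * k)" if k: "k \<ge> 2" for k
  proof -
    have pos: "ln (real k) > 0" "ln (real m) \<ge> 0" using k m by auto
    have b: "fact k ^ r \<le> real (subgroup_count G (m * k))"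
      using bound[OF k] by (metis of_nat_fact of_nat_le_iff of_nat_power)
    have s: "subgroup_count G (m * k) > 0" using bound[OF k] by (metis fact_gt_zero not_gr_zero not_le zero_less_power)
    have "real r * (real k * ln (real k) - real k) \<le> real r * ln (fact k)"
      using ln_fact_ge[of k] k by (intro mult_left_mono) auto
    also have "\<dots> = ln (fact k ^ r)" by (simp add: ln_realpow)
    also have "\<dots> \<le> ln (real (subgroup_count G (m * k)))"
      using b s by (subst ln_le_cancel_iff) auto
    finally have "real r * (real k * ln (real k) - real k) / (real (m * k) * ln (real (m * k)))
        \<le> ln (real (subgroup_count G (m * k))) / (real (m * k) * ln (real (m * k)))"
      using pos k m by (intro divide_right_mono) (auto simp: ln_mult)
    moreover have "real r * (real k * ln (real k) - real k) / (real (m * k) * ln (real (m * k))) = ?r k"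
    proof -
      have "real r * (real k * ln (real k) - real k) = real k * (real r * (ln (real k) - 1))"
        "real (m * k) * ln (real (m * k)) = real k * (real m * (ln (real m) + ln (real k)))"
        using k m by (simp_all add: ln_mult algebra_simps)
      then show ?thesis using k by (simp only: mult_divide_mult_cancel_left_if) simp
    qed
    ultimately show ?thesis using s by simp
  qed
  then have "eventually (\<lambda>k. ereal (?r k) \<le> (?s \<circ> (\<lambda>k. m * k)) k) sequentially"
    unfolding comp_def by (rule eventually_sequentiallyI)
  then have "limsup (\<lambda>k. ereal (?r k)) \<le> limsup (?s \<circ> (\<lambda>k. m * k))" by (rule Limsup_mono)
  also have "\<dots> \<le> limsup ?s"
    using m by (intro limsup_subseq_mono) (simp add: strict_mono_def)
  also have "limsup (\<lambda>k. ereal (?r k)) = ereal (real r / real m)"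
  proof (rule lim_imp_Limsup)
    have "?r \<longlonglongrightarrow> real r / real m" using m by real_asymp (simp add: divide_inverse)
    then show "(\<lambda>k. ereal (?r k)) \<longlonglongrightarrow> ereal (real r / real m)" by simp
  qed simp
  finally show ?thesis unfolding growth_coefficient_def .
qed

section \<open>Counting actions and subgroups\<close>

text \<open>Extensionality outside the carrier makes equality of two actions a matter of the carrier
  alone, so that counting them is meaningful.\<close>

definition actions :: "('a, 'm) monoid_scheme \<Rightarrow> nat \<Rightarrow> ('a \<Rightarrow> nat \<Rightarrow> nat) set" where
  "actions G n = {\<Phi> \<in> extensional (carrier G). group_action G {..<n} \<Phi>}"

text \<open>
  A subgroup of index \<open>n\<close> together with a numbering of its other cosets is the stabilizer
  of \<open>0\<close> in a unique transitive action on \<open>{..<n}\<close>.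
\<close>

lemma (in group) subgroup_count_le_actions:
  assumes n: "n \<ge> 1" and fin: "finite (actions G n)"
  shows "finite {S. subgroup S G \<and> card (rcosets S) = n}"
    and "subgroup_count G n * fact (n - 1) \<le> card (actions G n)"
proof -
  define N where "N = {S. subgroup S G \<and> card (rcosets S) = n}"
  \<comment> \<open>Renumberings that keep 0 fixed, because 0 is reserved for the coset
    \<open>S\<close> itself; there are \<open>fact (n - 1)\<close> of them.\<close>
  define P where "P = {\<pi>. \<pi> permutes {1..<n}}"
  define b where "b S = (SOME b. bij_betw b (rcosets S) {..<n} \<and> b S = 0)" for S
  have b: "bij_betw (b S) (rcosets S) {..<n}" "b S S = 0" if S: "S \<in> N" for S
  proof -
    have "card (rcosets S) = n" "subgroup S G" using S by (auto simp: N_def)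
    then have SS: "S \<in> rcosets S" "finite (rcosets S)"
      using n subgroup.subgroup_in_rcosets[OF _ is_group] by (auto intro: card_ge_0_finite)
    then obtain h where h: "bij_betw h (rcosets S) {..<n}"
      using ex_bij_betw_finite_nat[of "rcosets S"] \<open>card (rcosets S) = n\<close> by (auto simp: atLeast0LessThan)
    have "h S \<in> {..<n}" using h SS by (auto dest: bij_betwE)
    then have "bij_betw (transpose (h S) 0) {..<n} {..<n}"
      using n by (intro permutes_imp_bij permutes_swap_id) auto
    then have "bij_betw (transpose (h S) 0 \<circ> h) (rcosets S) {..<n}" by (rule bij_betw_trans[OF h])
    moreover have "(transpose (h S) 0 \<circ> h) S = 0" by simp
    ultimately have "\<exists>b. bij_betw b (rcosets S) {..<n} \<and> b S = 0" by blast
    then have "bij_betw (b S) (rcosets S) {..<n} \<and> b S S = 0" unfolding b_def by (rule someI_ex)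
    then show "bij_betw (b S) (rcosets S) {..<n}" "b S S = 0" by auto
  qed
  define c where "c S \<pi> = \<pi> \<circ> b S" for S and \<pi> :: "nat \<Rightarrow> nat"
  have c: "bij_betw (c S \<pi>) (rcosets S) {..<n}" "c S \<pi> S = 0" if "S \<in> N" "\<pi> \<in> P" for S \<pi>
  proof -
    have "\<pi> permutes {..<n}" "\<pi> 0 = 0"
      using that by (auto simp: P_def intro: permutes_subset dest: permutes_not_in[of \<pi> _ 0])
    then show "bij_betw (c S \<pi>) (rcosets S) {..<n}" "c S \<pi> S = 0"
      using b[OF that(1)] by (auto simp: c_def intro: bij_betw_trans permutes_imp_bij)
  qed
  define \<Phi> where "\<Phi> = (\<lambda>(S, \<pi>). restrict (\<lambda>g. restrict (\<lambda>i. c S \<pi> (inv_into (rcosets S) (c S \<pi>) i #> inv g)) {..<n}) (carrier G))"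
  have \<Phi>_0: "\<Phi> (S, \<pi>) g 0 = c S \<pi> (S #> inv g)" if "S \<in> N" "\<pi> \<in> P" "g \<in> carrier G" for S \<pi> g
  proof -
    have "S \<in> rcosets S" using that subgroup.subgroup_in_rcosets[OF _ is_group] by (auto simp: N_def)
    then have "inv_into (rcosets S) (c S \<pi>) 0 = S"
      using c[OF that(1,2)] by (metis bij_betw_inv_into_left)
    then show ?thesis using that n by (simp add: \<Phi>_def)
  qed
  have sub: "\<Phi> ` (N \<times> P) \<subseteq> actions G n"
  proof
    fix \<Psi> assume "\<Psi> \<in> \<Phi> ` (N \<times> P)"
    then obtain S \<pi> where S: "S \<in> N" "\<pi> \<in> P" "\<Psi> = \<Phi> (S, \<pi>)" by auto
    let ?M = "rcosets S" and ?c = "c S \<pi>"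
    have sub: "subgroup S G" using S by (auto simp: N_def)
    interpret M: group_action G ?M "\<lambda>g. restrict (\<lambda>R. R #> inv g) ?M" by (rule coset_action[OF sub])
    let ?d = "inv_into ?M ?c"
    have d: "?d i \<in> ?M" "?c (?d i) = i" if "i < n" for i
      using bij_betwE[OF bij_betw_inv_into[OF c(1)[OF S(1,2)]]] bij_betw_inv_into_right[OF c(1)[OF S(1,2)]] that by auto
    have d': "?c R < n" "?d (?c R) = R" if "R \<in> ?M" for R
      using bij_betwE[OF c(1)[OF S(1,2)]] bij_betw_inv_into_left[OF c(1)[OF S(1,2)]] that by auto
    have "group_action G {..<n} (\<lambda>g. restrict (\<lambda>i. ?c (?d i #> inv g)) {..<n})"
    proof (rule group_actionI[OF is_group])
      fix g i assume "g \<in> carrier G" "i \<in> {..<n}"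
      then show "?c (?d i #> inv g) \<in> {..<n}" using M.act_closed[of g "?d i"] d[of i] d' by simp
    next
      fix i assume "i \<in> {..<n}"
      then show "?c (?d i #> inv \<one>) = i" using M.act_one[of "?d i"] d[of i] by simp
    next
      fix g h i assume "g \<in> carrier G" "h \<in> carrier G" "i \<in> {..<n}"
      then show "?c (?d i #> inv (g \<otimes> h)) = ?c (?d (?c (?d i #> inv h)) #> inv g)"
        using M.composition_rule[of "?d i" g h] M.act_closed[of h "?d i"] d[of i] d'(2) by simp
    qed
    then have "(\<lambda>g. restrict (\<lambda>i. ?c (?d i #> inv g)) {..<n}) \<in> hom G (BijGroup {..<n})"
      by (simp add: group_action_def group_hom_def group_hom_axioms_def)
    then have "\<Psi> \<in> hom G (BijGroup {..<n})"
      by (rule hom_restrict) (simp add: S \<Phi>_def)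
    then show "\<Psi> \<in> actions G n"
      by (simp add: actions_def group_action_def group_hom_def group_hom_axioms_def group_BijGroup is_group S \<Phi>_def)
  qed
  have inj: "inj_on \<Phi> (N \<times> P)"
  proof (rule inj_onI)
    fix x y assume "x \<in> N \<times> P" "y \<in> N \<times> P" and eq: "\<Phi> x = \<Phi> y"
    then obtain S \<pi> S' \<pi>' where x: "x = (S, \<pi>)" "S \<in> N" "\<pi> \<in> P" and y: "y = (S', \<pi>')" "S' \<in> N" "\<pi>' \<in> P"
      by blast
    \<comment> \<open>The subgroup is recovered as the stabilizer of 0, and afterwards the numbering
      from the images of 0.\<close>
    have stab: "T = {g \<in> carrier G. \<Phi> (T, \<rho>) g 0 = 0}" if T: "T \<in> N" "\<rho> \<in> P" for T \<rho>
    proof -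
      have sub: "subgroup T G" using T by (auto simp: N_def)
      have TT: "T \<in> rcosets T" using sub by (rule subgroup.subgroup_in_rcosets[OF _ is_group])
      have "c T \<rho> (T #> inv g) = 0 \<longleftrightarrow> T #> inv g = T" if "g \<in> carrier G" for g
        using that c[OF T] TT rcosetsI[OF subgroup.subset[OF sub], of "inv g"]
        by (metis bij_betw_inv_into_left inv_closed)
      then have "{g \<in> carrier G. \<Phi> (T, \<rho>) g 0 = 0} = {g \<in> carrier G. T #> inv g = T}"
        using \<Phi>_0[OF T] c(2)[OF T] by auto
      also have "\<dots> = stabilizer G (\<lambda>g. restrict (\<lambda>R. R #> inv g) (rcosets T)) T"
        using TT by (auto simp: stabilizer_def)
      finally show ?thesis using coset_action(2)[OF sub] by simp
    qed
    have SS': "S = S'" using stab[OF x(2,3)] stab[OF y(2,3)] eq x y by simp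
    have "\<pi> i = \<pi>' i" for i
    proof (cases "i < n")
      case True
      then have "i \<in> b S ` (rcosets S)" using b(1)[OF x(2)] by (simp add: bij_betw_def)
      then obtain R where R: "R \<in> rcosets S" "b S R = i" by blast
      then obtain g where g: "g \<in> carrier G" "R = S #> g" by (auto simp: RCOSETS_def)
      have "c S \<pi> R = c S \<pi>' R"
        using \<Phi>_0[OF x(2,3) inv_closed[OF g(1)]] \<Phi>_0[OF y(2,3) inv_closed[OF g(1)]] eq x y g SS' by simp
      then show ?thesis using R by (simp add: c_def)
    next
      case False
      then have "i \<notin> {1..<n}" by simp
      then show ?thesis using x(3) y(3) by (simp add: P_def permutes_not_in)
    qed
    then show "x = y" using x y SS' by auto
  qed
  have le: "finite (N \<times> P)" "card (N \<times> P) \<le> card (actions G n)"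
    by (rule inj_on_finite[OF inj sub fin], rule card_inj_on_le[OF inj sub fin])
  have "id \<in> P" by (simp add: P_def permutes_id)
  then have "finite N" using le(1) by (auto simp: finite_cartesian_product_iff)
  then show "finite {S. subgroup S G \<and> card (rcosets S) = n}" by (simp add: N_def)
  have "card P = fact (n - 1)" unfolding P_def by (rule card_permutations) auto
  then show "subgroup_count G n * fact (n - 1) \<le> card (actions G n)"
    using le(2) by (simp add: card_cartesian_product subgroup_count_def N_def)
qed

subsection \<open>Encoding an action by the roots of its orbits\<close>

definition orbit_root :: "('a, 'm) monoid_scheme \<Rightarrow> ('a \<Rightarrow> nat \<Rightarrow> nat) \<Rightarrow> nat \<Rightarrow> nat" where
  "orbit_root G act x = Min (orbit G act x)"

text \<open>A coset of the stabilizer of the root. Taking the whole set avoids choosing an element;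
  there are at most \<open>2 ^ card (carrier G)\<close> values per point, which is an exponential
  factor in total.\<close>

definition labels :: "('a, 'm) monoid_scheme \<Rightarrow> ('a \<Rightarrow> nat \<Rightarrow> nat) \<Rightarrow> nat \<Rightarrow> 'a set" where
  "labels G act x = {g \<in> carrier G. act g (orbit_root G act x) = x}"

lemma (in group_action) orbit_subset: "x \<in> E \<Longrightarrow> orbit G \<phi> x \<subseteq> E"
  by (auto simp: orbit_def act_closed)

lemma (in group_action) orbit_eqI:
  assumes "x \<in> E" "y \<in> orbit G \<phi> x"
  shows "orbit G \<phi> y = orbit G \<phi> x"
proof -
  have y: "y \<in> E" using assms orbit_subset by blast
  have "orbit G \<phi> x \<in> orbits G E \<phi>" "orbit G \<phi> y \<in> orbits G E \<phi>" using assms y by (auto simp: orbits_def)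
  then show ?thesis using disjoint_union orbit_refl[OF y] assms(2) by blast
qed

lemma root_orbit:
  assumes "group_action G E act" "finite E" "x \<in> E"
  shows "orbit_root G act x \<in> orbit G act x" "orbit_root G act x \<in> E"
proof -
  interpret group_action G E act by fact
  have "finite (orbit G act x)" using orbit_subset assms finite_subset by blast
  then show "orbit_root G act x \<in> orbit G act x" unfolding orbit_root_def using orbit_refl[OF assms(3)] by (intro Min_in) auto
  then show "orbit_root G act x \<in> E" using orbit_subset assms(3) by blast
qed

lemma root_eqI:
  assumes "group_action G E act" "x \<in> E" "y \<in> orbit G act x"
  shows "orbit_root G act y = orbit_root G act x"
  unfolding orbit_root_def using group_action.orbit_eqI[OF assms] by simp

lemma card_roots:
  assumes "group_action G E act" "finite E"
  shows "card (orbit_root G act ` E) = card (orbits G E act)"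
proof -
  interpret group_action G E act by fact
  have "orbit_root G act ` E = Min ` orbits G E act" by (auto simp: orbit_root_def orbits_def)
  moreover have "inj_on Min (orbits G E act)"
  proof (rule inj_onI)
    fix O1 O2 assume "O1 \<in> orbits G E act" "O2 \<in> orbits G E act" "Min O1 = Min O2"
    then obtain x y where xy: "x \<in> E" "y \<in> E" "O1 = orbit G act x" "O2 = orbit G act y" "orbit_root G act x = orbit_root G act y"
      by (auto simp: orbits_def orbit_root_def)
    then show "O1 = O2"
      using orbit_eqI[OF xy(1) root_orbit(1)[OF assms xy(1)]] orbit_eqI[OF xy(2) root_orbit(1)[OF assms xy(2)]] by simp
  qed
  ultimately show ?thesis by (simp add: card_image)
qed

lemma orbit_root_fixed:
  assumes "group_action G E act" "finite E" "x \<in> orbit_root G act ` E"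
  shows "orbit_root G act x = x"
  using assms(3) root_orbit[OF assms(1,2)] root_eqI[OF assms(1)] by auto

text \<open>The minimum of an orbit is also the minimum of the smaller orbit that contains it.
  Choosing minima as roots is what makes the root sets nested.\<close>

lemma orbit_roots_mono:
  assumes a: "group_action G E act" and a': "group_action G' E act'" and fin: "finite E"
    and sub: "\<And>x. orbit G' act' x \<subseteq> orbit G act x"
  shows "orbit_root G act ` E \<subseteq> orbit_root G' act' ` E"
proof
  fix y assume root: "y \<in> orbit_root G act ` E"
  then obtain x where "x \<in> E" "y = orbit_root G act x" by blast
  then have y: "y \<in> E" "orbit_root G act y = y"
    using root_orbit(2)[OF a fin] orbit_root_fixed[OF a fin root] by simp_all
  have "finite (orbit G act y)"
    using group_action.orbit_subset[OF a y(1)] fin finite_subset by blast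
  moreover have "orbit_root G' act' y \<in> orbit G act y" "y \<in> orbit G' act' y"
    using root_orbit(1)[OF a' fin y(1)] sub group_action.orbit_refl[OF a' y(1)] by blast+
  ultimately have "y \<le> orbit_root G' act' y" "orbit_root G' act' y \<le> y"
    using y(2) sub[of y] unfolding orbit_root_def by (metis Min_le, metis Min_le finite_subset)
  then have "y = orbit_root G' act' y" by simp
  then show "y \<in> orbit_root G' act' ` E" using y by blast
qed

text \<open>If \<open>k\<close> carries the root to \<open>x\<close>, then
  \<open>g \<otimes> k\<close> is a label of \<open>act g x\<close>; equal labels force the same
  statement for the other action.\<close>

lemma root_labels_determine:
  fixes G (structure)
  assumes a: "group_action G E act" and a': "group_action G E act'" and fin: "finite E"
    and root: "\<And>x. x \<in> E \<Longrightarrow> orbit_root G act x = orbit_root G act' x"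
    and labels: "\<And>x. x \<in> E \<Longrightarrow> labels G act x = labels G act' x"
    and g: "g \<in> carrier G" and x: "x \<in> E"
  shows "act g x = act' g x"
proof -
  interpret a: group_action G E act by fact
  interpret a': group_action G E act' by fact
  interpret group G by (rule a.is_group)
  define r where "r = orbit_root G act x"
  have r: "r \<in> orbit G act x" "r \<in> E" unfolding r_def by (rule root_orbit[OF a fin x])+
  have "x \<in> orbit G act r" by (rule a.orbit_sym[OF x r(2,1)])
  then obtain k where k: "k \<in> carrier G" "act k r = x" by (auto simp: orbit_def)
  then have "k \<in> labels G act x" by (simp add: labels_def r_def)
  then have "k \<in> labels G act' x" using labels[OF x] by simp
  then have k': "act' k r = x" using root[OF x] by (simp add: labels_def r_def)
  have gx: "act g x \<in> E" "act g x \<in> orbit G act x" using g x by (auto simp: a.act_closed orbit_def)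
  have eq: "act (g \<otimes> k) r = act g x" using a.composition_rule[OF r(2) g k(1)] k by simp
  have "orbit_root G act (act g x) = r" unfolding r_def by (rule root_eqI[OF a x gx(2)])
  then have "g \<otimes> k \<in> labels G act (act g x)" using eq g k by (simp add: labels_def)
  then have "g \<otimes> k \<in> labels G act' (act g x)" using labels[OF gx(1)] by simp
  then have "act' (g \<otimes> k) r = act g x"
    using root[OF gx(1)] \<open>orbit_root G act (act g x) = r\<close> by (simp add: labels_def)
  then show ?thesis using a'.composition_rule[OF r(2) g k(1)] k' by simp
qed

section \<open>Counting the actions of an amalgam on n points\<close>

context amalgam begin

lemma restrict_action:
  assumes "group_action \<Gamma> E \<Phi>"
  shows "group_action G E (\<lambda>g. \<Phi> (inl g))" "group_action H E (\<lambda>h. \<Phi> (inr h))"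
proof -
  have "\<Phi> \<in> hom \<Gamma> (BijGroup E)" using assms by (simp add: group_action_def group_hom_def group_hom_axioms_def)
  then have "\<Phi> \<circ> inl \<in> hom G (BijGroup E)" "\<Phi> \<circ> inr \<in> hom H (BijGroup E)"
    using hom_compose[OF inl_hom] hom_compose[OF inr_hom] by blast+
  then show "group_action G E (\<lambda>g. \<Phi> (inl g))" "group_action H E (\<lambda>h. \<Phi> (inr h))"
    by (simp_all add: group_action_def group_hom_def group_hom_axioms_def group_BijGroup G.is_group H.is_group comp_def)
qed

lemma action_eqI:
  assumes "\<Phi> \<in> actions \<Gamma> n" "\<Psi> \<in> actions \<Gamma> n"
    and l: "\<And>g i. g \<in> carrier G \<Longrightarrow> i < n \<Longrightarrow> \<Phi> (inl g) i = \<Psi> (inl g) i"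
    and r: "\<And>h i. h \<in> carrier H \<Longrightarrow> i < n \<Longrightarrow> \<Phi> (inr h) i = \<Psi> (inr h) i"
  shows "\<Phi> = \<Psi>"
proof (rule extensionalityI)
  interpret \<Gamma>: group \<Gamma> by (rule group_\<Gamma>)
  show "\<Phi> \<in> extensional (carrier \<Gamma>)" "\<Psi> \<in> extensional (carrier \<Gamma>)" using assms by (auto simp: actions_def)
  interpret \<Phi>: group_action \<Gamma> "{..<n}" \<Phi> using assms by (simp add: actions_def)
  interpret \<Psi>: group_action \<Gamma> "{..<n}" \<Psi> using assms by (simp add: actions_def)
  have cl: "inl g \<in> carrier \<Gamma>" if "g \<in> carrier G" for g using that inl_hom by (auto simp: hom_def)
  have cr: "inr g \<in> carrier \<Gamma>" if "g \<in> carrier H" for g using that inr_hom by (auto simp: hom_def)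
  fix x assume x: "x \<in> carrier \<Gamma>"
  then have "\<forall>i<n. \<Phi> x i = \<Psi> x i"
  proof (induction rule: \<Gamma>_induct)
    case one then show ?case using \<Phi>.act_one \<Psi>.act_one by simp
  next
    case (inl g x)
    show ?case
    proof (intro allI impI)
      fix i assume "i < n"
      then show "\<Phi> (inl g \<otimes>\<^bsub>\<Gamma>\<^esub> x) i = \<Psi> (inl g \<otimes>\<^bsub>\<Gamma>\<^esub> x) i"
        using inl cl[OF inl(1)] \<Psi>.act_closed[of x i] l[of g "\<Psi> x i"]
          \<Phi>.composition_rule[of i "inl g" x] \<Psi>.composition_rule[of i "inl g" x] by simp
    qed
  next
    case (inr g x)
    show ?case
    proof (intro allI impI)
      fix i assume "i < n"
      then show "\<Phi> (inr g \<otimes>\<^bsub>\<Gamma>\<^esub> x) i = \<Psi> (inr g \<otimes>\<^bsub>\<Gamma>\<^esub> x) i"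
        using inr cr[OF inr(1)] \<Psi>.act_closed[of x i] r[of g "\<Psi> x i"]
          \<Phi>.composition_rule[of i "inr g" x] \<Psi>.composition_rule[of i "inr g" x] by simp
    qed
  qed
  moreover have "\<Phi> x \<in> extensional {..<n}" "\<Psi> x \<in> extensional {..<n}"
    using \<Phi>.bij_prop0[OF x] \<Psi>.bij_prop0[OF x] by (auto simp: Bij_def)
  ultimately show "\<Phi> x = \<Psi> x" by (intro extensionalityI) auto
qed

text \<open>Let a, g, h be the numbers of orbits of \<open>A\<close>, \<open>G\<close> and
  \<open>H\<close>. The three sets of roots are chosen in at most 8^n ways. Then only points that
  are not \<open>A\<close>-roots need their \<open>A\<close>-root, and only \<open>A\<close>-roots
  that are not \<open>G\<close>-roots (or \<open>H\<close>-roots) need their \<open>G\<close>-root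
  (or \<open>H\<close>-root): n - a, a - g and a - h values in a set of size n. Labels cost an
  exponential factor.\<close>

lemma card_actions_le:
  assumes fin: "finite (carrier G)" "finite (carrier H)" and A: "subgroup A G" and n: "n \<ge> 1"
    and orbits: "\<And>\<Phi>. group_action \<Gamma> {..<n} \<Phi> \<Longrightarrow> 4 * card (orbits (G\<lparr>carrier := A\<rparr>) {..<n} (\<lambda>g. \<Phi> (inl g)))
      \<le> 4 * card (orbits G {..<n} (\<lambda>g. \<Phi> (inl g))) + 4 * card (orbits H {..<n} (\<lambda>h. \<Phi> (inr h))) + n"
  shows "finite (actions \<Gamma> n)"
    and "real (card (actions \<Gamma> n)) \<le> (8 * 2 ^ card (carrier G) * 2 ^ card (carrier H)) ^ n * real n powr (5 / 4 * real n)"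
proof -
  let ?E = "{..<n}"
  define G' where "G' = G\<lparr>carrier := A\<rparr>"
  define aG where "aG \<Phi> = (\<lambda>g. \<Phi> (inl g))" for \<Phi> :: "('a + 'b) list set \<Rightarrow> nat \<Rightarrow> nat"
  define aH where "aH \<Phi> = (\<lambda>h. \<Phi> (inr h))" for \<Phi> :: "('a + 'b) list set \<Rightarrow> nat \<Rightarrow> nat"
  have act: "group_action G ?E (aG \<Phi>)" "group_action H ?E (aH \<Phi>)" "group_action G' ?E (aG \<Phi>)" if "\<Phi> \<in> actions \<Gamma> n" for \<Phi>
  proof -
    show "group_action G ?E (aG \<Phi>)" "group_action H ?E (aH \<Phi>)"
      using that restrict_action by (auto simp: actions_def aG_def aH_def)
    then show "group_action G' ?E (aG \<Phi>)" unfolding G'_def using group_action.induced_action[OF _ A] by blast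
  qed
  \<comment> \<open>Actions are sorted by their root sets, so that within one class the domains of
    the encoding functions are constant.\<close>
  define R where "R \<Phi> = (orbit_root G' (aG \<Phi>) ` ?E, orbit_root G (aG \<Phi>) ` ?E, orbit_root H (aH \<Phi>) ` ?E)" for \<Phi>
  define F where "F Q = {\<Phi> \<in> actions \<Gamma> n. R \<Phi> = Q}" for Q
  have orbitA: "orbit G' (aG \<Phi>) x \<subseteq> orbit G (aG \<Phi>) x" "orbit G' (aG \<Phi>) x \<subseteq> orbit H (aH \<Phi>) x" for \<Phi> x
  proof -
    show "orbit G' (aG \<Phi>) x \<subseteq> orbit G (aG \<Phi>) x" using A_subset by (auto simp: orbit_def G'_def)
    show "orbit G' (aG \<Phi>) x \<subseteq> orbit H (aH \<Phi>) x"
      using \<phi>_closed by (fastforce simp: orbit_def G'_def aG_def aH_def inl_eq_inr)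
  qed
  have rootA: "orbit_root G' (aG \<Phi>) x \<in> ?E" "orbit_root G (aG \<Phi>) (orbit_root G' (aG \<Phi>) x) = orbit_root G (aG \<Phi>) x"
      "orbit_root H (aH \<Phi>) (orbit_root G' (aG \<Phi>) x) = orbit_root H (aH \<Phi>) x"
    if \<Phi>: "\<Phi> \<in> actions \<Gamma> n" and x: "x \<in> ?E" for \<Phi> x
  proof -
    note r = root_orbit[OF act(3)[OF \<Phi>] finite_lessThan x]
    show "orbit_root G' (aG \<Phi>) x \<in> ?E" by (rule r)
    show "orbit_root G (aG \<Phi>) (orbit_root G' (aG \<Phi>) x) = orbit_root G (aG \<Phi>) x"
      using r orbitA by (intro root_eqI[OF act(1)[OF \<Phi>] x]) blast
    show "orbit_root H (aH \<Phi>) (orbit_root G' (aG \<Phi>) x) = orbit_root H (aH \<Phi>) x"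
      using r orbitA by (intro root_eqI[OF act(2)[OF \<Phi>] x]) blast
  qed
  define C where "C = (\<lambda>(RA, RG, RH). (?E - RA \<rightarrow>\<^sub>E ?E) \<times> (RA - RG \<rightarrow>\<^sub>E ?E) \<times> (RA - RH \<rightarrow>\<^sub>E ?E)
    \<times> (?E \<rightarrow>\<^sub>E Pow (carrier G)) \<times> (?E \<rightarrow>\<^sub>E Pow (carrier H)))"
  define enc where "enc \<Phi> = (case R \<Phi> of (RA, RG, RH) \<Rightarrow>
    (restrict (orbit_root G' (aG \<Phi>)) (?E - RA), restrict (orbit_root G (aG \<Phi>)) (RA - RG), restrict (orbit_root H (aH \<Phi>)) (RA - RH),
     restrict (labels G (aG \<Phi>)) ?E, restrict (labels H (aH \<Phi>)) ?E))" for \<Phi>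
  have C_fin: "finite (C Q)" if "Q \<in> Pow ?E \<times> Pow ?E \<times> Pow ?E" for Q
    using that fin unfolding C_def
    by (auto intro!: finite_cartesian_product finite_PiE intro: finite_subset[of _ ?E])
  have R_mem: "R \<Phi> \<in> Pow ?E \<times> Pow ?E \<times> Pow ?E" if "\<Phi> \<in> actions \<Gamma> n" for \<Phi>
    using root_orbit(2)[OF act(1)[OF that]] root_orbit(2)[OF act(2)[OF that]] root_orbit(2)[OF act(3)[OF that]]
    by (auto simp: R_def)
  have enc_mem: "enc \<Phi> \<in> C Q" if "\<Phi> \<in> F Q" for \<Phi> Q
  proof -
    have \<Phi>: "\<Phi> \<in> actions \<Gamma> n" and Q: "Q = R \<Phi>" using that by (auto simp: F_def)
    have sub: "orbit_root G' (aG \<Phi>) ` ?E \<subseteq> ?E" using R_mem[OF \<Phi>] by (auto simp: R_def)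
    have PiE: "restrict f B \<in> B \<rightarrow>\<^sub>E ?E" if "B \<subseteq> ?E" "\<And>x. x \<in> ?E \<Longrightarrow> f x \<in> ?E" for f B
      using that by auto
    have "orbit_root G' (aG \<Phi>) x \<in> ?E" "orbit_root G (aG \<Phi>) x \<in> ?E" "orbit_root H (aH \<Phi>) x \<in> ?E" if "x \<in> ?E" for x
      using that root_orbit(2)[OF act(1)[OF \<Phi>]] root_orbit(2)[OF act(2)[OF \<Phi>]] root_orbit(2)[OF act(3)[OF \<Phi>]]
      by blast+
    then show ?thesis
      unfolding Q enc_def C_def R_def prod.case mem_Times_iff fst_conv snd_conv
      using sub by (intro conjI PiE) (auto simp: labels_def)
  qed
  then have enc_sub: "enc ` F Q \<subseteq> C Q" for Q by blast
  have enc_inj: "inj_on enc (F Q)" for Q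
  proof (rule inj_onI)
    fix \<Phi> \<Psi> assume "\<Phi> \<in> F Q" "\<Psi> \<in> F Q" and eq: "enc \<Phi> = enc \<Psi>"
    then have \<Phi>: "\<Phi> \<in> actions \<Gamma> n" and \<Psi>: "\<Psi> \<in> actions \<Gamma> n" and RR: "R \<Phi> = R \<Psi>" by (auto simp: F_def)
    obtain RA RG RH where Q: "R \<Phi> = (RA, RG, RH)" by (cases "R \<Phi>") auto
    have RA: "RA = orbit_root G' (aG \<Phi>) ` ?E" "RA = orbit_root G' (aG \<Psi>) ` ?E"
      and RG: "RG = orbit_root G (aG \<Phi>) ` ?E" "RG = orbit_root G (aG \<Psi>) ` ?E"
      and RH: "RH = orbit_root H (aH \<Phi>) ` ?E" "RH = orbit_root H (aH \<Psi>) ` ?E"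
      using Q RR by (auto simp: R_def)
    have e: "restrict (orbit_root G' (aG \<Phi>)) (?E - RA) = restrict (orbit_root G' (aG \<Psi>)) (?E - RA)"
      "restrict (orbit_root G (aG \<Phi>)) (RA - RG) = restrict (orbit_root G (aG \<Psi>)) (RA - RG)"
      "restrict (orbit_root H (aH \<Phi>)) (RA - RH) = restrict (orbit_root H (aH \<Psi>)) (RA - RH)"
      "restrict (labels G (aG \<Phi>)) ?E = restrict (labels G (aG \<Psi>)) ?E"
      "restrict (labels H (aH \<Phi>)) ?E = restrict (labels H (aH \<Psi>)) ?E"
      using eq unfolding enc_def Q RR[symmetric, unfolded Q] by simp_all
    have *: "f y = g y" if "restrict f B = restrict g B" "y \<in> B" for f g :: "nat \<Rightarrow> 'z" and B y
      using that by (metis restrict_apply')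
    have rA: "orbit_root G' (aG \<Phi>) x = orbit_root G' (aG \<Psi>) x" if x: "x \<in> ?E" for x
    proof (cases "x \<in> RA")
      case True
      then show ?thesis using orbit_root_fixed[OF act(3)[OF \<Phi>] finite_lessThan] orbit_root_fixed[OF act(3)[OF \<Psi>] finite_lessThan] RA by metis
    next
      case False then show ?thesis using *[OF e(1)] x by blast
    qed
    \<comment> \<open>A point and its \<open>A\<close>-root lie in the same \<open>G\<close>-orbit,
      so the values at \<open>A\<close>-roots suffice.\<close>
    have rG: "orbit_root G (aG \<Phi>) x = orbit_root G (aG \<Psi>) x" if x: "x \<in> ?E" for x
    proof -
      define y where "y = orbit_root G' (aG \<Phi>) x"
      have y: "y \<in> RA" using x RA by (auto simp: y_def)
      have "orbit_root G (aG \<Phi>) y = orbit_root G (aG \<Psi>) y"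
      proof (cases "y \<in> RG")
        case True
        then show ?thesis using orbit_root_fixed[OF act(1)[OF \<Phi>] finite_lessThan] orbit_root_fixed[OF act(1)[OF \<Psi>] finite_lessThan] RG by metis
      next
        case False then show ?thesis using *[OF e(2)] y by blast
      qed
      then show ?thesis using rootA(2)[OF \<Phi> x] rootA(2)[OF \<Psi> x] rA[OF x] by (simp add: y_def)
    qed
    have rH: "orbit_root H (aH \<Phi>) x = orbit_root H (aH \<Psi>) x" if x: "x \<in> ?E" for x
    proof -
      define y where "y = orbit_root G' (aG \<Phi>) x"
      have y: "y \<in> RA" using x RA by (auto simp: y_def)
      have "orbit_root H (aH \<Phi>) y = orbit_root H (aH \<Psi>) y"
      proof (cases "y \<in> RH")
        case True
        then show ?thesis using orbit_root_fixed[OF act(2)[OF \<Phi>] finite_lessThan] orbit_root_fixed[OF act(2)[OF \<Psi>] finite_lessThan] RH by metis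
      next
        case False then show ?thesis using *[OF e(3)] y by blast
      qed
      then show ?thesis using rootA(3)[OF \<Phi> x] rootA(3)[OF \<Psi> x] rA[OF x] by (simp add: y_def)
    qed
    have "aG \<Phi> g i = aG \<Psi> g i" if "g \<in> carrier G" "i < n" for g i
      using that by (intro root_labels_determine[OF act(1)[OF \<Phi>] act(1)[OF \<Psi>] finite_lessThan rG]) (auto simp: *[OF e(4)])
    moreover have "aH \<Phi> g i = aH \<Psi> g i" if "g \<in> carrier H" "i < n" for g i
      using that by (intro root_labels_determine[OF act(2)[OF \<Phi>] act(2)[OF \<Psi>] finite_lessThan rH]) (auto simp: *[OF e(5)])
    ultimately show "\<Phi> = \<Psi>" by (intro action_eqI[OF \<Phi> \<Psi>]) (auto simp: aG_def aH_def)
  qed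
  have F_fin: "finite (F Q)" if "Q \<in> Pow ?E \<times> Pow ?E \<times> Pow ?E" for Q
    by (rule inj_on_finite[OF enc_inj enc_sub C_fin[OF that]])
  have cover: "actions \<Gamma> n = (\<Union>Q \<in> Pow ?E \<times> Pow ?E \<times> Pow ?E. F Q)"
    using R_mem by (auto simp: F_def)
  show "finite (actions \<Gamma> n)" unfolding cover using F_fin by (intro finite_UN_I) auto
  let ?B = "(2 ^ card (carrier G) * 2 ^ card (carrier H)) ^ n * real n powr (5 / 4 * real n)"
  have F_card: "real (card (F Q)) \<le> ?B" if Q: "Q \<in> Pow ?E \<times> Pow ?E \<times> Pow ?E" for Q
  proof (cases "F Q = {}")
    case False
    then obtain \<Phi> where \<Phi>: "\<Phi> \<in> actions \<Gamma> n" "R \<Phi> = Q" by (auto simp: F_def)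
    let ?RA = "orbit_root G' (aG \<Phi>) ` ?E" and ?RG = "orbit_root G (aG \<Phi>) ` ?E" and ?RH = "orbit_root H (aH \<Phi>) ` ?E"
    have Q': "Q = (?RA, ?RG, ?RH)" using \<Phi>(2) by (simp add: R_def)
    note RGA = orbit_roots_mono[OF act(1)[OF \<Phi>(1)] act(3)[OF \<Phi>(1)] finite_lessThan orbitA(1)]
      and RHA = orbit_roots_mono[OF act(2)[OF \<Phi>(1)] act(3)[OF \<Phi>(1)] finite_lessThan orbitA(2)]
    have RAE: "?RA \<subseteq> ?E" using Q Q' by simp
    let ?a = "card ?RA" and ?g = "card ?RG" and ?h = "card ?RH"
    have fins: "finite ?RA" "finite ?RG" "finite ?RH" by simp_all
    have le: "?g \<le> ?a" "?h \<le> ?a" "?a \<le> n"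
      using card_mono[OF fins(1) RGA] card_mono[OF fins(1) RHA] card_mono[OF _ RAE] by simp_all
    have "4 * ?a \<le> 4 * ?g + 4 * ?h + n"
      using orbits[of \<Phi>] \<Phi>(1) card_roots[OF act(1)[OF \<Phi>(1)]] card_roots[OF act(2)[OF \<Phi>(1)]] card_roots[OF act(3)[OF \<Phi>(1)]]
      by (simp add: actions_def aG_def aH_def G'_def)
    \<comment> \<open>The sum equals n + a - g - h; the inequalities \<open>le\<close> ensure that
      no subtraction is truncated.\<close>
    then have expo: "4 * ((n - ?a) + (?a - ?g) + (?a - ?h)) \<le> 5 * n" using le by simp
    have "card (F Q) \<le> card (C Q)"
      by (rule card_inj_on_le[OF enc_inj enc_sub C_fin[OF Q]])
    also have "card (C Q) = n ^ (n - ?a) * n ^ (?a - ?g) * n ^ (?a - ?h) * (2 ^ card (carrier G)) ^ n * (2 ^ card (carrier H)) ^ n"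
      unfolding Q' C_def using RAE RGA RHA fins fin
      by (simp add: card_cartesian_product card_PiE prod_constant card_Diff_subset card_Pow)
    also have "\<dots> = (2 ^ card (carrier G) * 2 ^ card (carrier H)) ^ n * n ^ ((n - ?a) + (?a - ?g) + (?a - ?h))"
      by (simp add: power_add power_mult_distrib)
    finally have "real (card (F Q)) \<le> (2 ^ card (carrier G) * 2 ^ card (carrier H)) ^ n * real n ^ ((n - ?a) + (?a - ?g) + (?a - ?h))"
      by (metis (mono_tags, lifting) of_nat_le_iff of_nat_mult of_nat_power of_nat_numeral)
    also have "real n ^ ((n - ?a) + (?a - ?g) + (?a - ?h)) = real n powr real ((n - ?a) + (?a - ?g) + (?a - ?h))"
      using n by (intro powr_realpow[symmetric]) simp
    also have "\<dots> \<le> real n powr (5 / 4 * real n)"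
    proof (rule powr_mono)
      have "real (4 * ((n - ?a) + (?a - ?g) + (?a - ?h))) \<le> real (5 * n)" using expo by (simp only: of_nat_le_iff)
      then show "real ((n - ?a) + (?a - ?g) + (?a - ?h)) \<le> 5 / 4 * real n" by simp
    qed (use n in simp)
    finally show ?thesis by (simp add: mult_left_mono)
  qed simp
  have "card (actions \<Gamma> n) \<le> (\<Sum>Q \<in> Pow ?E \<times> Pow ?E \<times> Pow ?E. card (F Q))"
    unfolding cover by (rule card_UN_le) simp
  then have "real (card (actions \<Gamma> n)) \<le> real (\<Sum>Q \<in> Pow ?E \<times> Pow ?E \<times> Pow ?E. card (F Q))"
    by (simp only: of_nat_le_iff)
  also have "\<dots> \<le> real (card (Pow ?E \<times> Pow ?E \<times> Pow ?E)) * ?B"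
    unfolding of_nat_sum using F_card by (rule sum_bounded_above)
  also have "real (card (Pow ?E \<times> Pow ?E \<times> Pow ?E)) = 8 ^ n"
    by (simp add: card_cartesian_product card_Pow flip: power_mult_distrib)
  finally show "real (card (actions \<Gamma> n)) \<le> (8 * 2 ^ card (carrier G) * 2 ^ card (carrier H)) ^ n * real n powr (5 / 4 * real n)"
    by (simp add: power_mult_distrib mult.assoc)
qed

end

section \<open>Constructing many subgroups\<close>

lemma cyclic_shift_permutes:
  "(\<lambda>l. if l < k then Suc l mod k else l) permutes {..<k::nat}"
proof (rule bij_imp_permutes)
  have inj: "inj_on (\<lambda>l. if l < k then Suc l mod k else l) {..<k}"
    by (auto simp: inj_on_def mod_Suc split: if_splits)
  moreover have sub: "(\<lambda>l. if l < k then Suc l mod k else l) ` {..<k} \<subseteq> {..<k}" by auto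
  ultimately show "bij_betw (\<lambda>l. if l < k then Suc l mod k else l) {..<k} {..<k}"
    using endo_inj_surj[OF _ sub inj] by (simp add: bij_betw_def)
qed simp

context amalgam_transversal begin

definition coset_index :: "'a \<Rightarrow> 'i" where
  "coset_index g = snd (inv_into (A \<times> I) (\<lambda>(a, i). a \<otimes>\<^bsub>G\<^esub> t i) g)"

lemma coset_index: "a \<in> A \<Longrightarrow> i \<in> I \<Longrightarrow> coset_index (a \<otimes>\<^bsub>G\<^esub> t i) = i"
  using bij_betw_inv_into_left[OF t, of "(a, i)"] by (simp add: coset_index_def)

lemma coset_index_closed: "g \<in> carrier G \<Longrightarrow> coset_index g \<in> I"
  using decompose_G coset_index by metis

lemma coset_index_mult: "a \<in> A \<Longrightarrow> g \<in> carrier G \<Longrightarrow> coset_index (a \<otimes>\<^bsub>G\<^esub> g) = coset_index g"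
  using decompose_G[of g] coset_index A_mult
  by (metis (no_types, lifting) A_carrier G.m_assoc t_closed)

text \<open>Normality lets \<open>a \<in> A\<close> pass from the right of \<open>g\<close> to its
  left, so left multiplication permutes the cosets and \<open>I\<close> becomes the
  \<open>G\<close>-set G/A.\<close>

lemma coset_index_action:
  assumes A: "A \<lhd> G" and g: "g \<in> carrier G" and h: "h \<in> carrier G" and i: "i \<in> I"
  shows "coset_index (g \<otimes>\<^bsub>G\<^esub> h \<otimes>\<^bsub>G\<^esub> t i) = coset_index (g \<otimes>\<^bsub>G\<^esub> t (coset_index (h \<otimes>\<^bsub>G\<^esub> t i)))"
proof -
  obtain a j where a: "a \<in> A" "j \<in> I" "h \<otimes>\<^bsub>G\<^esub> t i = a \<otimes>\<^bsub>G\<^esub> t j"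
    using decompose_G[of "h \<otimes>\<^bsub>G\<^esub> t i"] h i t_closed by auto
  have "g \<otimes>\<^bsub>G\<^esub> a \<otimes>\<^bsub>G\<^esub> inv\<^bsub>G\<^esub> g \<in> A" using normal.inv_op_closed2[OF A] g a by blast
  moreover have "g \<otimes>\<^bsub>G\<^esub> h \<otimes>\<^bsub>G\<^esub> t i = (g \<otimes>\<^bsub>G\<^esub> a \<otimes>\<^bsub>G\<^esub> inv\<^bsub>G\<^esub> g) \<otimes>\<^bsub>G\<^esub> (g \<otimes>\<^bsub>G\<^esub> t j)"
    using g h i a A_carrier t_closed by (simp add: G.m_assoc G.inv_solve_left)
  ultimately have "coset_index (g \<otimes>\<^bsub>G\<^esub> h \<otimes>\<^bsub>G\<^esub> t i) = coset_index (g \<otimes>\<^bsub>G\<^esub> t j)"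
    using coset_index_mult g a t_closed by simp
  then show ?thesis using a coset_index by simp
qed

text \<open>
  \<open>G\<close> acts on \<open>k\<close> copies of \<open>G + 2 G/A\<close>, and \<open>H\<close> acts on \<open>k\<close> copies of \<open>I \<times> Y\<close>, where \<open>Y\<close>
  consists of two \<open>A\<close>-fixed points and one free \<open>A\<close>-orbit. The bijection between the two sets
  permutes the \<open>k\<close> layers by \<open>\<pi>\<close> on the \<open>A\<close>-fixed points.
\<close>

lemma layered_action:
  fixes \<psi> :: "'b \<Rightarrow> 'y \<Rightarrow> 'y" and \<pi> :: "'i \<times> bool \<Rightarrow> nat \<Rightarrow> nat"
  assumes A: "A \<lhd> G" and Y: "group_action H Y \<psi>"
    and p: "p True \<in> Y" "p False \<in> Y" "p True \<noteq> p False"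
    and fixed: "\<And>a b. a \<in> A \<Longrightarrow> \<psi> (\<phi> a) (p b) = p b"
    and q: "q \<in> Y" and free: "bij_betw (\<lambda>a. \<psi> (\<phi> a) q) A (Y - {p True, p False})"
    and \<pi>: "\<And>e. e \<in> I \<times> UNIV \<Longrightarrow> \<pi> e permutes {..<k}"
  obtains \<Phi> where
    "group_action \<Gamma> (carrier G \<times> {..<k} <+> UNIV \<times> I \<times> {..<k}) \<Phi>"
    "\<And>g x l. g \<in> carrier G \<Longrightarrow> x \<in> carrier G \<Longrightarrow> l < k \<Longrightarrow> \<Phi> (inl g) (Inl (x, l)) = Inl (g \<otimes>\<^bsub>G\<^esub> x, l)"
    "\<And>g b i l. g \<in> carrier G \<Longrightarrow> i \<in> I \<Longrightarrow> l < k \<Longrightarrow> \<Phi> (inl g) (Inr (b, i, l)) = Inr (b, coset_index (g \<otimes>\<^bsub>G\<^esub> t i), l)"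
    "\<And>h b i l. h \<in> carrier H \<Longrightarrow> i \<in> I \<Longrightarrow> l < k \<Longrightarrow> \<psi> h q = p b \<Longrightarrow> \<Phi> (inr h) (Inl (t i, l)) = Inr (b, i, \<pi> (i, b) l)"
proof -
  let ?E = "carrier G \<times> {..<k} <+> (UNIV :: bool set) \<times> I \<times> {..<k}"
  interpret Y: group_action H Y \<psi> by fact
  define aG where "aG g = restrict (case_sum (\<lambda>(x, l). Inl (g \<otimes>\<^bsub>G\<^esub> x, l))
    (\<lambda>(b, i, l). Inr (b, coset_index (g \<otimes>\<^bsub>G\<^esub> t i), l))) ?E" for g
  have aG: "group_action G ?E aG"
    unfolding aG_def
    by (intro group_actionI G.is_group)
      (auto simp: G.m_assoc coset_index_closed t_closed coset_index_action[OF A] simp flip: G.m_assoc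
        dest: coset_index[OF A_one] split: sum.splits)
  define aH where "aH h = restrict (\<lambda>(i, y, l). (i, \<psi> h y, l)) (I \<times> Y \<times> {..<k})" for h
  have aH: "group_action H (I \<times> Y \<times> {..<k}) aH"
    unfolding aH_def by (intro group_actionI H.is_group) (auto simp: Y.act_closed Y.act_one Y.composition_rule)
  define c where "c = inv_into A (\<lambda>a. \<psi> (\<phi> a) q)"
  have c: "c (\<psi> (\<phi> a) q) = a" if "a \<in> A" for a
    unfolding c_def using bij_betw_inv_into_left[OF free that] .
  have Yq: "\<psi> (\<phi> a) q \<in> Y" "\<psi> (\<phi> a) q \<noteq> p b" if "a \<in> A" for a b
    using bij_betwE[OF free] that by (cases b; auto)+
  have Y_cases: "(\<exists>b. y = p b) \<or> (\<exists>a\<in>A. y = \<psi> (\<phi> a) q)" if "y \<in> Y" for y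
    using free that unfolding bij_betw_def by (metis (no_types, lifting) DiffI imageE insertE singletonD)
  \<comment> \<open>The free orbit in copy \<open>i\<close> is matched with the coset of
    \<open>t i\<close> in the regular \<open>G\<close>-set of the same layer. The fixed point
    \<open>p b\<close> in copy \<open>i\<close> is matched with point \<open>i\<close> of the copy
    \<open>b\<close> of G/A, in a layer chosen by \<open>\<pi>\<close>.\<close>
  define \<theta> where "\<theta> = (\<lambda>(i, y, l). if y = p True then Inr (True, i, \<pi> (i, True) l)
    else if y = p False then Inr (False, i, \<pi> (i, False) l) else Inl (c y \<otimes>\<^bsub>G\<^esub> t i, l))"
  have \<theta>p: "\<theta> (i, p b, l) = Inr (b, i, \<pi> (i, b) l)" for i b l
    using p(3) by (cases b) (auto simp: \<theta>_def)
  have \<theta>q: "\<theta> (i, \<psi> (\<phi> a) q, l) = Inl (a \<otimes>\<^bsub>G\<^esub> t i, l)" if "a \<in> A" for i a l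
    using Yq(2)[OF that] c[OF that] by (simp add: \<theta>_def)
  have pY: "p b \<in> Y" for b using p by (cases b) auto
  have \<pi>k: "\<pi> (i, b) l < k" if "i \<in> I" "l < k" for i b l
    using permutes_in_image[OF \<pi>, of "(i, b)" l] that by auto
  have \<theta>: "bij_betw \<theta> (I \<times> Y \<times> {..<k}) ?E"
    unfolding bij_betw_def
  proof
    show "inj_on \<theta> (I \<times> Y \<times> {..<k})"
    proof (rule inj_onI)
      fix x x' assume "x \<in> I \<times> Y \<times> {..<k}" "x' \<in> I \<times> Y \<times> {..<k}" and eq: "\<theta> x = \<theta> x'"
      then obtain i y l i' y' l' where x: "x = (i, y, l)" "i \<in> I" "y \<in> Y" "l < k" "x' = (i', y', l')" "i' \<in> I" "y' \<in> Y" "l' < k"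
        by auto
      from Y_cases[OF x(3)] Y_cases[OF x(7)] show "x = x'"
      proof (elim disjE exE bexE)
        fix b b' assume y: "y = p b" "y' = p b'"
        have "inj (\<pi> (i, b))" using \<pi>[of "(i, b)"] x(2) by (intro permutes_inj) auto
        then show ?thesis using eq x y by (auto simp: \<theta>p dest: injD)
      next
        fix b a' assume "y = p b" "a' \<in> A" "y' = \<psi> (\<phi> a') q"
        then show ?thesis using eq x by (simp add: \<theta>p \<theta>q)
      next
        fix a b' assume "a \<in> A" "y = \<psi> (\<phi> a) q" "y' = p b'"
        then show ?thesis using eq x by (simp add: \<theta>p \<theta>q)
      next
        fix a a' assume a: "a \<in> A" "y = \<psi> (\<phi> a) q" "a' \<in> A" "y' = \<psi> (\<phi> a') q"
        then have "a \<otimes>\<^bsub>G\<^esub> t i = a' \<otimes>\<^bsub>G\<^esub> t i'" "l = l'" using eq x by (simp_all add: \<theta>q)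
        then have "(a, i) = (a', i')"
          using inj_onD[OF bij_betw_imp_inj_on[OF t], of "(a, i)" "(a', i')"] a x by simp
        then show ?thesis using a x \<open>l = l'\<close> by simp
      qed
    qed
    show "\<theta> ` (I \<times> Y \<times> {..<k}) = ?E"
    proof (intro equalityI subsetI)
      fix z assume "z \<in> \<theta> ` (I \<times> Y \<times> {..<k})"
      then obtain i y l where x: "z = \<theta> (i, y, l)" "i \<in> I" "y \<in> Y" "l < k" by auto
      from Y_cases[OF x(3)] show "z \<in> ?E"
        using x \<pi>k by (auto simp: \<theta>p \<theta>q A_carrier t_closed)
    next
      fix z assume "z \<in> ?E"
      then show "z \<in> \<theta> ` (I \<times> Y \<times> {..<k})"
      proof
        fix u assume u: "u \<in> carrier G \<times> {..<k}" "z = Inl u"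
        then obtain x l where xl: "u = (x, l)" "x \<in> carrier G" "l < k" by auto
        obtain a i where a: "a \<in> A" "i \<in> I" "x = a \<otimes>\<^bsub>G\<^esub> t i" using decompose_G[OF xl(2)] .
        have "z = \<theta> (i, \<psi> (\<phi> a) q, l)" using a xl u by (simp add: \<theta>q)
        then show ?thesis using a xl Yq by blast
      next
        fix u assume u: "u \<in> (UNIV :: bool set) \<times> I \<times> {..<k}" "z = Inr u"
        then obtain b i l where xl: "u = (b, i, l)" "i \<in> I" "l < k" by auto
        have "l \<in> \<pi> (i, b) ` {..<k}" using permutes_image[OF \<pi>, of "(i, b)"] xl by auto
        then obtain l' where "l' < k" "l = \<pi> (i, b) l'" by auto
        then have "z = \<theta> (i, p b, l')" using xl u by (simp add: \<theta>p)
        then show ?thesis using xl \<open>l' < k\<close> pY by blast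
      qed
    qed
  qed
  \<comment> \<open>On the fixed points \<open>a\<close> acts trivially on both sides, so this holds
    for every choice of \<open>\<pi>\<close>.\<close>
  have equi: "\<theta> (aH (\<phi> a) x) = aG a (\<theta> x)" if a: "a \<in> A" and x_in: "x \<in> I \<times> Y \<times> {..<k}" for a x
  proof -
    obtain i y l where x: "x = (i, y, l)" "i \<in> I" "y \<in> Y" "l < k" using x_in by auto
    from Y_cases[OF x(3)] show ?thesis
    proof (elim disjE exE bexE)
      fix b assume "y = p b"
      then show ?thesis
        using x a \<pi>k[of i l b] fixed[OF a] coset_index[OF a x(2)] by (auto simp: aH_def aG_def \<theta>p pY)
    next
      fix b assume b: "b \<in> A" "y = \<psi> (\<phi> b) q"
      have "\<psi> (\<phi> a) (\<psi> (\<phi> b) q) = \<psi> (\<phi> (a \<otimes>\<^bsub>G\<^esub> b)) q"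
        using a b by (simp add: \<phi>_mult Y.composition_rule[OF q] \<phi>_carrier)
      then show ?thesis
        using x a b by (auto simp: aH_def aG_def \<theta>q A_mult A_carrier t_closed G.m_assoc)
    qed
  qed
  obtain \<Phi> where \<Phi>: "group_action \<Gamma> ?E \<Phi>"
    "\<And>g x. g \<in> carrier G \<Longrightarrow> \<Phi> (inl g) x = aG g x"
    "\<And>h y. h \<in> carrier H \<Longrightarrow> y \<in> I \<times> Y \<times> {..<k} \<Longrightarrow> \<Phi> (inr h) (\<theta> y) = \<theta> (aH h y)"
    using glue_actions[OF aG aH \<theta> equi] by blast
  show ?thesis
  proof
    show "group_action \<Gamma> ?E \<Phi>" by (rule \<Phi>)
    show "\<Phi> (inl g) (Inl (x, l)) = Inl (g \<otimes>\<^bsub>G\<^esub> x, l)" if "g \<in> carrier G" "x \<in> carrier G" "l < k" for g x l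
      using that by (auto simp: \<Phi>(2) aG_def)
    show "\<Phi> (inl g) (Inr (b, i, l)) = Inr (b, coset_index (g \<otimes>\<^bsub>G\<^esub> t i), l)" if "g \<in> carrier G" "i \<in> I" "l < k" for g b i l
      using that by (auto simp: \<Phi>(2) aG_def)
    show "\<Phi> (inr h) (Inl (t i, l)) = Inr (b, i, \<pi> (i, b) l)"
      if "h \<in> carrier H" "i \<in> I" "l < k" "\<psi> h q = p b" for h b i l
    proof -
      have "\<psi> (\<phi> \<one>\<^bsub>G\<^esub>) q = q" using Y.act_one[OF q] by (simp add: \<phi>_one)
      then have "\<theta> (i, q, l) = Inl (t i, l)" using \<theta>q[OF A_one, of i l] that t_closed by simp
      then have "\<Phi> (inr h) (Inl (t i, l)) = \<theta> (aH h (i, q, l))" using \<Phi>(3)[OF that(1), of "(i, q, l)"] that q by simp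
      also have "\<dots> = Inr (b, i, \<pi> (i, b) l)" using that q by (auto simp: aH_def \<theta>p)
      finally show ?thesis .
    qed
  qed
qed

text \<open>The elements \<open>h b\<close> lead from the free orbit to the fixed points, so they
  are used to walk through the graph. Different families of permutations yield different
  stabilizers, because the base point can be carried to any given point by one group element that
  works for all families, and stabilizers can then be compared. The assumption \<open>finS\<close>
  excludes that \<open>card\<close> takes its default value 0.\<close>

lemma subgroup_count_ge:
  fixes \<psi> :: "'b \<Rightarrow> 'y \<Rightarrow> 'y"
  assumes A: "A \<lhd> G" and Y: "group_action H Y \<psi>"
    and p: "p True \<in> Y" "p False \<in> Y" "p True \<noteq> p False"
    and fixed: "\<And>a b. a \<in> A \<Longrightarrow> \<psi> (\<phi> a) (p b) = p b"
    and q: "q \<in> Y" and free: "bij_betw (\<lambda>a. \<psi> (\<phi> a) q) A (Y - {p True, p False})"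
    and h: "\<And>b. h b \<in> carrier H" "\<And>b. \<psi> (h b) q = p b"
    and fin: "finite (carrier G)" "finite I" and I: "i\<^sub>1 \<in> I" "i\<^sub>1 \<noteq> i\<^sub>0" and k: "k \<ge> 1"
    and finS: "finite {S. subgroup S \<Gamma> \<and> card (rcosets\<^bsub>\<Gamma>\<^esub> S) = (card (carrier G) + 2 * card I) * k}"
  shows "fact k ^ (2 * card I - 3) \<le> subgroup_count \<Gamma> ((card (carrier G) + 2 * card I) * k)"
proof -
  let ?E = "carrier G \<times> {..<k} <+> (UNIV :: bool set) \<times> I \<times> {..<k}"
  let ?m = "(card (carrier G) + 2 * card I) * k"
  \<comment> \<open>The two edges at \<open>i\<^sub>0\<close> carry the identity and attach both
    copies of G/A to the regular orbit within each layer; the edge \<open>(i\<^sub>1, True)\<close>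
    carries the cyclic shift and joins the layers. The remaining edges are free.\<close>
  define J where "J = I \<times> (UNIV :: bool set) - {(i\<^sub>0, True), (i\<^sub>0, False), (i\<^sub>1, True)}"
  define Q where "Q = (J \<rightarrow>\<^sub>E {\<pi>. \<pi> permutes {..<k}})"
  define cyc where "cyc = (\<lambda>l. if l < k then Suc l mod k else l)"
  define full where "full P e = (if e \<in> J then P e else if e = (i\<^sub>1, True) then cyc else id)" for P :: "'i \<times> bool \<Rightarrow> nat \<Rightarrow> nat" and e
  have full: "full P e permutes {..<k}" if "P \<in> Q" for P e
    using that cyclic_shift_permutes[of k] by (auto simp: full_def Q_def cyc_def permutes_id)
  define good where "good P \<Phi> \<longleftrightarrow> group_action \<Gamma> ?E \<Phi> \<and>
    (\<forall>g\<in>carrier G. \<forall>x\<in>carrier G. \<forall>l<k. \<Phi> (inl g) (Inl (x, l)) = Inl (g \<otimes>\<^bsub>G\<^esub> x, l)) \<and>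
    (\<forall>g\<in>carrier G. \<forall>b. \<forall>i\<in>I. \<forall>l<k. \<Phi> (inl g) (Inr (b, i, l)) = Inr (b, coset_index (g \<otimes>\<^bsub>G\<^esub> t i), l)) \<and>
    (\<forall>b. \<forall>i\<in>I. \<forall>l<k. \<Phi> (inr (h b)) (Inl (t i, l)) = Inr (b, i, full P (i, b) l))" for P \<Phi>
  define \<Phi> where "\<Phi> P = (SOME \<Phi>. good P \<Phi>)" for P
  have ex: "\<exists>\<Phi>. good P \<Phi>" if P: "P \<in> Q" for P
    unfolding good_def
    by (rule layered_action[where \<pi> = "full P" and k = k, OF A Y p fixed q free full[OF P]])
      (assumption, rule exI, intro conjI, assumption, simp_all add: h)
  have good: "good P (\<Phi> P)" if "P \<in> Q" for P
    unfolding \<Phi>_def by (rule someI_ex[OF ex[OF that]])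
  have \<Phi>: "group_action \<Gamma> ?E (\<Phi> P)"
    and \<Phi>G: "\<And>g x l. g \<in> carrier G \<Longrightarrow> x \<in> carrier G \<Longrightarrow> l < k \<Longrightarrow> \<Phi> P (inl g) (Inl (x, l)) = Inl (g \<otimes>\<^bsub>G\<^esub> x, l)"
    and \<Phi>I: "\<And>g b i l. g \<in> carrier G \<Longrightarrow> i \<in> I \<Longrightarrow> l < k \<Longrightarrow> \<Phi> P (inl g) (Inr (b, i, l)) = Inr (b, coset_index (g \<otimes>\<^bsub>G\<^esub> t i), l)"
    and \<Phi>H: "\<And>b i l. i \<in> I \<Longrightarrow> l < k \<Longrightarrow> \<Phi> P (inr (h b)) (Inl (t i, l)) = Inr (b, i, full P (i, b) l)"
    if "P \<in> Q" for P
    using good[OF that] unfolding good_def by simp_all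
  define base :: "('a \<times> nat) + (bool \<times> 'i \<times> nat)" where "base = Inl (\<one>\<^bsub>G\<^esub>, 0)"
  have base: "base \<in> ?E" using k by (auto simp: base_def)
  \<comment> \<open>The order of the quantifiers matters: the same \<open>x\<close> has to serve
    every \<open>P\<close>. Hence only edges outside \<open>J\<close> may be used until every point
    is reached.\<close>
  define reach where "reach \<omega> \<longleftrightarrow> (\<exists>x\<in>carrier \<Gamma>. \<forall>P\<in>Q. \<Phi> P x base = \<omega>)" for \<omega>
  have reach_step: "reach \<omega>'" if r: "reach \<omega>" and x: "x \<in> carrier \<Gamma>" and x_act: "\<And>P. P \<in> Q \<Longrightarrow> \<Phi> P x \<omega> = \<omega>'" for \<omega> \<omega>' x
  proof -
    obtain y where y: "y \<in> carrier \<Gamma>" "\<forall>P\<in>Q. \<Phi> P y base = \<omega>" using r unfolding reach_def by (elim bexE)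
    have "\<Phi> P (x \<otimes>\<^bsub>\<Gamma>\<^esub> y) base = \<omega>'" if "P \<in> Q" for P
      using group_action.composition_rule[OF \<Phi>[OF that] base x y(1)] y(2) x_act that by simp
    then show ?thesis unfolding reach_def using x y(1) by (intro bexI[of _ "x \<otimes>\<^bsub>\<Gamma>\<^esub> y"] ballI) auto
  qed
  have return: "\<Phi> P (inv\<^bsub>\<Gamma>\<^esub> inr (h b)) (Inr (b, i, full P (i, b) l)) = Inl (t i, l)" if "P \<in> Q" "i \<in> I" "l < k" for P b i l
    by (rule group_action.orbit_sym_aux[OF \<Phi>[OF that(1)]]) (use that h \<Phi>H t_closed in auto)
  have full_i0: "full P (i\<^sub>0, b) = id" "full P (i\<^sub>1, True) = cyc" for P b
    using I by (cases b; auto simp: full_def J_def)+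
  have idx: "coset_index (t i) = i" if "i \<in> I" for i
    using coset_index[OF A_one that] that t_closed by simp
  have move: "reach (Inr (b, i, l))" if "reach (Inr (b, j, l))" "i \<in> I" "j \<in> I" "l < k" for b i j l
  proof (rule reach_step[OF that(1), of "inl (t i \<otimes>\<^bsub>G\<^esub> inv\<^bsub>G\<^esub> t j)"])
    show "inl (t i \<otimes>\<^bsub>G\<^esub> inv\<^bsub>G\<^esub> t j) \<in> carrier \<Gamma>" using that t_closed by simp
    show "\<Phi> P (inl (t i \<otimes>\<^bsub>G\<^esub> inv\<^bsub>G\<^esub> t j)) (Inr (b, j, l)) = Inr (b, i, l)" if "P \<in> Q" for P
      using \<Phi>I[OF that, of "t i \<otimes>\<^bsub>G\<^esub> inv\<^bsub>G\<^esub> t j" j l b] \<open>i \<in> I\<close> \<open>j \<in> I\<close> \<open>l < k\<close> t_closed idx by (simp add: G.m_assoc)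
  qed
  have moveG: "reach (Inl (y, l))" if "reach (Inl (x, l))" "x \<in> carrier G" "y \<in> carrier G" "l < k" for x y l
  proof (rule reach_step[OF that(1), of "inl (y \<otimes>\<^bsub>G\<^esub> inv\<^bsub>G\<^esub> x)"])
    show "inl (y \<otimes>\<^bsub>G\<^esub> inv\<^bsub>G\<^esub> x) \<in> carrier \<Gamma>" using that by simp
    show "\<Phi> P (inl (y \<otimes>\<^bsub>G\<^esub> inv\<^bsub>G\<^esub> x)) (Inl (x, l)) = Inl (y, l)" if "P \<in> Q" for P
      using \<Phi>G[OF that, of "y \<otimes>\<^bsub>G\<^esub> inv\<^bsub>G\<^esub> x" x l] \<open>x \<in> carrier G\<close> \<open>y \<in> carrier G\<close> \<open>l < k\<close> by (simp add: G.m_assoc)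
  qed
  \<comment> \<open>The next layer is reached by leaving along \<open>(i\<^sub>1, True)\<close>,
    where the shift acts, moving inside G/A, and returning along \<open>(i\<^sub>0, True)\<close>,
    where nothing is shifted.\<close>
  have layer: "reach (Inl (\<one>\<^bsub>G\<^esub>, l))" if "l < k" for l
    using that
  proof (induction l)
    case 0
    have "\<forall>P\<in>Q. \<Phi> P \<one>\<^bsub>\<Gamma>\<^esub> base = base" using group_action.act_one[OF \<Phi> base] by simp
    then show ?case unfolding reach_def base_def by blast
  next
    case (Suc l)
    then have l: "l < k" "cyc l = Suc l" by (auto simp: cyc_def)
    have "reach (Inl (t i\<^sub>1, l))" using moveG[OF Suc.IH] l I t_closed by simp
    then have "reach (Inr (True, i\<^sub>1, Suc l))"
      by (rule reach_step[of _ "inr (h True)"]) (use h \<Phi>H I l full_i0 in auto)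
    then have "reach (Inr (True, i\<^sub>0, Suc l))" using move I i\<^sub>0 Suc.prems by blast
    then have "reach (Inl (t i\<^sub>0, Suc l))"
      by (rule reach_step[of _ "inv\<^bsub>\<Gamma>\<^esub> inr (h True)"]) (use h return[of _ i\<^sub>0 "Suc l" True] i\<^sub>0 Suc.prems full_i0 in auto)
    then show ?case using i\<^sub>0 by simp
  qed
  have reach_Inl: "reach (Inl (g, l))" if "g \<in> carrier G" "l < k" for g l
    using moveG[OF layer] that by simp
  have reach_Inr: "reach (Inr (b, i, l))" if "i \<in> I" "l < k" for b i l
  proof -
    have "reach (Inr (b, i\<^sub>0, l))"
    proof (rule reach_step[OF reach_Inl[of "t i\<^sub>0" l], of "inr (h b)"])
      show "\<Phi> P (inr (h b)) (Inl (t i\<^sub>0, l)) = Inr (b, i\<^sub>0, l)" if "P \<in> Q" for P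
        using \<Phi>H[OF that i\<^sub>0(1) \<open>l < k\<close>, of b] by (simp add: full_i0)
    qed (use that h i\<^sub>0 in auto)
    then show ?thesis using move that i\<^sub>0 by blast
  qed
  define st where "st P = stabilizer \<Gamma> (\<Phi> P) base" for P
  have st_mem: "st P \<in> {S. subgroup S \<Gamma> \<and> card (rcosets\<^bsub>\<Gamma>\<^esub> S) = ?m}" if P: "P \<in> Q" for P
  proof -
    interpret P: group_action "amalgamated_product G H A \<phi>" ?E "\<Phi> P" by (rule \<Phi>[OF P])
    have "orbit \<Gamma> (\<Phi> P) base = ?E"
    proof (intro equalityI subsetI)
      fix \<omega> assume "\<omega> \<in> orbit \<Gamma> (\<Phi> P) base"
      then obtain x where "x \<in> carrier \<Gamma>" "\<omega> = \<Phi> P x base" unfolding orbit_def by blast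
      then show "\<omega> \<in> ?E" using P.act_closed[OF _ base] by simp
    next
      fix \<omega> assume "\<omega> \<in> ?E"
      then have "reach \<omega>" using reach_Inl reach_Inr by auto
      then obtain x where x: "x \<in> carrier \<Gamma>" "\<forall>P\<in>Q. \<Phi> P x base = \<omega>" unfolding reach_def by (elim bexE)
      then have "\<Phi> P x base = \<omega>" using P by (elim ballE) auto
      then show "\<omega> \<in> orbit \<Gamma> (\<Phi> P) base" unfolding orbit_def using x(1) by (intro CollectI exI[of _ x]) simp
    qed
    moreover have "card ?E = ?m" using fin by (simp add: card_Plus card_cartesian_product algebra_simps)
    ultimately have "card (rcosets\<^bsub>\<Gamma>\<^esub> (st P)) = ?m"
      unfolding st_def using bij_betw_same_card[OF P.orbit_stab_fun_is_bij[OF base]] by simp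
    then show ?thesis using P.stabilizer_subgroup[OF base] by (simp add: st_def)
  qed
  have inj: "inj_on st Q"
  proof (rule inj_onI)
    fix P P' assume P: "P \<in> Q" "P' \<in> Q" "st P = st P'"
    have "P e = P' e" if e: "e \<in> J" for e
    proof
      fix l
      obtain i b where ib: "e = (i, b)" "i \<in> I" using e by (auto simp: J_def)
      have perm: "P e permutes {..<k}" "P' e permutes {..<k}" using P e by (auto simp: Q_def)
      show "P e l = P' e l"
      proof (cases "l < k")
        case False
        then show ?thesis using perm by (simp add: permutes_not_in)
      next
        case True
        have lk: "P e l < k" using permutes_in_image[OF perm(1), of l] True by simp
        obtain x where x: "x \<in> carrier \<Gamma>" "\<forall>P\<in>Q. \<Phi> P x base = Inl (t i, l)"
          using reach_Inl[of "t i" l] True ib t_closed unfolding reach_def by blast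
        obtain y where y: "y \<in> carrier \<Gamma>" "\<forall>P''\<in>Q. \<Phi> P'' y base = Inr (b, i, P e l)"
          using reach_Inr[of i "P e l" b] lk ib unfolding reach_def by blast
        \<comment> \<open>The image of the base point under \<open>z\<close> depends on the family
          through its value at \<open>e\<close> and \<open>l\<close>, while its image under
          \<open>y\<close> does not. Whether \<open>z\<close> and \<open>y\<close> differ by a
          stabilizer element thus reveals this value.\<close>
        define z where "z = inr (h b) \<otimes>\<^bsub>\<Gamma>\<^esub> x"
        have z: "z \<in> carrier \<Gamma>" using x h by (simp add: z_def)
        have z_base: "\<Phi> P'' z base = Inr (b, i, P'' e l)" if "P'' \<in> Q" for P''
        proof -
          have "\<Phi> P'' z base = \<Phi> P'' (inr (h b)) (\<Phi> P'' x base)"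
            unfolding z_def using h x by (intro group_action.composition_rule[OF \<Phi>[OF that] base]) auto
          then show ?thesis using x \<Phi>H[OF that ib(2) True] that e ib by (simp add: full_def)
        qed
        have mem: "inv\<^bsub>\<Gamma>\<^esub> y \<otimes>\<^bsub>\<Gamma>\<^esub> z \<in> st P'' \<longleftrightarrow> P'' e l = P e l" if P'': "P'' \<in> Q" for P''
        proof -
          interpret P'': group_action "amalgamated_product G H A \<phi>" ?E "\<Phi> P''" by (rule \<Phi>[OF P''])
          have "\<Phi> P'' (inv\<^bsub>\<Gamma>\<^esub> y \<otimes>\<^bsub>\<Gamma>\<^esub> z) base = \<Phi> P'' (inv\<^bsub>\<Gamma>\<^esub> y) (\<Phi> P'' z base)"
            using y z by (intro P''.composition_rule[OF base]) auto
          then have "inv\<^bsub>\<Gamma>\<^esub> y \<otimes>\<^bsub>\<Gamma>\<^esub> z \<in> st P'' \<longleftrightarrow> \<Phi> P'' (inv\<^bsub>\<Gamma>\<^esub> y) (\<Phi> P'' z base) = base"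
            using y z by (simp add: st_def stabilizer_def)
          also have "\<dots> \<longleftrightarrow> \<Phi> P'' z base = \<Phi> P'' y base"
            using P''.act_inv[OF y(1)] P''.act_closed[OF z base] base by metis
          finally show ?thesis using z_base[OF P''] y(2) P'' by auto
        qed
        show ?thesis using mem[OF P(1)] mem[OF P(2)] P(3) by simp
      qed
    qed
    then show "P = P'" using P unfolding Q_def by (intro PiE_ext) auto
  qed
  have "card J = 2 * card I - 3"
  proof -
    have "card ({(i\<^sub>0, True), (i\<^sub>0, False), (i\<^sub>1, True)}) = 3" using I by simp
    then show ?thesis unfolding J_def using I i\<^sub>0 fin
      by (subst card_Diff_subset) (auto simp: card_cartesian_product)
  qed
  moreover have "finite J" using fin by (simp add: J_def)
  ultimately have "card Q = fact k ^ (2 * card I - 3)"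
    unfolding Q_def using card_permutations[of "{..<k}" k] by (simp add: card_PiE prod_constant)
  moreover have "card Q \<le> subgroup_count \<Gamma> ?m"
    unfolding subgroup_count_def using st_mem by (intro card_inj_on_le[OF inj _ finS]) auto
  ultimately show ?thesis by simp
qed

end

section \<open>The two Klein four-groups\<close>

lemma (in group) klein_subgroup:
  assumes "a \<in> carrier G" "b \<in> carrier G" and aa: "a \<otimes> a = \<one>" and bb: "b \<otimes> b = \<one>" and ab: "a \<otimes> b = b \<otimes> a"
  shows "subgroup {\<one>, a, b, a \<otimes> b} G"
proof -
  have aab: "a \<otimes> (a \<otimes> x) = x" if "x \<in> carrier G" for x using assms that by (simp flip: m_assoc)
  have bbx: "b \<otimes> (b \<otimes> x) = x" if "x \<in> carrier G" for x using assms that by (simp flip: m_assoc)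
  have abx: "a \<otimes> (b \<otimes> x) = b \<otimes> (a \<otimes> x)" if "x \<in> carrier G" for x using assms that by (simp flip: m_assoc)
  have inv: "inv a = a" "inv b = b" using assms by (auto intro: inv_equality)
  show ?thesis
  proof (rule subgroupI)
    fix x assume "x \<in> {\<one>, a, b, a \<otimes> b}"
    then show "inv x \<in> {\<one>, a, b, a \<otimes> b}" using assms inv by (auto simp: inv_mult_group)
  next
    fix x y assume "x \<in> {\<one>, a, b, a \<otimes> b}" "y \<in> {\<one>, a, b, a \<otimes> b}"
    then show "x \<otimes> y \<in> {\<one>, a, b, a \<otimes> b}"
      using assms aab bbx abx by (auto simp: m_assoc)
  qed (use assms in auto)
qed

lemma (in group) exists_transversal:
  assumes A: "subgroup A G" and fin: "finite (carrier G)" and card: "card (rcosets A) = k"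
  obtains t where "t 0 = \<one>" "\<And>i. i < k \<Longrightarrow> t i \<in> carrier G"
    "bij_betw (\<lambda>(a, i). a \<otimes> t i) (A \<times> {..<k}) (carrier G)"
proof -
  interpret A: subgroup A G by fact
  have AA: "A \<in> rcosets A" by (rule A.subgroup_in_rcosets[OF is_group])
  have finM: "finite (rcosets A)" using fin by (simp add: RCOSETS_def)
  then obtain h where h: "bij_betw h {..<k} (rcosets A)"
    using ex_bij_betw_nat_finite[of "rcosets A"] card by (auto simp: atLeast0LessThan)
  obtain j where j: "j < k" "h j = A" using h AA by (metis bij_betw_iff_bijections lessThan_iff)
  \<comment> \<open>Renumbered so that the coset \<open>A\<close> has index 0 and can be represented
    by the unit.\<close>
  define c where "c = h \<circ> transpose j 0"
  have "bij_betw (transpose j 0) {..<k} {..<k}"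
    using j by (intro permutes_imp_bij permutes_swap_id) auto
  then have c: "bij_betw c {..<k} (rcosets A)" unfolding c_def by (rule bij_betw_trans[OF _ h])
  have c0: "c 0 = A" using j by (simp add: c_def)
  define t where "t i = (if i = 0 then \<one> else SOME x. x \<in> c i)" for i
  have t: "t i \<in> carrier G" "A #> t i = c i" if i: "i < k" for i
  proof -
    have ci: "c i \<in> rcosets A" using bij_betwE[OF c] i by blast
    have "t i \<in> c i"
    proof (cases "i = 0")
      case False
      have "c i \<noteq> {}" using A.rcosets_non_empty[OF ci] .
      then show ?thesis using False by (simp add: t_def some_in_eq)
    qed (simp add: t_def c0)
    then show "t i \<in> carrier G" using A.rcosets_carrier[OF is_group ci] by blast
    obtain x where x: "x \<in> carrier G" "c i = A #> x" using ci by (auto simp: RCOSETS_def)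
    then show "A #> t i = c i" using repr_independence[OF _ _ A, of "t i" x] \<open>t i \<in> c i\<close> by simp
  qed
  show ?thesis
  proof (rule that)
    show "t 0 = \<one>" by (simp add: t_def)
    show "bij_betw (\<lambda>(a, i). a \<otimes> t i) (A \<times> {..<k}) (carrier G)"
      unfolding bij_betw_def
    proof
      show "inj_on (\<lambda>(a, i). a \<otimes> t i) (A \<times> {..<k})"
      proof (rule inj_onI)
        fix x y assume "x \<in> A \<times> {..<k}" "y \<in> A \<times> {..<k}" and eq: "(case x of (a, i) \<Rightarrow> a \<otimes> t i) = (case y of (a, i) \<Rightarrow> a \<otimes> t i)"
        then obtain a i b j where xy: "x = (a, i)" "a \<in> A" "i < k" "y = (b, j)" "b \<in> A" "j < k" by auto
        have "A #> (a \<otimes> t i) = A #> t i" "A #> (b \<otimes> t j) = A #> t j"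
          using xy t coset_mult_assoc[OF A.subset] coset_join2[OF _ A] by (metis A.mem_carrier)+
        then have "c i = c j" using eq xy t by simp
        then have "i = j" using inj_onD[OF bij_betw_imp_inj_on[OF c]] xy by simp
        then show "x = y" using eq xy t by simp
      qed
      show "(\<lambda>(a, i). a \<otimes> t i) ` (A \<times> {..<k}) = carrier G"
      proof (intro equalityI subsetI)
        fix x assume x: "x \<in> carrier G"
        then have "A #> x \<in> c ` {..<k}" using c rcosetsI[OF A.subset] by (simp add: bij_betw_def)
        then obtain i where i: "i < k" "c i = A #> x" by auto
        then have "x \<in> A #> t i" using t rcos_self[OF x A] by simp
        then obtain a where "a \<in> A" "x = a \<otimes> t i" by (auto simp: r_coset_def)
        then show "x \<in> (\<lambda>(a, i). a \<otimes> t i) ` (A \<times> {..<k})" using i by force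
      qed (use t A.subset in auto)
    qed
  qed (rule t)
qed

section \<open>Normality of V, and the subgroup W\<close>

lemma permutes_14_cases:
  assumes "p permutes {1..4::nat}" "i \<in> {1, 2, 3, 4}"
  shows "p i \<in> {1, 2, 3, 4}"
proof -
  have "{1..4} = {1, 2, 3, 4::nat}" by auto
  then show ?thesis using permutes_in_image[OF assms(1), of i] assms(2) by simp
qed

lemma permutes_14_eqI:
  assumes "p permutes {1..4::nat}" "q permutes {1..4}" "p 1 = q 1" "p 2 = q 2" "p 3 = q 3" "p 4 = q 4"
  shows "p = q"
proof
  fix i :: nat
  have "{1..4} = {1, 2, 3, 4::nat}" by auto
  then show "p i = q i"
    using assms permutes_not_in[OF assms(1), of i] permutes_not_in[OF assms(2), of i] by (cases "i \<in> {1..4}") auto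
qed

lemma double_transpositionI:
  assumes p: "p permutes {1..4::nat}" and pp: "\<And>i. p (p i) = i" and fixfree: "\<And>i. i \<in> {1, 2, 3, 4} \<Longrightarrow> p i \<noteq> i"
  shows "p \<in> {v1, v2, v3}"
proof -
  have perm: "v1 permutes {1..4}" "v2 permutes {1..4}" "v3 permutes {1..4}"
    by (intro permutes_compose permutes_swap_id; simp)+
  have r: "p 1 \<in> {1, 2, 3, 4}" "p 2 \<in> {1, 2, 3, 4}" "p 3 \<in> {1, 2, 3, 4}" "p 4 \<in> {1, 2, 3, 4}"
    by (rule permutes_14_cases[OF p]; simp)+
  have n: "p 1 \<noteq> 1" "p 2 \<noteq> 2" "p 3 \<noteq> 3" "p 4 \<noteq> 4" by (rule fixfree; simp)+
  from r(1) n(1) consider "p 1 = 2" | "p 1 = 3" | "p 1 = 4" by auto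
  then show ?thesis
  proof cases
    case 1
    then have "p 2 = 1" using pp[of 1] by simp
    moreover have "p 3 = 4" using r(3) n(3) pp[of 3] 1 calculation by auto
    moreover have "p 4 = 3" using pp[of 3] calculation by simp
    ultimately have "p = v1" using 1 by (intro permutes_14_eqI[OF p perm(1)]) (simp_all add: transpose_def)
    then show ?thesis by simp
  next
    case 2
    then have "p 3 = 1" using pp[of 1] by simp
    moreover have "p 2 = 4" using r(2) n(2) pp[of 2] 2 calculation by auto
    moreover have "p 4 = 2" using pp[of 2] calculation by simp
    ultimately have "p = v2" using 2 by (intro permutes_14_eqI[OF p perm(2)]) (simp_all add: transpose_def)
    then show ?thesis by simp
  next
    case 3
    then have "p 4 = 1" using pp[of 1] by simp
    moreover have "p 2 = 3" using r(2) n(2) pp[of 2] 3 calculation by auto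
    moreover have "p 3 = 2" using pp[of 2] calculation by simp
    ultimately have "p = v3" using 3 by (intro permutes_14_eqI[OF p perm(3)]) (simp_all add: transpose_def)
    then show ?thesis by simp
  qed
qed

text \<open>The nontrivial elements are exactly the fixed-point-free involutions of four points, and
  this description is invariant under conjugation.\<close>

lemma V_normal:
  shows "{id, v1, v2, v3} \<lhd> S4"
proof -
  interpret S: group S4 by (rule sym_group_is_group)
  have mem: "v1 \<in> carrier S4" "v2 \<in> carrier S4" "v3 \<in> carrier S4" by (intro comp_S4 transpose_S4; simp)+
  have eqs: "v1 \<circ> v1 = id" "v2 \<circ> v2 = id" "v3 \<circ> v3 = id" "v1 \<circ> v2 = v2 \<circ> v1" "v1 \<circ> v2 = v3"
    by (auto simp: fun_eq_iff transpose_def)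
  have sub: "subgroup {id, v1, v2, v3} S4"
    using S.klein_subgroup[OF mem(1,2)] eqs by (simp add: S4_mult sym_group_one)
  have fixfree: "v i \<noteq> i" if "v \<in> {v1, v2, v3}" "i \<in> {1, 2, 3, 4::nat}" for v i
    using that by (auto simp: transpose_def)
  show ?thesis
  proof (rule S.normal_inv_iff[THEN iffD2], intro conjI ballI)
    show "subgroup {id, v1, v2, v3} S4" by (rule sub)
    fix g v assume g: "g \<in> carrier S4" and v: "v \<in> {id, v1, v2, v3}"
    \<comment> \<open>All later information about the conjugate comes from
      \<open>w \<circ> g = g \<circ> v\<close>, so no inverse permutation is computed.\<close>
    define w where "w = g \<otimes>\<^bsub>S4\<^esub> v \<otimes>\<^bsub>S4\<^esub> inv\<^bsub>S4\<^esub> g"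
    have vS: "v \<in> carrier S4" using v sub by (auto dest: subgroup.subset)
    note gv = S.m_closed[OF g vS] and gi = S.inv_closed[OF g]
    have "w \<otimes>\<^bsub>S4\<^esub> g = (g \<otimes>\<^bsub>S4\<^esub> v) \<otimes>\<^bsub>S4\<^esub> (inv\<^bsub>S4\<^esub> g \<otimes>\<^bsub>S4\<^esub> g)"
      unfolding w_def by (rule S.m_assoc[OF gv gi g])
    also have "\<dots> = g \<otimes>\<^bsub>S4\<^esub> v" unfolding S.l_inv[OF g] by (rule S.r_one[OF gv])
    finally have w: "w \<in> carrier S4" "w \<circ> g = g \<circ> v"
      using S.m_closed[OF gv gi] by (simp_all only: w_def S4_mult)
    have perm: "g permutes {1..4}" "w permutes {1..4}" using g w by (simp_all add: sym_group_carrier)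
    have gi: "\<exists>j. i = g j" for i using permutes_surj[OF perm(1)] by (meson surjD)
    have wg: "w (g j) = g (v j)" for j using fun_cong[OF w(2), of j] by simp
    show "g \<otimes>\<^bsub>S4\<^esub> v \<otimes>\<^bsub>S4\<^esub> inv\<^bsub>S4\<^esub> g \<in> {id, v1, v2, v3}"
    proof (cases "v = id")
      case True
      then have "w i = i" for i using gi[of i] wg by auto
      then have "w = id" by auto
      then show ?thesis by (simp add: w_def)
    next
      case False
      then have v': "v \<in> {v1, v2, v3}" using v by simp
      have vv: "v (v i) = i" for i using v' eqs(1-3) by (auto dest: fun_cong[where x = i])
      have "w \<in> {v1, v2, v3}"
      proof (rule double_transpositionI[OF perm(2)])
        show "w (w i) = i" for i using gi[of i] wg vv by auto
        fix i :: nat assume "i \<in> {1, 2, 3, 4}"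
        then have i: "i \<in> {1..4}" by auto
        obtain j where j: "i = g j" using gi by blast
        then have "j \<in> {1..4}" using permutes_in_image[OF perm(1), of j] i by simp
        then have "j \<in> {1, 2, 3, 4}" by auto
        then have "v j \<noteq> j" by (rule fixfree[OF v'])
        then show "w i \<noteq> i" using j wg permutes_inj[OF perm(1)] by (metis injD)
      qed
      then show ?thesis by (simp add: w_def)
    qed
  qed
qed

lemma W_subgroup: "subgroup {id, transpose 1 2, transpose 3 4, v1} S4"
proof -
  interpret S: group S4 by (rule sym_group_is_group)
  have "transpose (1::nat) 2 \<in> carrier S4" "transpose (3::nat) 4 \<in> carrier S4" by (intro transpose_S4; simp)+
  moreover have "transpose (1::nat) 2 \<circ> transpose 3 4 = transpose 3 4 \<circ> transpose 1 2"
    by (auto simp: fun_eq_iff transpose_def)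
  ultimately show ?thesis
    using S.klein_subgroup[of "transpose 1 2" "transpose 3 4"] by (simp add: S4_mult sym_group_one)
qed

lemma card_four_group:
  assumes "distinct (map (\<lambda>p. (p 1, p 2, p 3, p (4::nat))) [a, b, c, d :: nat \<Rightarrow> nat])"
  shows "card {a, b, c, d} = 4"
proof -
  have "distinct [a, b, c, d]" using assms by (simp only: distinct_map)
  then show ?thesis using distinct_card[of "[a, b, c, d]"] by simp
qed

section \<open>The action on two-element subsets\<close>

definition pairs :: "nat set set" where
  "pairs = {S. S \<subseteq> {1..4} \<and> card S = 2}"

lemma pairs_eq: "pairs = {{1, 2}, {3, 4}, {1, 3}, {2, 3}, {1, 4}, {2, 4}}"
proof
  show "pairs \<subseteq> {{1, 2}, {3, 4}, {1, 3}, {2, 3}, {1, 4}, {2, 4}}"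
  proof
    fix S assume "S \<in> pairs"
    then obtain x y where S: "S = {x, y}" "x \<noteq> y" "x \<in> {1..4}" "y \<in> {1..4}"
      by (auto simp: pairs_def card_2_iff)
    have "{1..4} = {1, 2, 3, 4::nat}" by auto
    then have "x \<in> {1, 2, 3, 4}" "y \<in> {1, 2, 3, 4}" using S by auto
    then show "S \<in> {{1, 2}, {3, 4}, {1, 3}, {2, 3}, {1, 4}, {2, 4}}"
      using S(1,2) by (elim insertE; simp add: insert_commute)
  qed
qed (auto simp: pairs_def)

lemma pairs_action: "group_action S4 pairs (\<lambda>p. restrict (image p) pairs)"
proof (rule group_actionI[OF sym_group_is_group])
  fix p S assume p: "p \<in> carrier S4" and S: "S \<in> pairs"
  have perm: "p permutes {1..4}" using p by (simp add: sym_group_carrier)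
  have "p ` S \<subseteq> p ` {1..4}" using S by (auto simp: pairs_def)
  then have "p ` S \<subseteq> {1..4}" using permutes_image[OF perm] by simp
  moreover have "card (p ` S) = card S"
    by (intro card_image permutes_inj_on[OF perm])
  ultimately show "p ` S \<in> pairs" using S by (simp add: pairs_def)
qed (auto simp: sym_group_one S4_mult image_comp)

section \<open>Both invariants of the given amalgam\<close>

theorem proposition4:
  fixes V W :: "(nat \<Rightarrow> nat) set"
    and \<phi> :: "(nat \<Rightarrow> nat) \<Rightarrow> (nat \<Rightarrow> nat)"
    and \<Gamma> :: "((nat \<Rightarrow> nat) + (nat \<Rightarrow> nat)) list set monoid"
  assumes V: "V = {id, transpose 1 2 \<circ> transpose 3 4, transpose 1 3 \<circ> transpose 2 4,
                   transpose 1 4 \<circ> transpose 2 3}"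
    and W: "W = {id, transpose 1 2, transpose 3 4, transpose 1 2 \<circ> transpose 3 4}"
    and iso: "\<phi> \<in> iso ((sym_group 4)\<lparr>carrier := V\<rparr>) ((sym_group 4)\<lparr>carrier := W\<rparr>)"
    and "\<phi> (transpose 1 2 \<circ> transpose 3 4) = transpose 1 2 \<circ> transpose 3 4"
    and "\<phi> (transpose 1 3 \<circ> transpose 2 4) = transpose 1 2"
    and "\<phi> (transpose 1 4 \<circ> transpose 2 3) = transpose 3 4"
    and \<Gamma>: "\<Gamma> = amalgamated_product (sym_group 4) (sym_group 4) V \<phi>"
  shows "growth_coefficient \<Gamma> = 1 / 4 \<and> euler_characteristic \<Gamma> = - 1 / 6"
proof -
  interpret S: group S4 by (rule sym_group_is_group)
  have V_normal: "V \<lhd> S4" unfolding V by (rule V_normal)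
  then have V_sub: "subgroup V S4" by (rule normal.axioms)
  have W_sub: "subgroup W S4" unfolding W by (rule W_subgroup)
  have bij_\<phi>: "bij_betw \<phi> V W" using iso by (simp add: iso_def)
  have \<phi>V: "\<phi> ` V = W" using bij_\<phi> by (simp add: bij_betw_def)
  have \<phi>_hom: "\<phi> \<in> hom (S4\<lparr>carrier := V\<rparr>) S4"
    using iso subgroup.subset[OF W_sub] by (auto simp: iso_def hom_def)
  have card_V: "card V = 4" unfolding V by (rule card_four_group) (simp add: transpose_def)
  have card_W: "card W = 4" unfolding W by (rule card_four_group) (simp add: transpose_def)
  have index: "card (rcosets\<^bsub>S4\<^esub> V) = 6" "card (rcosets\<^bsub>S4\<^esub> W) = 6"
    using S.lagrange[OF V_sub] S.lagrange[OF W_sub] card_V card_W card_S4 by (simp_all add: order_def)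
  obtain t where t: "t 0 = \<one>\<^bsub>S4\<^esub>" "\<And>i. i < 6 \<Longrightarrow> t i \<in> carrier S4"
    "bij_betw (\<lambda>(a, i). a \<otimes>\<^bsub>S4\<^esub> t i) (V \<times> {..<6::nat}) (carrier S4)"
    using S.exists_transversal[OF V_sub card_S4(2) index(1)] by metis
  obtain u where u: "u 0 = \<one>\<^bsub>S4\<^esub>" "\<And>i. i < 6 \<Longrightarrow> u i \<in> carrier S4"
    "bij_betw (\<lambda>(a, i). a \<otimes>\<^bsub>S4\<^esub> u i) (W \<times> {..<6::nat}) (carrier S4)"
    using S.exists_transversal[OF W_sub card_S4(2) index(2)] by metis
  have "bij_betw (map_prod \<phi> id) (V \<times> {..<6}) (W \<times> {..<6::nat})"
    by (rule bij_betw_map_prod[OF bij_\<phi> bij_betw_id])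
  from bij_betw_trans[OF this u(3)]
  have u': "bij_betw (\<lambda>(a, i). \<phi> a \<otimes>\<^bsub>S4\<^esub> u i) (V \<times> {..<6::nat}) (carrier S4)"
    by (rule bij_betw_cong[THEN iffD1, rotated]) auto
  interpret amalgam_transversal S4 S4 V \<phi> "{..<6::nat}" 0 t u
    using V_sub W_sub \<phi>V \<phi>_hom t u u' by unfold_locales
      (auto dest: subgroup.subset intro: subgroup.m_closed subgroup.one_closed subgroup.m_inv_closed)
  have \<Gamma>_eq: "\<Gamma> = amalgamated_product S4 S4 V \<phi>" by (rule \<Gamma>)
  have "euler_characteristic \<Gamma> = (2 - of_nat (card {..<6::nat})) / of_nat (card (carrier S4))"
    unfolding \<Gamma>_eq by (rule euler_characteristic_amalgam) (simp_all add: card_S4)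
  then have chi: "euler_characteristic \<Gamma> = - 1 / 6" by (simp add: card_S4)
  have orbits: "4 * card (orbits (S4\<lparr>carrier := V\<rparr>) {..<n} (\<lambda>g. \<Phi> (inl g)))
      \<le> 4 * card (orbits S4 {..<n} (\<lambda>g. \<Phi> (inl g))) + 4 * card (orbits S4 {..<n} (\<lambda>h. \<Phi> (inr h))) + n"
    if "group_action (amalgamated_product S4 S4 V \<phi>) {..<n} \<Phi>" for n \<Phi>
  proof -
    \<comment> \<open>An element of \<open>V\<close> and its image under \<open>\<phi>\<close> act
      by the same permutation, so both inequalities speak about the same orbit number a. Twice the
      first plus the second is 12 a <= 12 g + 12 h + 3 n.\<close>
    have "orbit (S4\<lparr>carrier := V\<rparr>) (\<lambda>g. \<Phi> (inl g)) x = (\<lambda>g. \<Phi> (inl g) x) ` V"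
      "orbit (S4\<lparr>carrier := W\<rparr>) (\<lambda>h. \<Phi> (inr h)) x = (\<lambda>h. \<Phi> (inr h) x) ` W" for x
      by (auto simp: orbit_def)
    then have "orbit (S4\<lparr>carrier := V\<rparr>) (\<lambda>g. \<Phi> (inl g)) x = orbit (S4\<lparr>carrier := W\<rparr>) (\<lambda>h. \<Phi> (inr h)) x" for x
      by (simp add: \<phi>V[symmetric] image_image inl_eq_inr)
    then have "orbits (S4\<lparr>carrier := V\<rparr>) {..<n} (\<lambda>g. \<Phi> (inl g)) = orbits (S4\<lparr>carrier := W\<rparr>) {..<n} (\<lambda>h. \<Phi> (inr h))"
      by (simp add: orbits_def)
    then show ?thesis
      using four_orbits[OF restrict_action(1)[OF that] finite_lessThan V V_sub]
        orbits_inequality[OF restrict_action(2)[OF that] finite_lessThan W W_sub] by simp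
  qed
  have upper: "growth_coefficient \<Gamma> \<le> ereal (1 / 4)"
  proof (rule growth_coefficient_le)
    fix n :: nat assume n: "n \<ge> 1"
    note le = card_actions_le[OF card_S4(2) card_S4(2) V_sub n orbits]
    have "real (subgroup_count \<Gamma> n * fact (n - 1)) \<le> real (card (actions \<Gamma> n))"
      unfolding of_nat_le_iff \<Gamma>_eq by (rule \<Gamma>.subgroup_count_le_actions(2)[OF n le(1)])
    then show "real (subgroup_count \<Gamma> n) * fact (n - 1)
        \<le> (8 * 2 ^ card (carrier S4) * 2 ^ card (carrier S4)) ^ n * real n powr ((1 + 1 / 4) * real n)"
      using le(2) unfolding \<Gamma>_eq by simp
  qed (simp add: card_S4)
  \<comment> \<open>The pairs fixed by \<open>W\<close>. The transpositions (2 3) and (1 4) carry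
    {1, 3}, which lies in the free orbit, to {1, 2} and {3, 4}.\<close>
  define p where "p b = (if b then {1, 2} else {3, 4 :: nat})" for b
  define h where "h b = (if b then transpose 2 3 else transpose 1 (4 :: nat))" for b
  let ?\<psi> = "\<lambda>g. restrict (image g) pairs"
  \<comment> \<open>Here 9 = 2 * 6 - 3 and 36 = 24 + 2 * 6, with six the index of V; the quotient
    9/36 is the growth coefficient.\<close>
  have "fact k ^ 9 \<le> subgroup_count \<Gamma> (36 * k)" if k: "k \<ge> 2" for k
  proof -
    have "fact k ^ (2 * card {..<6::nat} - 3) \<le> subgroup_count (amalgamated_product S4 S4 V \<phi>) ((card (carrier S4) + 2 * card {..<6::nat}) * k)"
    proof (rule subgroup_count_ge[OF V_normal pairs_action])
      show "p True \<in> pairs" "p False \<in> pairs" "p True \<noteq> p False" "{1, 3} \<in> pairs"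
        by (auto simp: p_def pairs_eq doubleton_eq_iff)
      then have pb: "p b \<in> pairs" for b by (cases b) auto
      show "?\<psi> (\<phi> a) (p b) = p b" if "a \<in> V" for a b
      proof -
        have "\<phi> a \<in> W" using that \<phi>V by blast
        then show ?thesis using pb[of b] by (auto simp: W p_def transpose_def)
      qed
      \<comment> \<open>The four elements of \<open>W\<close> produce four different pairs, so
        counting gives injectivity.\<close>
      have "bij_betw (\<lambda>w. ?\<psi> w {1, 3}) W (pairs - {p True, p False})"
      proof -
        have eq: "pairs - {p True, p False} = {{1, 3}, {2, 3}, {1, 4}, {2, 4}}"
          by (auto simp: pairs_eq p_def doubleton_eq_iff)
        have im: "(\<lambda>w. ?\<psi> w {1, 3}) ` W = {{1, 3}, {2, 3}, {1, 4}, {2, 4}}"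
          using \<open>{1, 3} \<in> pairs\<close> by (simp add: W transpose_def insert_commute)
        have "card {{1, 3}, {2, 3}, {1, 4}, {2, 4 :: nat}} = 4" by (simp add: doubleton_eq_iff)
        then have "inj_on (\<lambda>w. ?\<psi> w {1, 3}) W"
          using im card_W by (intro eq_card_imp_inj_on) (auto simp: W)
        then show ?thesis using im eq by (simp add: bij_betw_def)
      qed
      from bij_betw_trans[OF bij_\<phi> this]
      show "bij_betw (\<lambda>a. ?\<psi> (\<phi> a) {1, 3}) V (pairs - {p True, p False})" by (simp add: comp_def)
      show "h b \<in> carrier S4" for b by (simp add: h_def transpose_S4)
      show "?\<psi> (h b) {1, 3} = p b" for b
        using \<open>{1, 3} \<in> pairs\<close> by (auto simp: h_def p_def transpose_def)
      \<comment> \<open>The upper bound on the number of actions supplies the finiteness needed for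
        the lower bound.\<close>
      show "finite {S. subgroup S (amalgamated_product S4 S4 V \<phi>) \<and> card (rcosets\<^bsub>amalgamated_product S4 S4 V \<phi>\<^esub> S)
          = (card (carrier S4) + 2 * card {..<6::nat}) * k}"
        using k card_S4 by (intro \<Gamma>.subgroup_count_le_actions(1) card_actions_le(1) V_sub orbits) auto
      show "(1::nat) \<in> {..<6}" "(1::nat) \<noteq> 0" "k \<ge> 1" using k by auto
    qed (simp_all add: card_S4)
    then show ?thesis by (simp add: card_S4 \<Gamma>_eq)
  qed
  then have "ereal (real 9 / real 36) \<le> growth_coefficient \<Gamma>"
    by (intro growth_coefficient_ge) auto
  then have "growth_coefficient \<Gamma> = ereal (1 / 4)" using upper by simp
  moreover have "(1 / 4 :: ereal) = ereal (1 / 4)" unfolding one_ereal_def numeral_eq_ereal by simp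
  ultimately show ?thesis using chi by simp
qed

end
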